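(* Let $a,d\in\mathbb{R}$ and $A_1=\begin{pmatrix} a & 1\\ 1 & d\end{pmatrix}$. The following statements are true. (a) If $ad=1$ then $\mathrm{Spec}(A_1D)=\mathbb{C}$. (b) If $ad>1$ and $a,d>0$ then $A_1D$ is similar to a non-negative operator, so that $\mathrm{Spec}(A_1D)\subset[0,\infty)$. (c) If $ad>1$ and $a,d<0$ then $-A_1D$ is similar to a non-negative self-adjoint operator, so that $\mathrm{Spec}(A_1D)\subset(-\infty,0]$. (d) If $ad<1$ then $\mathrm{Spec}(A_1D)\subset\mathbb{R}$.
   Context: Let $W^{2,2}$ be the Sobolev space of all $f\in L^2(0,1)\otimes\mathbb{C}^2$ whose generalized derivative $f''$ lies in $L^2(0,1)\otimes\mathbb{C}^2$, and write $f=\begin{pmatrix}\phi\\ \gamma\end{pmatrix}$. The operator $D$ acts on $L^2(0,1)\otimes\mathbb{C}^2$ by $Df=-f''$ with domain $\mathrm{Dom}(D)=\{f\in W^{2,2}:\phi(0)=\phi(1)=0,\ \gamma'(0)=\gamma'(1)=0\}$. For a constant $2\times2$ matrix $A$, $AD$ is the operator $f\mapsto -Af''$ with domain $\mathrm{Dom}(D)$. $\mathrm{Spec}(K)$ denotes the spectrum of $K$, i.e. the complement of the set of $z$ for which $K-z$ is a bijection from $\mathrm{Dom}(K)$ onto the Hilbert space with bounded inverse (so an operator that is not closed has spectrum $\mathbb{C}$). An operator $K$ is called non-negative if $K=K^*$ and $\mathrm{Spec}(K)\subset[0,\infty)$. Two operators $K,L$ are similar if $K=ULU^{-1}$ (with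 matching domains) for some bounded invertible operator $U$ with bounded inverse. *)

theory Defs
  imports "HOL-Analysis.Analysis"
begin

section \<open>The Hilbert space of square-integrable functions from (0,1) to complex 2-vectors\<close>

abbreviation I01 :: "real measure" where
  "I01 \<equiv> lebesgue_on {0<..<1}"

definition square_integrable :: "(real \<Rightarrow> complex ^ 2) \<Rightarrow> bool" where
  "square_integrable f \<longleftrightarrow>
     f \<in> borel_measurable I01 \<and> integrable I01 (\<lambda>x. (norm (f x))\<^sup>2)"

lemma square_integrable_zero: "square_integrable (\<lambda>x. 0)"
  by (simp add: square_integrable_def)

lemma square_integrable_add:
  assumes "square_integrable f" "square_integrable g"
  shows "square_integrable (\<lambda>x. f x + g x)"
  unfolding square_integrable_def
proof
  have [measurable]: "f \<in> borel_measurable I01" "g \<in> borel_measurable I01"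
    using assms by (auto simp: square_integrable_def)
  show "(\<lambda>x. f x + g x) \<in> borel_measurable I01" by measurable
  have A: "(norm (f x + g x))\<^sup>2 \<le> 2 * (norm (f x))\<^sup>2 + 2 * (norm (g x))\<^sup>2" for x
  proof -
    have "(norm (f x + g x))\<^sup>2 \<le> (norm (f x) + norm (g x))\<^sup>2"
      by (intro power_mono norm_triangle_ineq) simp
    also have "\<dots> \<le> 2 * (norm (f x))\<^sup>2 + 2 * (norm (g x))\<^sup>2"
      using sum_squares_bound[of "norm (f x)" "norm (g x)"] by (simp add: power2_sum)
    finally show ?thesis .
  qed
  have B: "integrable I01 (\<lambda>x. 2 * (norm (f x))\<^sup>2 + 2 * (norm (g x))\<^sup>2)"
    using assms by (auto simp: square_integrable_def)
  have M: "(\<lambda>x. (norm (f x + g x))\<^sup>2) \<in> borel_measurable I01" by measurable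
  show "integrable I01 (\<lambda>x. (norm (f x + g x))\<^sup>2)"
    by (rule Bochner_Integration.integrable_bound[OF B M]) (use A in \<open>simp add: abs_of_nonneg\<close>)
qed

lemma square_integrable_linear:
  fixes T :: "complex ^ 2 \<Rightarrow> complex ^ 2"
  assumes "square_integrable f" "bounded_linear T"
  shows "square_integrable (\<lambda>x. T (f x))"
  unfolding square_integrable_def
proof
  have [measurable]: "f \<in> borel_measurable I01"
    using assms by (auto simp: square_integrable_def)
  have [measurable]: "T \<in> borel_measurable borel"
    using assms(2) by (intro borel_measurable_continuous_onI linear_continuous_on)
  show "(\<lambda>x. T (f x)) \<in> borel_measurable I01" by measurable
  obtain K where K: "\<And>x. norm (T x) \<le> norm x * K"
    using assms(2) bounded_linear.bounded by blast
  have A: "(norm (T (f x)))\<^sup>2 \<le> K\<^sup>2 * (norm (f x))\<^sup>2" for x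
    using power_mono[OF K[of "f x"], of 2] by (simp add: power_mult_distrib mult.commute)
  have B: "integrable I01 (\<lambda>x. K\<^sup>2 * (norm (f x))\<^sup>2)"
    using assms by (auto simp: square_integrable_def)
  have M: "(\<lambda>x. (norm (T (f x)))\<^sup>2) \<in> borel_measurable I01" by measurable
  show "integrable I01 (\<lambda>x. (norm (T (f x)))\<^sup>2)"
    by (rule Bochner_Integration.integrable_bound[OF B M]) (use A in \<open>simp add: abs_of_nonneg\<close>)
qed

lemma bounded_linear_matrix_complex:
  "bounded_linear (\<lambda>v. (A :: complex ^ 2 ^ 2) *v v)"
  by (rule linear_conv_bounded_linear[THEN iffD1])
    (auto intro!: linearI simp: vec_eq_iff matrix_vector_mult_def sum.distrib scaleR_sum_right
      distrib_left)

lemma bounded_linear_cscale: "bounded_linear (\<lambda>v. (c :: complex) *s (v :: complex ^ 2))"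
  by (rule linear_conv_bounded_linear[THEN iffD1])
    (auto intro!: linearI simp: vec_eq_iff distrib_left)

lemma square_integrable_matrix:
  "square_integrable f \<Longrightarrow> square_integrable (\<lambda>x. A *v f x)"
  by (rule square_integrable_linear[OF _ bounded_linear_matrix_complex])

lemma square_integrable_cscale:
  "square_integrable f \<Longrightarrow> square_integrable (\<lambda>x. c *s f x)"
  by (rule square_integrable_linear[OF _ bounded_linear_cscale])

lemma square_integrable_scaleR:
  "square_integrable f \<Longrightarrow> square_integrable (\<lambda>x. r *\<^sub>R f x)"
  by (rule square_integrable_linear[OF _ bounded_linear_scaleR_right])

definition cdot :: "complex ^ 2 \<Rightarrow> complex ^ 2 \<Rightarrow> complex" where
  "cdot v w = (\<Sum>i\<in>UNIV. v $ i * cnj (w $ i))"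

lemma integrable_cdot:
  assumes "square_integrable f" "square_integrable g"
  shows "integrable I01 (\<lambda>x. cdot (f x) (g x))"
  unfolding cdot_def
proof (rule Bochner_Integration.integrable_sum)
  fix i :: 2
  have [measurable]: "f \<in> borel_measurable I01" "g \<in> borel_measurable I01"
    using assms by (auto simp: square_integrable_def)
  have [measurable]: "(\<lambda>v :: complex ^ 2. v $ i) \<in> borel_measurable borel"
    by (intro borel_measurable_continuous_onI continuous_intros)
  have [measurable]: "(\<lambda>v :: complex ^ 2. cnj (v $ i)) \<in> borel_measurable borel"
    by (intro borel_measurable_continuous_onI continuous_intros)
  have A: "norm (f x $ i * cnj (g x $ i)) \<le> (norm (f x))\<^sup>2 + (norm (g x))\<^sup>2" for x
  proof -
    have "norm (f x $ i * cnj (g x $ i)) \<le> norm (f x) * norm (g x)"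
      by (auto simp: norm_mult intro!: mult_mono Finite_Cartesian_Product.norm_nth_le)
    also have "\<dots> \<le> 2 * norm (f x) * norm (g x)" by simp
    also have "\<dots> \<le> (norm (f x))\<^sup>2 + (norm (g x))\<^sup>2" by (rule sum_squares_bound)
    finally show ?thesis .
  qed
  have B: "integrable I01 (\<lambda>x. (norm (f x))\<^sup>2 + (norm (g x))\<^sup>2)"
    using assms by (auto simp: square_integrable_def)
  have M: "(\<lambda>x. f x $ i * cnj (g x $ i)) \<in> borel_measurable I01" by measurable
  show "integrable I01 (\<lambda>x. f x $ i * cnj (g x $ i))"
    by (rule Bochner_Integration.integrable_bound[OF B M]) (use A in \<open>simp add: abs_of_nonneg\<close>)
qed

lemma Re_cdot: "Re (cdot v w) = v \<bullet> w"
  by (simp add: cdot_def inner_vec_def inner_complex_def)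

definition l2_rel :: "(real \<Rightarrow> complex ^ 2) \<Rightarrow> (real \<Rightarrow> complex ^ 2) \<Rightarrow> bool" where
  "l2_rel f g \<longleftrightarrow> square_integrable f \<and> square_integrable g \<and> (AE x in I01. f x = g x)"

lemma part_equivp_l2_rel: "part_equivp l2_rel"
proof (rule part_equivpI)
  show "\<exists>f. l2_rel f f"
    by (rule exI[of _ "\<lambda>x. 0"]) (simp add: l2_rel_def square_integrable_zero)
  show "symp l2_rel" by (auto intro!: sympI simp: l2_rel_def elim: AE_mp)
  show "transp l2_rel"
    by (rule transpI) (auto simp: l2_rel_def elim: AE_mp)
qed

quotient_type l2 = "real \<Rightarrow> complex ^ 2" / partial: l2_rel
  by (rule part_equivp_l2_rel)

lift_definition cinner :: "l2 \<Rightarrow> l2 \<Rightarrow> complex" is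
  "\<lambda>f g. LINT x|I01. cdot (f x) (g x)"
proof -
  fix f f' g g' assume "l2_rel f f'" "l2_rel g g'"
  then have sq: "square_integrable f" "square_integrable g" "square_integrable f'"
      "square_integrable g'" and ae: "AE x in I01. f x = f' x" "AE x in I01. g x = g' x"
    by (auto simp: l2_rel_def)
  have "AE x in I01. cdot (f x) (g x) = cdot (f' x) (g' x)"
    using ae by eventually_elim simp
  then show "(LINT x|I01. cdot (f x) (g x)) = (LINT x|I01. cdot (f' x) (g' x))"
    using sq by (intro integral_cong_AE borel_measurable_integrable integrable_cdot)
qed

lift_definition mat_app :: "complex ^ 2 ^ 2 \<Rightarrow> l2 \<Rightarrow> l2" is "\<lambda>A f x. A *v f x"
  by (auto simp: l2_rel_def intro!: square_integrable_matrix)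

lift_definition scaleC :: "complex \<Rightarrow> l2 \<Rightarrow> l2" (infixr \<open>*\<^sub>C\<close> 75) is "\<lambda>c f x. c *s f x"
  by (auto simp: l2_rel_def intro!: square_integrable_cscale)

instantiation l2 :: real_inner
begin

lift_definition zero_l2 :: l2 is "\<lambda>x. 0"
  by (simp add: l2_rel_def square_integrable_zero)

lift_definition plus_l2 :: "l2 \<Rightarrow> l2 \<Rightarrow> l2" is "\<lambda>f g x. f x + g x"
  by (auto simp: l2_rel_def intro!: square_integrable_add)

lift_definition scaleR_l2 :: "real \<Rightarrow> l2 \<Rightarrow> l2" is "\<lambda>c f x. c *\<^sub>R f x"
  by (auto simp: l2_rel_def intro!: square_integrable_scaleR)

definition uminus_l2 :: "l2 \<Rightarrow> l2" where "uminus_l2 f = (-1) *\<^sub>R f"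
definition minus_l2 :: "l2 \<Rightarrow> l2 \<Rightarrow> l2" where "minus_l2 f g = f + (-1) *\<^sub>R g"
definition inner_l2 :: "l2 \<Rightarrow> l2 \<Rightarrow> real" where "inner_l2 f g = Re (cinner f g)"
definition norm_l2 :: "l2 \<Rightarrow> real" where "norm_l2 f = sqrt (f \<bullet> f)"
definition sgn_l2 :: "l2 \<Rightarrow> l2" where "sgn_l2 f = inverse (norm f) *\<^sub>R f"
definition dist_l2 :: "l2 \<Rightarrow> l2 \<Rightarrow> real" where "dist_l2 f g = norm (f - g)"
definition uniformity_l2 :: "(l2 \<times> l2) filter" where
  "uniformity_l2 = (INF e\<in>{0<..}. principal {(x, y). dist x y < e})"
definition open_l2 :: "l2 set \<Rightarrow> bool" where
  "open_l2 U \<longleftrightarrow> (\<forall>x\<in>U. eventually (\<lambda>(x', y). x' = x \<longrightarrow> y \<in> U) uniformity)"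

instance
proof
  fix f g h :: l2 and a b :: real
  show "f + g + h = f + (g + h)"
    by transfer (auto simp: l2_rel_def algebra_simps intro!: square_integrable_add)
  show "f + g = g + f"
    by transfer (auto simp: l2_rel_def algebra_simps intro!: square_integrable_add)
  show "0 + f = f"
    by transfer (auto simp: l2_rel_def)
  show "- f + f = 0"
    unfolding uminus_l2_def by transfer (auto simp: l2_rel_def square_integrable_zero)
  show "f - g = f + - g" by (simp add: minus_l2_def uminus_l2_def)
  show "a *\<^sub>R (f + g) = a *\<^sub>R f + a *\<^sub>R g"
    by transfer (auto simp: l2_rel_def scaleR_right_distrib
      intro!: square_integrable_add square_integrable_scaleR)
  show "(a + b) *\<^sub>R f = a *\<^sub>R f + b *\<^sub>R f"
    by transfer (auto simp: l2_rel_def scaleR_left_distrib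
      intro!: square_integrable_add square_integrable_scaleR)
  show "a *\<^sub>R b *\<^sub>R f = (a * b) *\<^sub>R f"
    by transfer (auto simp: l2_rel_def
      intro!: square_integrable_scaleR)
  show "1 *\<^sub>R f = f" by transfer (auto simp: l2_rel_def)
  show "sgn f = inverse (norm f) *\<^sub>R f" by (simp add: sgn_l2_def)
  show "dist f g = norm (f - g)" by (simp add: dist_l2_def)
  show "uniformity = (INF e\<in>{0<..}. principal {(x, y :: l2). dist x y < e})"
    by (simp add: uniformity_l2_def)
  fix U :: "l2 set"
  show "open U = (\<forall>x\<in>U. \<forall>\<^sub>F (x', y) in uniformity. x' = x \<longrightarrow> y \<in> U)"
    by (simp add: open_l2_def)
  have inner: "f \<bullet> g = (LINT x|I01. rep_l2 f x \<bullet> rep_l2 g x)"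
    "integrable I01 (\<lambda>x. rep_l2 f x \<bullet> rep_l2 g x)" for f g
  proof -
    have "square_integrable (rep_l2 f)" "square_integrable (rep_l2 g)"
      using Quotient_rep_reflp[OF Quotient_l2] by (auto simp: l2_rel_def)
    note I = integrable_cdot[OF this]
    show "f \<bullet> g = (LINT x|I01. rep_l2 f x \<bullet> rep_l2 g x)"
      using integral_Re[OF I] by (simp add: inner_l2_def cinner.rep_eq Re_cdot)
    show "integrable I01 (\<lambda>x. rep_l2 f x \<bullet> rep_l2 g x)"
      using integrable_Re[OF I] by (simp add: Re_cdot)
  qed
  have cong: "(LINT x|I01. u x \<bullet> rep_l2 g x) = (LINT x|I01. v x \<bullet> rep_l2 g x)"
    if "l2_rel u v" for u v and g
  proof (rule integral_cong_AE)
    have "rep_l2 g \<in> borel_measurable I01"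
      using Quotient_rep_reflp[OF Quotient_l2, of g] by (auto simp: l2_rel_def square_integrable_def)
    with that show "(\<lambda>x. u x \<bullet> rep_l2 g x) \<in> borel_measurable I01"
      "(\<lambda>x. v x \<bullet> rep_l2 g x) \<in> borel_measurable I01"
      by (auto simp: l2_rel_def square_integrable_def)
    show "AE x in I01. u x \<bullet> rep_l2 g x = v x \<bullet> rep_l2 g x"
      using that by (auto simp: l2_rel_def)
  qed
  have sq: "square_integrable (rep_l2 f)" for f
    using Quotient_rep_reflp[OF Quotient_l2] by (auto simp: l2_rel_def)
  have rep_abs: "l2_rel (rep_l2 (abs_l2 u)) u" if "square_integrable u" for u
    by (rule Quotient_rep_abs[OF Quotient_l2]) (simp add: l2_rel_def that)
  show "f \<bullet> g = g \<bullet> f" by (simp add: inner(1) inner_commute)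
  show "(f + g) \<bullet> h = f \<bullet> h + g \<bullet> h"
  proof -
    have "l2_rel (rep_l2 (f + g)) (\<lambda>x. rep_l2 f x + rep_l2 g x)"
      unfolding plus_l2_def by (simp add: rep_abs sq square_integrable_add)
    from cong[OF this] show ?thesis
      by (simp add: inner(1) inner_add_left inner(2))
  qed
  show "a *\<^sub>R f \<bullet> g = a * (f \<bullet> g)"
  proof -
    have "l2_rel (rep_l2 (a *\<^sub>R f)) (\<lambda>x. a *\<^sub>R rep_l2 f x)"
      unfolding scaleR_l2_def
      by (simp add: rep_abs sq square_integrable_scaleR)
    from cong[OF this] show ?thesis by (simp add: inner(1))
  qed
  show "0 \<le> f \<bullet> f" by (simp add: inner(1))
  show "f \<bullet> f = 0 \<longleftrightarrow> f = 0"
  proof -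
    have "f \<bullet> f = 0 \<longleftrightarrow> (AE x in I01. rep_l2 f x \<bullet> rep_l2 f x = 0)"
      unfolding inner(1) by (rule integral_nonneg_eq_0_iff_AE[OF inner(2)]) simp
    also have "\<dots> \<longleftrightarrow> l2_rel (rep_l2 f) (\<lambda>x. 0)"
      by (simp add: l2_rel_def sq square_integrable_zero)
    also have "\<dots> \<longleftrightarrow> f = 0"
      using Quotient_rel_abs2[OF Quotient_l2]  Quotient_abs_rep[OF Quotient_l2, of f]
        Quotient_rel[OF Quotient_l2, of "rep_l2 f" "\<lambda>x. 0"] sq[of f]
      by (auto simp: zero_l2_def l2_rel_def square_integrable_zero)
    finally show ?thesis .
  qed
  show "norm f = sqrt (f \<bullet> f)" by (simp add: norm_l2_def)
qed

end


section \<open>Unbounded operators\<close>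

text \<open>
  An operator is a partial function whose domain is its domain of definition; equality of
  operators thus includes equality of domains.
\<close>

type_synonym operator = "l2 \<rightharpoonup> l2"

definition linear_operator :: "operator \<Rightarrow> bool" where
  "linear_operator K \<longleftrightarrow>
     0 \<in> dom K \<and>
     (\<forall>f\<in>dom K. \<forall>g\<in>dom K. K (f + g) = Some (the (K f) + the (K g))) \<and>
     (\<forall>f\<in>dom K. \<forall>c. K (c *\<^sub>C f) = Some (c *\<^sub>C the (K f)))"

definition densely_defined :: "operator \<Rightarrow> bool" where
  "densely_defined K \<longleftrightarrow> closure (dom K) = UNIV"

definition bounded_clinear :: "(l2 \<Rightarrow> l2) \<Rightarrow> bool" where
  "bounded_clinear T \<longleftrightarrow> bounded_linear T \<and> (\<forall>c f. T (c *\<^sub>C f) = c *\<^sub>C T f)"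

definition neg_op :: "operator \<Rightarrow> operator" where
  "neg_op K = (\<lambda>f. map_option uminus (K f))"

text \<open>
  The vector in the adjoint's value is unique, and hence the description meaningful, exactly
  when the operator is densely defined.
\<close>

definition adjoint_op :: "operator \<Rightarrow> operator" where
  "adjoint_op K = (\<lambda>u.
     if \<exists>v. \<forall>f\<in>dom K. cinner (the (K f)) u = cinner f v
     then Some (THE v. \<forall>f\<in>dom K. cinner (the (K f)) u = cinner f v)
     else None)"

definition self_adjoint :: "operator \<Rightarrow> bool" where
  "self_adjoint K \<longleftrightarrow> linear_operator K \<and> densely_defined K \<and> K = adjoint_op K"

definition resolvent_set :: "operator \<Rightarrow> complex set" where
  "resolvent_set K = {z.
     bij_betw (\<lambda>f. the (K f) - z *\<^sub>C f) (dom K) UNIV \<and>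
     bounded_clinear (inv_into (dom K) (\<lambda>f. the (K f) - z *\<^sub>C f))}"

definition spec :: "operator \<Rightarrow> complex set" where
  "spec K = - resolvent_set K"

definition nonneg_operator :: "operator \<Rightarrow> bool" where
  "nonneg_operator K \<longleftrightarrow> self_adjoint K \<and> spec K \<subseteq> complex_of_real ` {0..}"

definition similar :: "operator \<Rightarrow> operator \<Rightarrow> bool" where
  "similar K L \<longleftrightarrow>
     (\<exists>U. bounded_clinear U \<and> bij U \<and> bounded_clinear (inv U) \<and>
          K = (\<lambda>f. map_option U (L (inv U f))))"


section \<open>The Sobolev space and the operators AD\<close>

definition test_function :: "(real \<Rightarrow> real) \<Rightarrow> bool" where
  "test_function \<psi> \<longleftrightarrow>
     (\<forall>n x. (deriv ^^ n) \<psi> field_differentiable (at x)) \<and>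
     (\<exists>a b. 0 < a \<and> b < 1 \<and> (\<forall>x. x \<notin> {a..b} \<longrightarrow> \<psi> x = 0))"

definition has_weak_deriv2 :: "l2 \<Rightarrow> l2 \<Rightarrow> bool" where
  "has_weak_deriv2 f g \<longleftrightarrow>
     (\<forall>\<psi>. test_function \<psi> \<longrightarrow>
        (LINT x|I01. (deriv ^^ 2) \<psi> x *\<^sub>R rep_l2 f x) = (LINT x|I01. \<psi> x *\<^sub>R rep_l2 g x))"

definition W22 :: "l2 set" where
  "W22 = {f. \<exists>g. has_weak_deriv2 f g}"

definition weak_deriv2 :: "l2 \<Rightarrow> l2" where
  "weak_deriv2 f = (THE g. has_weak_deriv2 f g)"

text \<open>
  Boundary values are those of the continuously differentiable representative on the closed
  interval (one-sided derivatives at the end points); it exists and is unique for every element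
  of the Sobolev space.
\<close>

definition C1_representative ::
    "l2 \<Rightarrow> (real \<Rightarrow> complex ^ 2) \<Rightarrow> (real \<Rightarrow> complex ^ 2) \<Rightarrow> bool" where
  "C1_representative f F F' \<longleftrightarrow>
     (AE x in I01. rep_l2 f x = F x) \<and>
     (\<forall>x\<in>{0..1}. (F has_vector_derivative F' x) (at x within {0..1})) \<and>
     continuous_on {0..1} F'"

definition Dom_D :: "l2 set" where
  "Dom_D = {f \<in> W22. \<exists>F F'. C1_representative f F F' \<and>
     F 0 $ 1 = 0 \<and> F 1 $ 1 = 0 \<and> F' 0 $ 2 = 0 \<and> F' 1 $ 2 = 0}"

definition op_AD :: "complex ^ 2 ^ 2 \<Rightarrow> operator" where
  "op_AD A = (\<lambda>f. if f \<in> Dom_D then Some (- mat_app A (weak_deriv2 f)) else None)"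

definition A1 :: "real \<Rightarrow> real \<Rightarrow> complex ^ 2 ^ 2" where
  "A1 a d = vector [vector [complex_of_real a, 1], vector [1, complex_of_real d]]"

end

theory Submission
  imports Defs
begin

text \<open>
  Let \<open>A\<close> be invertible. An eigenbasis of \<open>A\<close> splits the equation \<open>- A f'' - z f = g\<close> into two
  scalar oscillator equations, solved explicitly by variation of constants. The conditions at \<open>0\<close>
  leave two free parameters, and those at \<open>1\<close> give a \<open>2 \<times> 2\<close> linear system for them; hence \<open>z\<close> lies in
  the resolvent set as soon as \<open>A D - z\<close> is injective on the domain. An element \<open>f\<close> of the kernel
  satisfies \<open>\<integral>\<bar>f'\<bar>\<^sup>2 = z \<langle>A\<^sup>-\<^sup>1 f, f\<rangle>\<close> with both quadratic forms real, which gives the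
  location of the spectrum: for indefinite \<open>A\<close> it is real, and for \<open>\<plusminus>A\<close> positive definite it lies in the
  corresponding half-line.

  If \<open>\<plusminus>A = S\<^sup>2\<close> with \<open>S\<close> symmetric, then \<open>\<plusminus>A D\<close> is similar to \<open>S D S\<close>, which is
  symmetric, densely defined and has \<open>-1\<close> in its resolvent set, and is therefore self-adjoint. If
  \<open>A\<close> is singular, a linear functional annihilating the range of \<open>A\<close> maps the range of \<open>A D - z\<close> into
  the functions with a continuous representative, so \<open>A D - z\<close> is not surjective.
\<close>

section \<open>Integration by parts against an indefinite integral\<close>

text \<open>The second derivative of an element of the domain is only a square-integrable class, so
  \<open>F'\<close> need not be differentiable everywhere. It is therefore carried in the integrated
  form \<open>F' x = F' 0 + integral {0..x} w\<close>, and calculus is done with indefinite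
  integrals of merely integrable functions. The splitting works because the off-diagonal entries 1
  of \<open>A1\<close> force two distinct real eigenvalues, with eigenvectors of first component 1.
  The frequencies are square roots of z / \<mu> and appear in denominators, so z = 0 is set apart.
  It is an eigenvalue, with the constant (0, 1) as eigenvector, and lies in each set claimed to
  contain the spectrum. As only two parameters are free, injectivity amounts to a non-zero
  determinant, and Cramer's rule gives the bounded inverse. The similarity is S^{-1} (S^2 D) S = S D
  S on the preimage of the domain under S, a form in which symmetry is visible.\<close>

lemma integral_has_vector_derivative_Icc:
  fixes F :: "real \<Rightarrow> 'a::euclidean_space"
  assumes "\<And>x. x \<in> {0..1} \<Longrightarrow> (F has_vector_derivative F' x) (at x within {0..1})"
    and "0 \<le> x" "x \<le> y" "y \<le> 1"
  shows "integral {x..y} F' = F y - F x" "F' integrable_on {x..y}"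
proof -
  have "(F' has_integral F y - F x) {x..y}"
    by (rule fundamental_theorem_of_calculus) (use assms in \<open>auto intro!: has_vector_derivative_within_subset[OF assms(1)]\<close>)
  then show "integral {x..y} F' = F y - F x" "F' integrable_on {x..y}" by auto
qed

lemma integral_diff_Icc:
  fixes f :: "real \<Rightarrow> 'a::euclidean_space"
  assumes "f integrable_on {0..1}" "0 \<le> x" "x \<le> y" "y \<le> 1"
  shows "integral {0..y} f - integral {0..x} f = integral {x..y} f"
  using Henstock_Kurzweil_Integration.integral_combine[of 0 x y f] assms
    integrable_on_subinterval[OF assms(1), of 0 y]
  by (simp add: algebra_simps)

lemma integral_Icc_continuous:
  fixes f :: "real \<Rightarrow> 'a::euclidean_space"
  assumes "f integrable_on {0..1}"
  shows "continuous_on {0..1} (\<lambda>x. integral {0..x} f)"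
  using indefinite_integral_continuous_1[OF assms] .

lemma integral_Icc_has_vector_derivative:
  fixes f :: "real \<Rightarrow> 'a::euclidean_space"
  assumes "continuous_on {0..1} f" "x \<in> {0..1}"
  shows "((\<lambda>x. integral {0..x} f) has_vector_derivative f x) (at x within {0..1})"
  by (rule integral_has_vector_derivative) (use assms in auto)

text \<open>
  The indefinite integral need not be differentiable everywhere, but the defect \<open>\<Phi>\<close> of the identity
  has increments bounded by \<open>\<bar>y - x\<bar>\<close> times the integral of \<open>norm g\<close> over \<open>[x, y]\<close>, so its derivative vanishes.
\<close>

lemma integral_by_parts_indefinite:
  fixes prod :: "'a::euclidean_space \<Rightarrow> 'b::euclidean_space \<Rightarrow> 'c::euclidean_space"
  assumes bil: "bounded_bilinear prod"
    and g: "g absolutely_integrable_on {0..1}"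
    and H: "\<And>x. x \<in> {0..1} \<Longrightarrow> (H has_vector_derivative H' x) (at x within {0..1})"
    and H': "continuous_on {0..1} H'"
    and x: "x \<in> {0..1}"
  shows "prod (integral {0..x} g) (H x) =
    integral {0..x} (\<lambda>t. prod (g t) (H t)) + integral {0..x} (\<lambda>t. prod (integral {0..t} g) (H' t))"
proof -
  interpret bounded_bilinear prod by (rule bil)
  define G where "G x = integral {0..x} g" for x
  define n where "n x = integral {0..x} (\<lambda>t. norm (g t))" for x
  have gi: "g integrable_on {0..1}" "(\<lambda>t. norm (g t)) integrable_on {0..1}"
    using g by (auto simp: absolutely_integrable_on_def)
  have Hc: "continuous_on {0..1} H"
    by (rule continuous_on_vector_derivative) (use H in auto)
  have Gc: "continuous_on {0..1} G" and nc: "continuous_on {0..1} n"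
    unfolding G_def n_def using gi by (auto intro: integral_Icc_continuous)
  have gH: "(\<lambda>t. prod (g t) (h t)) absolutely_integrable_on {0..1}"
    if "continuous_on {0..1} h" for h
  proof -
    have "(\<lambda>t. (\<lambda>a b. prod b a) (h t) (g t)) absolutely_integrable_on {0..1}"
    proof (rule absolutely_integrable_bounded_measurable_product[where h="\<lambda>a b. prod b a"])
      show "bilinear (\<lambda>a b. prod b a)"
        by (auto simp: bilinear_def intro!: linearI simp: add_left add_right scaleR_left scaleR_right)
      show "h \<in> borel_measurable (lebesgue_on {0..1})"
        by (rule continuous_imp_measurable_on_sets_lebesgue[OF that]) auto
      show "bounded (h ` {0..1})"
        using compact_continuous_image[OF that] by (auto intro: compact_imp_bounded)
    qed (use g in auto)
    then show ?thesis by simp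
  qed
  obtain K where K: "K \<ge> 0" "\<And>a b. norm (prod a b) \<le> norm a * norm b * K"
    using nonneg_bounded by blast
  obtain M where M: "\<And>t. t \<in> {0..1} \<Longrightarrow> norm (H' t) \<le> M"
    using compact_imp_bounded[OF compact_continuous_image[OF H']] unfolding bounded_iff by fastforce
  have M0: "M \<ge> 0" using order_trans[OF norm_ge_zero M[of 0]] by simp
  define \<Phi> where "\<Phi> x = integral {0..x} (\<lambda>t. prod (g t) (H t)) - prod (G x) (H x)
     + integral {0..x} (\<lambda>t. prod (G t) (H' t))" for x
  have PGH: "continuous_on {0..1} (\<lambda>t. prod (h t) (H' t))" if "continuous_on {0..1} h" for h
    by (rule continuous_on[OF that H'])
  \<comment> \<open>The increment of the boundary term splits as
    \<open>prod (G y - G x) (H y)\<close> plus \<open>prod (G x) (H y - H x)\<close>. Both are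
    integrals over [x, y] with one factor frozen (\<open>e2\<close>, \<open>e4\<close>), so only
    products of two small deviations remain; \<open>b1\<close> and \<open>b2\<close> estimate
    them.\<close>
  have key: "norm (\<Phi> y - \<Phi> x) \<le> 2 * K * M * (y - x) * (n y - n x)"
    if xy: "0 \<le> x" "x \<le> y" "y \<le> 1" for x y
  proof -
    have sub: "{x..y} \<subseteq> {0..1}" using xy by auto
    have i1: "(\<lambda>t. prod (g t) (H t)) integrable_on {x..y}"
        and i2: "(\<lambda>t. prod (g t) (H y)) integrable_on {x..y}"
        and i0: "g integrable_on {x..y}" and in0: "(\<lambda>t. norm (g t)) integrable_on {x..y}"
      using gH[OF Hc] gH[of "\<lambda>_. H y"] gi
      by (auto simp: absolutely_integrable_on_def intro: integrable_on_subinterval[OF _ sub])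
    have i3: "(\<lambda>t. prod (G t) (H' t)) integrable_on {x..y}" 
        and i4: "(\<lambda>t. prod (G x) (H' t)) integrable_on {x..y}"
      using PGH[OF Gc] PGH[of "\<lambda>_. G x"]
      by (auto intro!: integrable_continuous_real intro: continuous_on_subset[OF _ sub])
    have nyx: "n y - n x = integral {x..y} (\<lambda>t. norm (g t))"
      unfolding n_def by (rule integral_diff_Icc) (use xy gi in auto)
    have Gyx: "G y - G x = integral {x..y} g"
      unfolding G_def by (rule integral_diff_Icc) (use xy gi in auto)
    have e2: "integral {x..y} (\<lambda>t. prod (g t) (H y)) = prod (G y - G x) (H y)"
      unfolding Gyx using integral_linear[OF i0 bounded_linear_left[of "H y"]] by (simp add: o_def)
    have H'i: "H' integrable_on {x..y}" "integral {x..y} H' = H y - H x"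
      using integral_has_vector_derivative_Icc[OF H] xy by auto
    have e4: "integral {x..y} (\<lambda>t. prod (G x) (H' t)) = prod (G x) (H y - H x)"
      using integral_linear[OF H'i(1) bounded_linear_right[of "G x"]] H'i(2) by (simp add: o_def)
    have "\<Phi> y - \<Phi> x = integral {x..y} (\<lambda>t. prod (g t) (H t)) - (prod (G y) (H y) - prod (G x) (H x))
        + integral {x..y} (\<lambda>t. prod (G t) (H' t))"
      using integral_diff_Icc[of "\<lambda>t. prod (g t) (H t)" x y] integral_diff_Icc[of "\<lambda>t. prod (G t) (H' t)" x y]
        xy gH[OF Hc] PGH[OF Gc]
      by (auto simp: \<Phi>_def absolutely_integrable_on_def integrable_continuous_real algebra_simps)
    also have "\<dots> = integral {x..y} (\<lambda>t. prod (g t) (H t) - prod (g t) (H y))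
        + integral {x..y} (\<lambda>t. prod (G t) (H' t) - prod (G x) (H' t))"
      by (simp add: integral_diff i1 i2 i3 i4 e2 e4) (simp add: diff_left diff_right)
    finally have eq: "\<Phi> y - \<Phi> x = \<dots>" .
    have b1: "norm (integral {x..y} (\<lambda>t. prod (g t) (H t) - prod (g t) (H y)))
       \<le> integral {x..y} (\<lambda>t. K * M * (y - x) * norm (g t))"
    proof (rule integral_norm_bound_integral)
      fix t assume t: "t \<in> {x..y}"
      have "norm (H t - H y) \<le> M * norm (t - y)"
      proof (rule differentiable_bound[of "{x..y}" H "\<lambda>t h. h *\<^sub>R H' t"])
        show "(H has_derivative (\<lambda>h. h *\<^sub>R H' z)) (at z within {x..y})" if "z \<in> {x..y}" for z
          using H[of z] that sub unfolding has_vector_derivative_def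
          by (meson has_derivative_subset subsetD)
        show "onorm (\<lambda>h. h *\<^sub>R H' z) \<le> M" if "z \<in> {x..y}" for z
          by (rule onorm_bound) (use M[of z] M0 that sub in \<open>auto simp: mult.commute[of M] intro: mult_left_mono\<close>)
      qed (use t xy in auto)
      also have "\<dots> \<le> M * (y - x)" using t M0 by (intro mult_left_mono) auto
      finally have "norm (H t - H y) \<le> M * (y - x)" .
      then have "norm (g t) * norm (H t - H y) * K \<le> norm (g t) * (M * (y - x)) * K"
        using K by (intro mult_right_mono mult_left_mono) auto
      then show "norm (prod (g t) (H t) - prod (g t) (H y)) \<le> K * M * (y - x) * norm (g t)"
        using K(2)[of "g t" "H t - H y"] by (simp add: diff_right algebra_simps)
    qed (use i1 i2 in0 in \<open>auto intro!: integrable_diff integrable_on_mult_right\<close>)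
    have b2: "norm (integral {x..y} (\<lambda>t. prod (G t) (H' t) - prod (G x) (H' t)))
       \<le> integral {x..y} (\<lambda>t. K * M * (n y - n x))"
    proof (rule integral_norm_bound_integral)
      fix t assume t: "t \<in> {x..y}"
      have "G t - G x = integral {x..t} g"
        unfolding G_def by (rule integral_diff_Icc) (use xy t gi in auto)
      also have "norm \<dots> \<le> integral {x..t} (\<lambda>t. norm (g t))"
        by (rule integral_norm_bound_integral)
          (use gi xy t in \<open>auto intro: integrable_on_subinterval[where a=x and b=t]\<close>)
      also have "\<dots> \<le> n y - n x"
        unfolding nyx by (rule integral_subset_le)
          (use in0 t in \<open>auto intro: integrable_on_subinterval[where a=x and b=t]\<close>)
      finally have le: "norm (G t - G x) \<le> n y - n x" .
      then have "0 \<le> n y - n x" by (rule order_trans[OF norm_ge_zero])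
      with le have "norm (G t - G x) * norm (H' t) * K \<le> (n y - n x) * M * K"
        using K(1) M[of t] sub t M0 by (intro mult_right_mono mult_mono) auto
      then show "norm (prod (G t) (H' t) - prod (G x) (H' t)) \<le> K * M * (n y - n x)"
        using K(2)[of "G t - G x" "H' t"] by (simp add: diff_left algebra_simps)
    qed (use i3 i4 in \<open>auto intro!: integrable_diff\<close>)
    have "norm (\<Phi> y - \<Phi> x) \<le> K * M * (y - x) * (n y - n x) + (y - x) * (K * M * (n y - n x))"
      unfolding eq using b1 b2 xy by (intro order_trans[OF norm_triangle_ineq] add_mono) (auto simp: nyx mult_ac)
    then show ?thesis by (simp add: algebra_simps)
  qed
  have der: "(\<Phi> has_derivative (\<lambda>h. 0)) (at x within {0..1})" if x: "x \<in> {0..1}" for x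
    unfolding has_derivative_within_alt
  proof (intro conjI allI impI)
    fix e :: real assume e: "e > 0"
    \<comment> \<open>The summand 1 keeps the denominator positive when \<open>K\<close> or
      \<open>M\<close> is zero.\<close>
    define c where "c = e / (2 * K * M + 1)"
    have c: "c > 0" "2 * K * M * c \<le> e" using e K M0 by (auto simp: c_def divide_simps add_nonneg_pos)
    obtain d where d: "d > 0" "\<And>y. y \<in> {0..1} \<Longrightarrow> dist y x < d \<Longrightarrow> dist (n y) (n x) < c"
      using nc x c unfolding continuous_on_iff by metis
    show "\<exists>d>0. \<forall>y\<in>{0..1}. norm (y - x) < d \<longrightarrow> norm (\<Phi> y - \<Phi> x - 0) \<le> e * norm (y - x)"
    proof (intro exI[of _ d] conjI ballI impI d)
      fix y :: real assume y: "y \<in> {0..1}" "norm (y - x) < d"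
      have "norm (\<Phi> y - \<Phi> x) \<le> 2 * K * M * (\<bar>y - x\<bar> * \<bar>n y - n x\<bar>)"
      proof -
        have nn: "0 \<le> 2 * K * M" using K M0 by auto
        consider "x \<le> y" | "y \<le> x" by linarith
        then show ?thesis
        proof cases
          case 1
          have "norm (\<Phi> y - \<Phi> x) \<le> 2 * K * M * ((y - x) * (n y - n x))" using key[of x y] 1 x y by (simp add: mult.assoc)
          also have "\<dots> \<le> 2 * K * M * (\<bar>y - x\<bar> * \<bar>n y - n x\<bar>)"
            by (rule mult_left_mono[OF _ nn]) (metis abs_ge_self abs_mult)
          finally show ?thesis .
        next
          case 2
          have "norm (\<Phi> y - \<Phi> x) \<le> 2 * K * M * ((x - y) * (n x - n y))"
            using key[of y x] 2 x y by (simp add: mult.assoc norm_minus_commute)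
          also have "\<dots> \<le> 2 * K * M * (\<bar>y - x\<bar> * \<bar>n y - n x\<bar>)"
            by (rule mult_left_mono[OF _ nn]) (metis abs_ge_self abs_minus_commute abs_mult)
          finally show ?thesis .
        qed
      qed
      also have "\<dots> \<le> 2 * K * M * (\<bar>y - x\<bar> * c)"
        using d(2)[of y] y K M0 by (intro mult_left_mono) (auto simp: dist_real_def)
      also have "\<dots> \<le> e * norm (y - x)"
        using mult_right_mono[OF c(2), of "\<bar>y - x\<bar>"] by (simp add: algebra_simps)
      finally show "norm (\<Phi> y - \<Phi> x - 0) \<le> e * norm (y - x)" by simp
    qed
  qed auto
  obtain c where "\<forall>x\<in>{0..1}. \<Phi> x = c"
    using has_derivative_zero_constant[of "{0..1}" \<Phi>] der by auto
  then have "\<Phi> x = \<Phi> 0" using x by simp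
  also have "\<Phi> 0 = 0" by (simp add: \<Phi>_def G_def zero_left)
  finally show ?thesis by (simp add: \<Phi>_def G_def algebra_simps)
qed

section \<open>Smooth bump functions\<close>

text \<open>
  The powers of \<open>(x - p) * (q - x)\<close> in the denominator and the polynomial factor are there to make
  the family closed under differentiation.
\<close>

definition bump :: "real \<Rightarrow> real \<Rightarrow> real \<Rightarrow> real poly \<Rightarrow> nat \<Rightarrow> real \<Rightarrow> real" where
  "bump p q c r k x = (if p < x \<and> x < q
     then poly r x / ((x - p) * (q - x)) ^ k * exp (- c / ((x - p) * (q - x))) else 0)"

text \<open>With u = (x - p) (q - x), this is the numerator that remains when the derivative of r
  u^{-k} exp(- c / u) is written over u^{k + 2}.\<close>

definition bump_deriv :: "real \<Rightarrow> real \<Rightarrow> real \<Rightarrow> real poly \<Rightarrow> nat \<Rightarrow> real poly" where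
  "bump_deriv p q c r k = (let u = [:- p, 1:] * [:q, - 1:] in
     pderiv r * u\<^sup>2 - smult (real k) (r * pderiv u * u) + smult c (r * pderiv u))"

text \<open>The exponential beats every power of the denominator: from y / n \<le> exp (y / n)
  follows exp (- c / u) \<le> (n / c)^n u^n. With n = k + 2 the denominator u^k is cancelled and u^2
  is left, which vanishes to second order at both end points.\<close>

lemma bump_quadratic_bound:
  assumes "p < q" "c > 0"
  obtains K where "\<And>x. \<bar>bump p q c r k x\<bar> \<le> K * (x - p)\<^sup>2" "\<And>x. \<bar>bump p q c r k x\<bar> \<le> K * (x - q)\<^sup>2"
proof -
  have "bounded (poly r ` {p..q})"
    by (intro compact_imp_bounded compact_continuous_image continuous_intros) auto
  then obtain M where M: "\<And>x. x \<in> {p..q} \<Longrightarrow> \<bar>poly r x\<bar> \<le> M"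
    unfolding bounded_iff by fastforce
  have M0: "0 \<le> M" using order_trans[OF abs_ge_zero M[of p]] assms by simp
  define n where "n = k + 2"
  define K where "K = M * (real n / c) ^ n * (q - p)\<^sup>2"
  have K: "K \<ge> 0" using M0 assms by (auto simp: K_def)
  have main: "\<bar>bump p q c r k x\<bar> \<le> M * (real n / c) ^ n * ((x - p) * (q - x))\<^sup>2" if x: "p < x" "x < q" for x
  proof -
    define U where "U = (x - p) * (q - x)"
    have U: "U > 0" using x by (simp add: U_def)
    have "c / U / real n \<le> exp (c / U / real n)"
      using exp_ge_add_one_self[of "c / U / real n"] by linarith
    then have "(c / U / real n) ^ n \<le> exp (c / U / real n) ^ n"
      by (rule power_mono) (use U assms in auto)
    also have "\<dots> = exp (c / U)" using U by (subst exp_of_nat_mult[symmetric]) (simp add: n_def)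
    finally have e: "(c / U / real n) ^ n \<le> exp (c / U)" .
    have "exp (- c / U) = inverse (exp (c / U))" by (simp add: exp_minus)
    also have "\<dots> \<le> inverse ((c / U / real n) ^ n)"
      by (rule le_imp_inverse_le[OF e]) (use U assms in \<open>auto simp: n_def\<close>)
    also have "\<dots> = (real n / c) ^ n * U ^ n" by (simp add: power_divide field_simps)
    finally have "exp (- c / U) \<le> (real n / c) ^ n * U ^ n" .
    then have "\<bar>poly r x\<bar> / U ^ k * exp (- c / U) \<le> M / U ^ k * ((real n / c) ^ n * U ^ n)"
      using M[of x] x U M0 by (intro mult_mono divide_right_mono) auto
    also have "\<dots> = M * (real n / c) ^ n * U\<^sup>2"
      using U by (simp add: n_def power_add power2_eq_square)
    finally show ?thesis using x U by (simp add: bump_def U_def abs_mult)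
  qed
  have nn: "0 \<le> M * (real n / c) ^ n" using M0 assms by auto
  show ?thesis
  proof (rule that[of K])
    fix x :: real
    show "\<bar>bump p q c r k x\<bar> \<le> K * (x - p)\<^sup>2"
    proof (cases "p < x \<and> x < q")
      case True
      have "((x - p) * (q - x))\<^sup>2 \<le> (q - p)\<^sup>2 * (x - p)\<^sup>2"
        unfolding power_mult_distrib by (subst mult.commute, rule mult_right_mono) (use True in \<open>auto intro: power_mono\<close>)
      from mult_left_mono[OF this nn] main[of x] True show ?thesis by (simp add: K_def mult.assoc)
    qed (use K in \<open>auto simp: bump_def\<close>)
    show "\<bar>bump p q c r k x\<bar> \<le> K * (x - q)\<^sup>2"
    proof (cases "p < x \<and> x < q")
      case True
      have "((x - p) * (q - x))\<^sup>2 \<le> (q - p)\<^sup>2 * (x - q)\<^sup>2"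
        unfolding power_mult_distrib power2_commute[of q x] by (rule mult_right_mono) (use True in \<open>auto intro: power_mono\<close>)
      from mult_left_mono[OF this nn] main[of x] True show ?thesis by (simp add: K_def mult.assoc)
    qed (use K in \<open>auto simp: bump_def\<close>)
  qed
qed

lemma DERIV_zero_quadratic_bound:
  fixes f :: "real \<Rightarrow> real"
  assumes "\<And>x. \<bar>f x\<bar> \<le> K * (x - p)\<^sup>2"
  shows "(f has_real_derivative 0) (at p)"
proof -
  have f0: "f p = 0" using assms[of p] by simp
  have "((\<lambda>h. (f (p + h) - f p) / h) \<longlongrightarrow> 0) (at 0)"
  proof (rule Lim_null_comparison)
    show "\<forall>\<^sub>F h in at 0. norm ((f (p + h) - f p) / h) \<le> K * \<bar>h\<bar>"
    proof (rule eventually_at_topological[THEN iffD2], intro exI[of _ UNIV] conjI ballI impI)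
      fix h :: real assume "h \<noteq> 0"
      then show "norm ((f (p + h) - f p) / h) \<le> K * \<bar>h\<bar>"
        using assms[of "p + h"] f0 by (simp add: divide_le_eq power2_eq_square mult.assoc)
    qed auto
    show "((\<lambda>h. K * \<bar>h\<bar>) \<longlongrightarrow> 0) (at 0)"
      by (auto intro!: tendsto_eq_intros)
  qed
  then show ?thesis by (simp add: DERIV_def)
qed

text \<open>The left side is what the quotient, power and exponential rules produce. The truncated
  exponent \<open>k - Suc 0\<close> calls for the case distinction; for k = 0 its term carries the
  factor \<open>real k\<close> = 0.\<close>

lemma bump_deriv_algebra:
  fixes U :: real
  assumes "U \<noteq> 0"
  shows "(R' * U ^ k - R * (real k * (U' * U ^ (k - Suc 0)))) / (U ^ k * U ^ k) * e
      + e * (c * U' / U\<^sup>2) * (R / U ^ k)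
    = (R' * U\<^sup>2 - real k * (R * (U' * U)) + c * (R * U')) / U ^ (k + 2) * e"
proof (cases k)
  case (Suc m)
  have "U ^ m \<noteq> 0" using assms by simp
  define V where "V = U ^ m"
  have V: "V \<noteq> 0" using assms by (simp add: V_def)
  show ?thesis using assms V unfolding Suc power_add
    by (simp add: V_def[symmetric] divide_simps power2_eq_square) (simp add: algebra_simps)
qed (use assms in \<open>simp add: field_simps power2_eq_square\<close>)

text \<open>Inside (p, q) this is calculus, off [p, q] the function is locally zero, and at the two
  end points the quadratic bound gives the derivative 0.\<close>

lemma bump_has_real_derivative:
  assumes "p < q" "c > 0"
  shows "(bump p q c r k has_real_derivative bump p q c (bump_deriv p q c r k) (k + 2) x) (at x)"
proof -
  obtain K where K: "\<And>x. \<bar>bump p q c r k x\<bar> \<le> K * (x - p)\<^sup>2" "\<And>x. \<bar>bump p q c r k x\<bar> \<le> K * (x - q)\<^sup>2"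
    using bump_quadratic_bound[OF assms] by blast
  consider "p < x" "x < q" | "x < p \<or> q < x" | "x = p" | "x = q" by linarith
  then show ?thesis
  proof cases
    case 1
    define u where "u = [:- p, 1:] * [:q, - 1:]"
    have u: "poly u y = (y - p) * (q - y)" for y by (simp add: u_def algebra_simps)
    have U: "poly u x > 0" using 1 by (simp add: u)
    define e where "e = exp (- c / poly u x)"
    have d1: "((\<lambda>x. exp (- c / poly u x)) has_real_derivative e * (c * poly (pderiv u) x / (poly u x)\<^sup>2)) (at x)"
    proof -
      have "((\<lambda>x. - c / poly u x) has_real_derivative
          (0 * poly u x - (- c) * poly (pderiv u) x) / (poly u x * poly u x)) (at x)"
        by (rule DERIV_divide DERIV_const poly_DERIV)+ (use U in simp)
      from DERIV_fun_exp[OF this] show ?thesis by (simp add: e_def power2_eq_square)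
    qed
    have d2: "((\<lambda>x. poly r x / poly u x ^ k) has_real_derivative
        (poly (pderiv r) x * poly u x ^ k - poly r x * (real k * (poly (pderiv u) x * poly u x ^ (k - Suc 0))))
         / (poly u x ^ k * poly u x ^ k)) (at x)"
      by (intro DERIV_divide poly_DERIV DERIV_power) (use U in simp)
    have eq: "poly (bump_deriv p q c r k) x = poly (pderiv r) x * (poly u x)\<^sup>2
        - real k * (poly r x * (poly (pderiv u) x * poly u x)) + c * (poly r x * poly (pderiv u) x)"
      unfolding bump_deriv_def Let_def u_def[symmetric] by simp
    have "poly u x \<noteq> 0" using U by simp
    note alg = bump_deriv_algebra[OF this]
    have "((\<lambda>x. poly r x / poly u x ^ k * exp (- c / poly u x)) has_real_derivative
        poly (bump_deriv p q c r k) x / poly u x ^ (k + 2) * exp (- c / poly u x)) (at x)"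
      using DERIV_mult[OF d2 d1] unfolding e_def[symmetric] alg eq .
    then have "((\<lambda>x. poly r x / poly u x ^ k * exp (- c / poly u x)) has_real_derivative
        bump p q c (bump_deriv p q c r k) (k + 2) x) (at x)"
      using 1 by (simp add: bump_def u)
    then show ?thesis
      by (rule has_field_derivative_transform_within_open[where S="{p<..<q}"])
        (use 1 in \<open>auto simp: bump_def u\<close>)
  next
    case 2
    have "((\<lambda>x. 0) has_real_derivative 0) (at x)" by simp
    then have "(bump p q c r k has_real_derivative 0) (at x)"
      by (rule has_field_derivative_transform_within_open[where S="- {p..q}"])
        (use 2 in \<open>auto simp: bump_def\<close>)
    then show ?thesis using 2 by (auto simp: bump_def)
  next
    case 3
    have "bump p q c (bump_deriv p q c r k) (k + 2) p = 0" by (simp add: bump_def)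
    with 3 DERIV_zero_quadratic_bound[OF K(1)] show ?thesis by simp
  next
    case 4
    have "bump p q c (bump_deriv p q c r k) (k + 2) q = 0" by (simp add: bump_def)
    with 4 DERIV_zero_quadratic_bound[OF K(2)] show ?thesis by simp
  qed
qed

lemma deriv_bump:
  assumes "p < q" "c > 0"
  shows "deriv (bump p q c r k) = bump p q c (bump_deriv p q c r k) (k + 2)"
  by (rule ext) (rule DERIV_imp_deriv[OF bump_has_real_derivative[OF assms]])

lemma higher_deriv_bump_differentiable:
  assumes "p < q" "c > 0"
  shows "(deriv ^^ n) (bump p q c r k) field_differentiable (at x)"
proof (induction n arbitrary: r k)
  case 0
  then show ?case using bump_has_real_derivative[OF assms] by (auto simp: field_differentiable_def)
next
  case (Suc n)
  then show ?case by (simp add: funpow_Suc_right deriv_bump[OF assms] del: funpow.simps)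
qed

lemma test_function_bump:
  assumes "0 < p" "p < q" "q < 1" "c > 0"
  shows "test_function (bump p q c 1 0)"
  unfolding test_function_def
proof (intro conjI allI, goal_cases)
  case (2)
  show ?case by (rule exI[of _ p], rule exI[of _ q]) (use assms in \<open>auto simp: bump_def\<close>)
next
  case (1 n x)
  show ?case by (rule higher_deriv_bump_differentiable) (use assms in auto)
qed

lemma bump_bounds:
  assumes "c > 0"
  shows "0 \<le> bump p q c 1 0 x" "bump p q c 1 0 x \<le> 1"
  using assms by (auto simp: bump_def)

section \<open>Linear combinations and primitives of test functions\<close>

lemma higher_deriv_add:
  assumes "\<And>n x. (deriv ^^ n) f field_differentiable (at x)" "\<And>n x. (deriv ^^ n) g field_differentiable (at x)"
  shows "(deriv ^^ n) (\<lambda>x. f x + c * g x :: real) = (\<lambda>x. (deriv ^^ n) f x + c * (deriv ^^ n) g x)"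
proof (induction n)
  case (Suc n)
  show ?case
  proof (rule ext)
    fix x
    show "(deriv ^^ Suc n) (\<lambda>x. f x + c * g x) x = (deriv ^^ Suc n) f x + c * (deriv ^^ Suc n) g x"
      using assms[of n x] by (auto simp: Suc intro!: DERIV_imp_deriv derivative_eq_intros
        field_differentiable_derivI)
  qed
qed simp

text \<open>In this form it serves both to subtract a multiple of a normalised test function and,
  with \<open>f\<close> zero, to rescale one.\<close>

lemma test_function_add:
  assumes "test_function f" "test_function g"
  shows "test_function (\<lambda>x. f x + c * g x)"
proof -
  have d: "\<And>n x. (deriv ^^ n) f field_differentiable (at x)" "\<And>n x. (deriv ^^ n) g field_differentiable (at x)"
    using assms by (auto simp: test_function_def)
  obtain a b where ab: "0 < a" "b < 1" "\<And>x. x \<notin> {a..b} \<Longrightarrow> f x = 0"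
    using assms(1) by (auto simp: test_function_def)
  obtain a' b' where ab': "0 < a'" "b' < 1" "\<And>x. x \<notin> {a'..b'} \<Longrightarrow> g x = 0"
    using assms(2) by (auto simp: test_function_def)
  show ?thesis
    unfolding test_function_def higher_deriv_add[OF d]
  proof (intro conjI allI, goal_cases)
    case (1 n x)
    show ?case
      using d by (intro field_differentiable_add field_differentiable_mult field_differentiable_const) auto
  next
    case 2
    have "f x + c * g x = 0" if "x \<notin> {min a a'..max b b'}" for x
      using that ab(3)[of x] ab'(3)[of x] by (auto simp: min_def max_def split: if_splits)
    moreover have "0 < min a a'" "max b b' < 1" using ab ab' by auto
    ultimately show ?case by blast
  qed
qed

lemma test_function_has_real_derivative:
  assumes "test_function f"
  shows "(f has_real_derivative deriv f x) (at x)" "(deriv f has_real_derivative (deriv ^^ 2) f x) (at x)"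
  using assms unfolding test_function_def
  by (auto simp: numeral_2_eq_2 field_differentiable_derivI intro: field_differentiable_derivI
      dest: spec[of _ "0::nat"] spec[of _ "Suc 0"])

text \<open>The vanishing mean is what gives the primitive compact support: to the right of the
  support of \<eta> it equals the integral over all of [0, 1].\<close>

lemma test_function_primitive:
  assumes "test_function \<eta>" "integral {0..1} \<eta> = 0"
  obtains \<psi> where "test_function \<psi>" "deriv \<psi> = \<eta>"
proof -
  have der: "(\<eta> has_real_derivative deriv \<eta> x) (at x)" for x
    by (rule test_function_has_real_derivative[OF assms(1)])
  obtain a b where ab: "0 < a" "b < 1" "\<And>x. x \<notin> {a..b} \<Longrightarrow> \<eta> x = 0"
    using assms(1) by (auto simp: test_function_def)
  have cont: "continuous_on A \<eta>" for A
    using der by (meson DERIV_isCont continuous_at_imp_continuous_on)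
  define \<psi> where "\<psi> x = (if x < 0 then 0 else integral {0..x} \<eta>)" for x
  have z: "integral {s..t} \<eta> = 0" if "t \<le> a \<or> b \<le> s" for s t
  proof -
    have "integral {s..t} \<eta> = integral {s..t} (\<lambda>x. 0)"
      by (rule integral_spike[of "{a,b}"]) (use that ab in auto)
    then show ?thesis by simp
  qed
  have zero: "\<psi> x = 0" if "x \<notin> {a..b}" for x
  proof (cases "x < a")
    case True then show ?thesis by (auto simp: \<psi>_def z)
  next
    case False
    then have x: "x > b" "x > 0" using that ab by auto
    have i: "\<eta> integrable_on {s..t}" for s t by (intro integrable_continuous_real cont)
    \<comment> \<open>Passing through \<open>max x 1\<close> treats x below and above 1 alike: both
      correction integrals start to the right of \<open>b\<close>, where \<eta> vanishes.\<close>
    have e1: "integral {0..x} \<eta> = integral {0..max x 1} \<eta> - integral {x..max x 1} \<eta>"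
      using Henstock_Kurzweil_Integration.integral_combine[of 0 x "max x 1" \<eta>] x i by simp
    have e2: "integral {0..max x 1} \<eta> = integral {0..1} \<eta> + integral {1..max x 1} \<eta>"
      using Henstock_Kurzweil_Integration.integral_combine[of 0 1 "max x 1" \<eta>] x i by simp
    show ?thesis using x e1 e2 assms(2) ab by (simp add: \<psi>_def z)
  qed
  have d: "(\<psi> has_real_derivative \<eta> x) (at x)" for x
  proof (cases "x < a")
    case True
    have "((\<lambda>x. 0) has_real_derivative 0) (at x)" by simp
    then have "(\<psi> has_real_derivative 0) (at x)"
      by (rule has_field_derivative_transform_within_open[where S="{..<a}"]) (use True zero in auto)
    then show ?thesis using ab True by simp
  next
    case False
    have "((\<lambda>x. integral {0..x} \<eta>) has_real_derivative \<eta> x) (at x within {0..x+1})"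
      by (rule integral_has_real_derivative[OF cont]) (use False ab in auto)
    moreover have "at x within {0..x+1} = at x"
      by (rule at_within_Icc_at) (use False ab in auto)
    ultimately have "((\<lambda>x. integral {0..x} \<eta>) has_real_derivative \<eta> x) (at x)"
      by simp
    then show ?thesis
      by (rule has_field_derivative_transform_within_open[where S="{0<..}"])
        (use False ab in \<open>auto simp: \<psi>_def\<close>)
  qed
  have dd: "deriv \<psi> = \<eta>" by (rule ext) (rule DERIV_imp_deriv[OF d])
  have "(deriv ^^ n) \<psi> field_differentiable at x" for n x
  proof (cases n)
    case 0 then show ?thesis using d by (auto simp: field_differentiable_def)
  next
    case (Suc m)
    have "(deriv ^^ Suc m) \<psi> = (deriv ^^ m) \<eta>" by (simp add: funpow_Suc_right dd del: funpow.simps)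
    then show ?thesis using assms(1) Suc by (simp add: test_function_def)
  qed
  then have "test_function \<psi>" unfolding test_function_def using ab zero by blast
  from that[OF this dd] show thesis .
qed

section \<open>The fundamental lemma of the calculus of variations\<close>

text \<open>An approximation from below of the indicator of (a, b) within (0, 1). Pulling the end
  points in by 1 / (n + 1) keeps the support away from 0 and 1, and the constant 1 / (n + 1) in the
  exponent sends the values inside to 1. If the shrunken interval is empty, this is the zero
  function.\<close>

definition cutoff :: "real \<Rightarrow> real \<Rightarrow> nat \<Rightarrow> real \<Rightarrow> real" where
  "cutoff a b n = bump (max a 0 + 1 / real (Suc n)) (min b 1 - 1 / real (Suc n)) (1 / real (Suc n)) 1 0"

lemma test_function_zero: "test_function (\<lambda>x. 0)"
proof -
  have "(deriv ^^ n) (\<lambda>x. 0 :: real) = (\<lambda>x. 0)" for n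
    by (induction n) auto
  then show ?thesis
    by (auto simp: test_function_def intro!: exI[of _ "1/2"])
qed

lemma test_function_cutoff: "test_function (cutoff a b n)"
proof (cases "max a 0 + 1 / real (Suc n) < min b 1 - 1 / real (Suc n)")
  case True
  have n: "1 / real (Suc n) > 0" by simp
  show ?thesis unfolding cutoff_def
  proof (rule test_function_bump)
    show "0 < max a 0 + 1 / real (Suc n)" using n by linarith
    show "min b 1 - 1 / real (Suc n) < 1" using n by linarith
  qed (use True n in auto)
next
  case False
  then have "cutoff a b n = (\<lambda>x. 0)" by (auto simp: cutoff_def bump_def fun_eq_iff)
  then show ?thesis by (simp add: test_function_zero)
qed

lemma cutoff_bounds: "0 \<le> cutoff a b n x" "cutoff a b n x \<le> 1"
  by (simp_all add: cutoff_def bump_bounds)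

lemma cutoff_tendsto_indicator:
  assumes "x \<in> {0<..<1}"
  shows "(\<lambda>n. cutoff a b n x) \<longlonglongrightarrow> indicator {a<..<b} x"
proof -
  define p where "p n = max a 0 + 1 / real (Suc n)" for n
  define q where "q n = min b 1 - 1 / real (Suc n)" for n
  have lim: "(\<lambda>n. 1 / real (Suc n)) \<longlonglongrightarrow> 0" by (intro LIMSEQ_Suc lim_1_over_n)
  have p: "p \<longlonglongrightarrow> max a 0" and q: "q \<longlonglongrightarrow> min b 1"
    unfolding p_def q_def using tendsto_add[OF tendsto_const lim, of "max a 0"]
      tendsto_diff[OF tendsto_const lim, of "min b 1"] by auto
  show ?thesis
  proof (cases "a < x \<and> x < b")
    case True
    have x: "max a 0 < x" "x < min b 1" using True assms by auto
    have "(\<lambda>n. exp (- (1 / real (Suc n)) / ((x - p n) * (q n - x)))) \<longlonglongrightarrow>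
        exp (- 0 / ((x - max a 0) * (min b 1 - x)))"
      by (intro tendsto_intros lim p q) (use x in auto)
    then have "(\<lambda>n. exp (- (1 / real (Suc n)) / ((x - p n) * (q n - x)))) \<longlonglongrightarrow> indicator {a<..<b} x"
      using True by simp
    then show ?thesis
    proof (rule Lim_transform_eventually)
      show "\<forall>\<^sub>F n in sequentially. exp (- (1 / real (Suc n)) / ((x - p n) * (q n - x))) = cutoff a b n x"
        using order_tendstoD(2)[OF p x(1)] order_tendstoD(1)[OF q x(2)]
        by eventually_elim (simp add: cutoff_def bump_def p_def q_def)
    qed
  next
    case False
    have "cutoff a b n x = 0" for n
    proof -
      have "1 / real (Suc n) > 0" by simp
      moreover have "a < x" if "p n < x" using that calculation unfolding p_def by linarith
      moreover have "x < b" if "x < q n" using that calculation(1) unfolding q_def by linarith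
      ultimately have "\<not> (p n < x \<and> x < q n)" using False by blast
      then show ?thesis unfolding cutoff_def bump_def p_def[symmetric] q_def[symmetric] by auto
    qed
    then show ?thesis using False by (auto simp: indicator_def)
  qed
qed

lemma test_function_continuous: "test_function f \<Longrightarrow> continuous_on A f"
  using test_function_has_real_derivative(1) by (meson DERIV_isCont continuous_at_imp_continuous_on)

lemmas cutoff_continuous = test_function_continuous[OF test_function_cutoff]

lemma sum_indicator_disjoint_family:
  assumes "disjoint_family A"
  shows "(\<lambda>n. \<Sum>i<n. indicator (A i) x :: real) \<longlonglongrightarrow> indicator (\<Union>i. A i) x"
    and "0 \<le> (\<Sum>i<n. indicator (A i) x :: real)" and "(\<Sum>i<n. indicator (A i) x :: real) \<le> 1"
proof -
  show "(\<lambda>n. \<Sum>i<n. indicator (A i) x :: real) \<longlonglongrightarrow> indicator (\<Union>i. A i) x"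
    using indicator_sums[of A x] assms by (auto simp: sums_def disjoint_family_on_def)
  have "(\<Sum>i<n. indicator (A i) x :: real) = indicator (\<Union>i<n. A i) x"
    by (rule indicator_UN_disjoint[symmetric]) (use assms in \<open>auto simp: disjoint_family_on_def\<close>)
  then show "(\<Sum>i<n. indicator (A i) x :: real) \<le> 1" by (simp add: indicator_def)
qed (simp add: sum_nonneg)

text \<open>A Lebesgue set differs from a Borel set by a subset of a null set, which
  \<open>null\<close> absorbs. Borel sets are reached by Dynkin's argument, as open intervals form
  an intersection-stable generator. The rule is applied to vanishing integrals and to membership in
  the closure of the domain.\<close>

lemma sets_I01_induct [consumes 1, case_names null interval compl union]:
  assumes E: "E \<in> sets lebesgue"
    and null: "\<And>A B. A \<in> sets lebesgue \<Longrightarrow> B \<in> sets lebesgue \<Longrightarrow> P A \<Longrightarrow>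
        (AE x in I01. x \<in> A \<longleftrightarrow> x \<in> B) \<Longrightarrow> P B"
    and interval: "\<And>a b. P {a<..<b}"
    and compl: "\<And>A. A \<in> sets lebesgue \<Longrightarrow> P A \<Longrightarrow> P (- A)"
    and union: "\<And>A :: nat \<Rightarrow> real set. disjoint_family A \<Longrightarrow> range A \<subseteq> sets lebesgue \<Longrightarrow>
       (\<And>i. P (A i)) \<Longrightarrow> P (\<Union>i. A i)"
  shows "P E"
proof -
  let ?G = "range (\<lambda>(a, b). {a<..<b :: real})"
  have borel: "P S" if "S \<in> sets borel" for S
  proof -
    have b: "sigma_sets UNIV ?G = sets borel"
      unfolding borel_eq_box box_real by simp
    have bl: "A \<in> sets lebesgue" if "A \<in> sigma_sets UNIV ?G" for A
      using that unfolding b by auto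
    have "Int_stable ?G"
    proof (rule Int_stableI)
      fix A B assume "A \<in> ?G" "B \<in> ?G"
      then obtain a b c d where "A = {a<..<b}" "B = {c<..<d}" by auto
      then have "A \<inter> B = {max a c<..<min b d}" by auto
      then show "A \<inter> B \<in> ?G" by auto
    qed
    moreover have "?G \<subseteq> Pow UNIV" by simp
    moreover have "S \<in> sigma_sets UNIV ?G" using that b by simp
    ultimately show ?thesis
    proof (induction rule: sigma_sets_induct_disjoint)
      case (basic A)
      then show ?case using interval by auto
    next
      case empty
      show ?case using interval[of 0 0] by simp
    next
      case (compl A)
      then show ?case using assms(4)[OF bl[OF compl(1)]] by (simp add: Compl_eq_Diff_UNIV)
    next
      case (union A)
      then show ?case using bl by (intro assms(5)) auto
    qed
  qed
  obtain S N N' where S: "E = S \<union> N" "N \<subseteq> N'" "N' \<in> null_sets lborel" "S \<in> sets lborel"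
    using sets_completionE[OF E] .
  show ?thesis
  proof (rule null)
    show "S \<in> sets lebesgue" "P S" using S borel[of S] by auto
    have "AE x in lebesgue. x \<notin> N'"
      using S(3) by (intro AE_not_in) (auto intro: null_sets_completionI)
    then show "AE x in I01. x \<in> S \<longleftrightarrow> x \<in> E"
      by (subst AE_restrict_space_iff) (use S in \<open>auto elim!: eventually_mono\<close>)
  qed (rule E)
qed

section \<open>Passage between \<open>I01\<close> and the gauge integral on the closed
  interval\<close>

lemma I01_absolutely_integrable:
  fixes f :: "real \<Rightarrow> 'a::euclidean_space"
  shows "integrable I01 f \<longleftrightarrow> f absolutely_integrable_on {0..1}"
  unfolding absolutely_integrable_on_Icc_iff_Ioo by (simp add: set_integrable_def integrable_restrict_space)

lemma LINT_I01:
  fixes f :: "real \<Rightarrow> 'a::euclidean_space"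
  assumes "integrable I01 f"
  shows "(LINT x|I01. f x) = integral {0..1} f"
  using lebesgue_integral_eq_integral[OF assms] by (simp add: integral_open_interval_real)

lemma AE_I01:
  "(AE x in I01. P x) \<longleftrightarrow> negligible {x \<in> {0..1}. \<not> P x}"
proof -
  have "(AE x in I01. P x) \<longleftrightarrow> negligible {x. \<not> (x \<in> {0<..<1} \<longrightarrow> P x)}"
    by (subst AE_restrict_space_iff)
      (auto simp: completion.AE_iff_null_sets negligible_iff_null_sets)
  also have "\<dots> \<longleftrightarrow> negligible {x \<in> {0..1}. \<not> P x}"
  proof
    assume "negligible {x. \<not> (x \<in> {0<..<1} \<longrightarrow> P x)}"
    then have "negligible ({x. \<not> (x \<in> {0<..<1} \<longrightarrow> P x)} \<union> {0, 1})" by (intro negligible_Un) auto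
    then show "negligible {x \<in> {0..1}. \<not> P x}" by (rule negligible_subset) auto
  next
    assume "negligible {x \<in> {0..1}. \<not> P x}"
    then show "negligible {x. \<not> (x \<in> {0<..<1} \<longrightarrow> P x)}" by (rule negligible_subset) auto
  qed
  finally show ?thesis .
qed

lemma finite_measure_I01: "finite_measure I01"
  by (rule finite_measure_lebesgue_on) simp

text \<open>Dominated convergence along the cutoffs makes the integral of \<open>g\<close> over
  every interval vanish. Set induction extends this to all measurable sets, and a function whose
  integrals over all measurable sets vanish is zero almost everywhere.\<close>

lemma fundamental_lemma_variations:
  fixes g :: "real \<Rightarrow> 'a::euclidean_space"
  assumes g: "g absolutely_integrable_on {0..1}"
    and test: "\<And>\<psi>. test_function \<psi> \<Longrightarrow> integral {0..1} (\<lambda>x. \<psi> x *\<^sub>R g x) = 0"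
  shows "AE x in I01. g x = 0"
proof -
  interpret finite_measure I01 by (rule finite_measure_I01)
  have gi: "integrable I01 g" using g by (simp add: I01_absolutely_integrable)
  have gind: "integrable I01 (\<lambda>x. indicator A x *\<^sub>R g x)" if "A \<in> sets lebesgue" for A
  proof -
    have "integrable I01 (\<lambda>x. indicator (A \<inter> {0<..<1}) x *\<^sub>R g x)"
      by (rule integrable_mult_indicator[OF _ gi]) (use that in \<open>auto simp: sets_restrict_space\<close>)
    then show ?thesis
      by (rule Bochner_Integration.integrable_cong[THEN iffD1, rotated -1]) (auto simp: indicator_def)
  qed
  have intv: "(LINT x|I01. indicator {a<..<b} x *\<^sub>R g x) = 0" for a b
  proof -
    have cm: "cutoff a b n \<in> borel_measurable I01" for n
      by (intro measurable_restrict_space1 measurable_completion)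
        (simp add: borel_measurable_continuous_onI cutoff_continuous)
    have ci: "integrable I01 (\<lambda>x. cutoff a b n x *\<^sub>R g x)" for n
      by (rule Bochner_Integration.integrable_bound[OF integrable_norm[OF gi]])
        (use cm[of n] cutoff_bounds[of a b n] gi in \<open>auto intro!: mult_left_le_one_le\<close>)
    have "(\<lambda>n. LINT x|I01. cutoff a b n x *\<^sub>R g x) \<longlonglongrightarrow> (LINT x|I01. indicator {a<..<b} x *\<^sub>R g x)"
    proof (rule integral_dominated_convergence[where w="\<lambda>x. norm (g x)"])
      show "AE x in I01. (\<lambda>n. cutoff a b n x *\<^sub>R g x) \<longlonglongrightarrow> indicator {a<..<b} x *\<^sub>R g x"
        by (rule AE_I2) (auto intro!: tendsto_scaleR cutoff_tendsto_indicator)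
      show "AE x in I01. norm (cutoff a b n x *\<^sub>R g x) \<le> norm (g x)" for n
        using cutoff_bounds[of a b n] by (auto intro!: mult_left_le_one_le)
    qed (use gind[of "{a<..<b}"] ci gi in auto)
    moreover have "(LINT x|I01. cutoff a b n x *\<^sub>R g x) = 0" for n
      using LINT_I01[OF ci] test[OF test_function_cutoff] by simp
    ultimately show ?thesis by (simp add: LIMSEQ_const_iff)
  qed
  have zero: "(LINT x|I01. indicator A x *\<^sub>R g x) = 0" if "A \<in> sets lebesgue" for A
    using that
  proof (induction rule: sets_I01_induct)
    case (null A B)
    have "(LINT x|I01. indicator B x *\<^sub>R g x) = (LINT x|I01. indicator A x *\<^sub>R g x)"
      by (rule integral_cong_AE) (use gind null in \<open>auto simp: indicator_def elim!: eventually_mono\<close>)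
    with null show ?case by simp
  next
    case (interval a b)
    show ?case by (rule intv)
  next
    case (compl A)
    \<comment> \<open>The interval (-1, 2) contains (0, 1), so the total integral is an instance of
      the interval case; the complement is then a difference.\<close>
    have "(LINT x|I01. g x) = (LINT x|I01. indicator {-1<..<2} x *\<^sub>R g x)"
      by (rule Bochner_Integration.integral_cong) (auto simp: indicator_def)
    with intv have full: "(LINT x|I01. g x) = 0" by simp
    have "(LINT x|I01. indicator (- A) x *\<^sub>R g x) = (LINT x|I01. g x - indicator A x *\<^sub>R g x)"
      by (rule Bochner_Integration.integral_cong) (auto simp: indicator_def)
    also have "\<dots> = 0" using compl gi gind full by simp
    finally show ?case .
  next
    case (union A)
    have int: "integrable I01 (\<lambda>x. (\<Sum>i<n. indicator (A i) x) *\<^sub>R g x)" for n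
      unfolding scaleR_sum_left using union by (intro Bochner_Integration.integrable_sum gind) auto
    have "(\<lambda>n. LINT x|I01. (\<Sum>i<n. indicator (A i) x) *\<^sub>R g x) \<longlonglongrightarrow> (LINT x|I01. indicator (\<Union>i. A i) x *\<^sub>R g x)"
    proof (rule integral_dominated_convergence[where w="\<lambda>x. norm (g x)"])
      show "AE x in I01. (\<lambda>n. (\<Sum>i<n. indicator (A i) x) *\<^sub>R g x) \<longlonglongrightarrow> indicator (\<Union>i. A i) x *\<^sub>R g x"
        using sum_indicator_disjoint_family[OF union(1)] by (intro AE_I2 tendsto_intros)
      show "AE x in I01. norm ((\<Sum>i<n. indicator (A i) x) *\<^sub>R g x) \<le> norm (g x)" for n
        using sum_indicator_disjoint_family(2,3)[OF union(1), of _ n]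
        by (intro AE_I2) (auto intro!: mult_left_le_one_le)
      show "(\<lambda>x. indicator (\<Union>i. A i) x *\<^sub>R g x) \<in> borel_measurable I01"
        using union by (intro borel_measurable_integrable gind) auto
    qed (use int gi in auto)
    moreover have "(LINT x|I01. (\<Sum>i<n. indicator (A i) x) *\<^sub>R g x) = 0" for n
      unfolding scaleR_sum_left using union gind
      by (subst Bochner_Integration.integral_sum) (auto simp: subset_eq)
    ultimately show ?case by (simp add: LIMSEQ_const_iff)
  qed
  show ?thesis
  proof (rule density_zero[OF gi])
    fix A assume "A \<in> sets I01"
    then have "A \<in> sets lebesgue" by (auto simp: sets_restrict_space)
    from zero[OF this] show "set_lebesgue_integral I01 A g = 0" by (simp add: set_lebesgue_integral_def)
  qed
qed

section \<open>Elements of the Hilbert space and their representatives\<close>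

lemma square_integrable_rep_l2: "square_integrable (rep_l2 f)"
  using Quotient_rep_reflp[OF Quotient_l2] by (auto simp: l2_rel_def)

lemma rep_abs_l2:
  assumes "square_integrable u"
  shows "AE x in I01. rep_l2 (abs_l2 u) x = u x"
  using Quotient_rep_abs[OF Quotient_l2, of u] assms by (simp add: l2_rel_def)

lemma abs_l2_cong:
  assumes "square_integrable u" "square_integrable v" "AE x in I01. u x = v x"
  shows "abs_l2 u = abs_l2 v"
  using Quotient_rel_abs[OF Quotient_l2] assms by (simp add: l2_rel_def)

lemma abs_rep_l2: "abs_l2 (rep_l2 f) = f"
  by (rule Quotient_abs_rep[OF Quotient_l2])

lemma l2_eqI:
  assumes "AE x in I01. rep_l2 f x = rep_l2 g x"
  shows "f = g"
  using abs_l2_cong[OF square_integrable_rep_l2 square_integrable_rep_l2 assms] by (simp add: abs_rep_l2)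

lemma abs_l2_eq_iff:
  assumes "square_integrable u" "square_integrable v"
  shows "abs_l2 u = abs_l2 v \<longleftrightarrow> (AE x in I01. u x = v x)"
  using Quotient_rel[OF Quotient_l2, of u v] assms by (auto simp: l2_rel_def)

lemma rep_plus: "AE x in I01. rep_l2 (f + g) x = rep_l2 f x + rep_l2 g x"
  unfolding plus_l2_def by (simp add: rep_abs_l2 square_integrable_add square_integrable_rep_l2)

lemma rep_scaleR: "AE x in I01. rep_l2 (c *\<^sub>R f) x = c *\<^sub>R rep_l2 f x"
  unfolding scaleR_l2_def by (simp add: rep_abs_l2 square_integrable_scaleR square_integrable_rep_l2)

lemma rep_scaleC: "AE x in I01. rep_l2 (c *\<^sub>C f) x = c *s rep_l2 f x"
  unfolding scaleC_def by (simp add: rep_abs_l2 square_integrable_cscale square_integrable_rep_l2)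

lemma rep_mat_app: "AE x in I01. rep_l2 (mat_app A f) x = A *v rep_l2 f x"
  unfolding mat_app_def by (simp add: rep_abs_l2 square_integrable_matrix square_integrable_rep_l2)

lemma rep_zero: "AE x in I01. rep_l2 0 x = 0"
  unfolding zero_l2_def by (simp add: rep_abs_l2 square_integrable_zero)

lemma rep_uminus: "AE x in I01. rep_l2 (- f) x = - rep_l2 f x"
  using rep_scaleR[of "-1" f] by simp

lemma rep_minus: "AE x in I01. rep_l2 (f - g) x = rep_l2 f x - rep_l2 g x"
  using rep_plus[of f "- g"] rep_uminus[of g] by eventually_elim simp

lemma rep_l2_absolutely_integrable: "rep_l2 f absolutely_integrable_on {0..1}"
  and rep_l2_integrable: "integrable I01 (rep_l2 f)"
proof -
  interpret finite_measure I01 by (rule finite_measure_I01)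
  have sq: "rep_l2 f \<in> borel_measurable I01" "integrable I01 (\<lambda>x. (norm (rep_l2 f x))\<^sup>2)"
    using square_integrable_rep_l2[of f] by (auto simp: square_integrable_def)
  show "integrable I01 (rep_l2 f)"
  proof (rule Bochner_Integration.integrable_bound)
    show "integrable I01 (\<lambda>x. 1 + (norm (rep_l2 f x))\<^sup>2)" using sq by simp
    have "t \<le> 1 + t\<^sup>2" for t :: real
      using zero_le_power2[of "t - 1/2"] by (simp add: power2_eq_square algebra_simps)
    then show "AE x in I01. norm (rep_l2 f x) \<le> norm (1 + (norm (rep_l2 f x))\<^sup>2)"
      by (intro AE_I2) (simp add: abs_of_nonneg add_nonneg_nonneg)
  qed (rule sq)
  then show "rep_l2 f absolutely_integrable_on {0..1}" by (simp add: I01_absolutely_integrable)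
qed

lemma norm_l2_square: "(norm f)\<^sup>2 = (LINT x|I01. (norm (rep_l2 f x))\<^sup>2)"
proof -
  have "(norm f)\<^sup>2 = Re (LINT x|I01. cdot (rep_l2 f x) (rep_l2 f x))"
    by (simp add: power2_norm_eq_inner inner_l2_def cinner.rep_eq)
  also have "\<dots> = (LINT x|I01. (norm (rep_l2 f x))\<^sup>2)"
    using integrable_cdot[OF square_integrable_rep_l2 square_integrable_rep_l2]
    using integral_Re[of I01 "\<lambda>x. cdot (rep_l2 f x) (rep_l2 f x)"] by (simp add: Re_cdot power2_norm_eq_inner)
  finally show ?thesis .
qed

lemma measure_I01: "measure I01 (space I01) = 1"
  by (simp add: measure_restrict_space)

lemma norm_l2_le:
  assumes "AE x in I01. norm (rep_l2 f x) \<le> B" "0 \<le> B"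
  shows "norm f \<le> B"
proof (rule power2_le_imp_le)
  interpret finite_measure I01 by (rule finite_measure_I01)
  have "(norm f)\<^sup>2 \<le> (LINT x|I01. B\<^sup>2)"
    unfolding norm_l2_square
  proof (rule integral_mono_AE)
    show "integrable I01 (\<lambda>x. (norm (rep_l2 f x))\<^sup>2)"
      using square_integrable_rep_l2[of f] by (simp add: square_integrable_def)
    show "AE x in I01. (norm (rep_l2 f x))\<^sup>2 \<le> B\<^sup>2"
      using assms(1) by eventually_elim (rule power_mono, auto)
  qed simp
  then show "(norm f)\<^sup>2 \<le> B\<^sup>2" using measure_I01 by simp
qed fact

text \<open>The Cauchy-Schwarz inequality against the constant 1, proved as non-negativity of a
  variance; the measure has total mass 1.\<close>

lemma integral_norm_rep_l2_le: "integral {0..1} (\<lambda>x. norm (rep_l2 f x)) \<le> norm f"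
proof -
  interpret finite_measure I01 by (rule finite_measure_I01)
  have sq: "integrable I01 (\<lambda>x. (norm (rep_l2 f x))\<^sup>2)"
    using square_integrable_rep_l2[of f] by (auto simp: square_integrable_def)
  have i: "integrable I01 (\<lambda>x. norm (rep_l2 f x))" by (rule integrable_norm[OF rep_l2_integrable])
  define N where "N = (LINT x|I01. norm (rep_l2 f x))"
  have "0 \<le> (LINT x|I01. (norm (rep_l2 f x) - N)\<^sup>2)" by (rule integral_nonneg_AE) simp
  also have "\<dots> = (LINT x|I01. (norm (rep_l2 f x))\<^sup>2 - 2 * N * norm (rep_l2 f x) + N\<^sup>2)"
    by (simp add: power2_eq_square algebra_simps)
  also have "\<dots> = (norm f)\<^sup>2 - N\<^sup>2"
    using sq i measure_I01 by (simp add: norm_l2_square N_def[symmetric]) (simp add: power2_eq_square)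
  finally have "N\<^sup>2 \<le> (norm f)\<^sup>2" by simp
  then have "N \<le> norm f" by (rule power2_le_imp_le) simp
  then show ?thesis using LINT_I01[OF i] by (simp add: N_def)
qed

lemma square_integrable_continuous:
  assumes "continuous_on {0..1} F"
  shows "square_integrable F"
  unfolding square_integrable_def
proof
  have "F \<in> borel_measurable (lebesgue_on {0..1})"
    by (rule continuous_imp_measurable_on_sets_lebesgue[OF assms]) simp
  then show "F \<in> borel_measurable I01"
    by (rule measurable_restrict_mono) auto
  show "integrable I01 (\<lambda>x. (norm (F x))\<^sup>2)"
    unfolding I01_absolutely_integrable
    by (intro absolutely_integrable_continuous_real continuous_intros assms)
qed

text \<open>The norm of the difference is continuous and non-negative with integral zero, so it
  vanishes at every point, end points included.\<close>

lemma continuous_AE_eq: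
  fixes F G :: "real \<Rightarrow> 'a::euclidean_space"
  assumes "continuous_on {0..1} F" "continuous_on {0..1} G" "AE x in I01. F x = G x" "x \<in> {0..1}"
  shows "F x = G x"
proof -
  have c: "continuous_on {0..1} (\<lambda>x. norm (F x - G x))"
    by (intro continuous_intros assms)
  have "integral {0..1} (\<lambda>x. norm (F x - G x)) = integral {0..1} (\<lambda>x :: real. 0)"
    by (rule integral_spike[where S="{x \<in> {0..1}. \<not> F x = G x}" and T="{0..1}"]) (use assms(3) in \<open>auto simp: AE_I01\<close>)
  then have "\<forall>x\<in>{0..1}. norm (F x - G x) = 0"
    using integral_eq_0_iff[OF c] by simp
  then show ?thesis using assms by simp
qed

lemma absolutely_integrable_scaleR_continuous:
  fixes g :: "real \<Rightarrow> 'a::euclidean_space" and h :: "real \<Rightarrow> real"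
  assumes "g absolutely_integrable_on {0..1}" "continuous_on {0..1} h"
  shows "(\<lambda>x. h x *\<^sub>R g x) absolutely_integrable_on {0..1}"
proof (rule absolutely_integrable_bounded_measurable_product[where h="\<lambda>a b. a *\<^sub>R b"])
  show "bilinear (\<lambda>a b. a *\<^sub>R b :: 'a)"
    by (auto simp: bilinear_def intro!: linearI simp: scaleR_add_left scaleR_add_right)
  show "h \<in> borel_measurable (lebesgue_on {0..1})"
    by (rule continuous_imp_measurable_on_sets_lebesgue[OF assms(2)]) auto
  show "bounded (h ` {0..1})"
    using compact_continuous_image[OF assms(2)] by (auto intro: compact_imp_bounded)
qed (use assms in auto)

section \<open>Integration by parts with test functions and the lemma of du Bois-Reymond\<close>

lemma test_function_deriv:
  assumes "test_function \<psi>"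
  shows "test_function (deriv \<psi>)"
proof -
  obtain a b where ab: "0 < a" "b < 1" "\<And>x. x \<notin> {a..b} \<Longrightarrow> \<psi> x = 0"
    using assms by (auto simp: test_function_def)
  have "deriv \<psi> x = 0" if "x \<notin> {a..b}" for x
  proof (rule DERIV_imp_deriv)
    have "((\<lambda>x. 0) has_real_derivative 0) (at x)" by simp
    then show "(\<psi> has_real_derivative 0) (at x)"
      by (rule has_field_derivative_transform_within_open[where S="- {a..b}"]) (use that ab in auto)
  qed
  moreover have "(deriv ^^ n) (deriv \<psi>) field_differentiable at x" for n x
  proof -
    have "(deriv ^^ Suc n) \<psi> field_differentiable at x" using assms by (simp add: test_function_def del: funpow.simps)
    then show ?thesis by (simp add: funpow_Suc_right del: funpow.simps)
  qed
  ultimately have "(\<forall>n x. (deriv ^^ n) (deriv \<psi>) field_differentiable at x) \<and>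
      (0 < a \<and> b < 1 \<and> (\<forall>x. x \<notin> {a..b} \<longrightarrow> deriv \<psi> x = 0))"
    using ab(1,2) by simp
  then show ?thesis unfolding test_function_def by (elim conjE, intro conjI exI)
qed

lemma test_function_boundary:
  assumes "test_function \<psi>"
  shows "\<psi> 0 = 0" "\<psi> 1 = 0"
proof -
  obtain a b where ab: "0 < a" "b < 1" "\<And>x. x \<notin> {a..b} \<Longrightarrow> \<psi> x = 0"
    using assms by (auto simp: test_function_def)
  show "\<psi> 0 = 0" "\<psi> 1 = 0" using ab by auto
qed

text \<open>The constant \<open>c\<close> makes the formula fit a function given by its initial
  value and the integral of its derivative. It contributes nothing, since the derivative of a test
  function has mean zero.\<close>

lemma test_function_by_parts:
  fixes g :: "real \<Rightarrow> 'a::euclidean_space"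
  assumes "test_function \<psi>" "g absolutely_integrable_on {0..1}"
  shows "integral {0..1} (\<lambda>x. deriv \<psi> x *\<^sub>R (c + integral {0..x} g)) = - integral {0..1} (\<lambda>x. \<psi> x *\<^sub>R g x)"
proof -
  have d: "(\<psi> has_real_derivative deriv \<psi> x) (at x within {0..1})" for x
    using test_function_has_real_derivative(1)[OF assms(1)] has_field_derivative_at_within by blast
  have dc: "continuous_on {0..1} (deriv \<psi>)"
    by (rule test_function_continuous[OF test_function_deriv[OF assms(1)]])
  have bil: "bounded_bilinear (\<lambda>(a::'a) r. r *\<^sub>R a)"
    by (rule bounded_bilinear.flip[OF bounded_bilinear_scaleR])
  have gi: "g integrable_on {0..1}" using assms(2) by (simp add: absolutely_integrable_on_def)
  have ibp: "integral {0..1} (\<lambda>x. \<psi> x *\<^sub>R g x) + integral {0..1} (\<lambda>x. deriv \<psi> x *\<^sub>R integral {0..x} g) = 0"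
    using integral_by_parts_indefinite[OF bil assms(2), of \<psi> "deriv \<psi>" 1] d dc
      test_function_boundary[OF assms(1)] by (simp add: has_real_derivative_iff_has_vector_derivative)
  have "((deriv \<psi>) has_integral (\<psi> 1 - \<psi> 0)) {0..1}"
    by (rule fundamental_theorem_of_calculus) (use d in \<open>auto simp: has_real_derivative_iff_has_vector_derivative\<close>)
  then have "((\<lambda>x. deriv \<psi> x *\<^sub>R c) has_integral 0) {0..1}"
    using has_integral_linear[OF _ bounded_linear_scaleR_left, of "deriv \<psi>" 0 "{0..1}" c]
      test_function_boundary[OF assms(1)] by (simp add: o_def)
  then have "integral {0..1} (\<lambda>x. deriv \<psi> x *\<^sub>R c + deriv \<psi> x *\<^sub>R integral {0..x} g) =
      integral {0..1} (\<lambda>x. deriv \<psi> x *\<^sub>R integral {0..x} g)"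
    by (subst integral_add) (auto intro!: integrable_continuous_real continuous_intros dc integral_Icc_continuous[OF gi])
  with ibp show ?thesis by (simp add: scaleR_add_right eq_neg_iff_add_eq_0 add.commute)
qed

text \<open>If all test functions had integral zero, the fundamental lemma applied to the constant 1
  would give 1 = 0 almost everywhere.\<close>

lemma test_function_integral_one:
  obtains \<eta> where "test_function \<eta>" "integral {0..1} \<eta> = 1"
proof -
  have "\<exists>\<eta>. test_function \<eta> \<and> integral {0..1} \<eta> \<noteq> 0"
  proof (rule ccontr)
    assume "\<not> ?thesis"
    then have "AE x in I01. (1::real) = 0"
      by (intro fundamental_lemma_variations) auto
    then have "negligible (cbox 0 (1::real))" unfolding AE_I01 by (rule negligible_subset) auto
    then show False unfolding negligible_interval by simp
  qed
  then obtain \<eta> where \<eta>: "test_function \<eta>" "integral {0..1} \<eta> \<noteq> 0" by blast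
  show thesis
  proof (rule that)
    show "test_function (\<lambda>x. 0 + (1 / integral {0..1} \<eta>) * \<eta> x)"
      by (rule test_function_add[OF test_function_zero \<eta>(1)])
  qed (use \<eta> in simp)
qed

text \<open>Subtracting the right multiple of \<open>\<eta>0\<close> from a test function leaves one
  of mean zero, hence the derivative of a test function, to which the hypothesis applies. So every
  test function annihilates k - \<kappa>, where \<kappa> is the mean of \<open>k\<close> weighted by
  \<open>\<eta>0\<close>, the only possible value of the constant.\<close>

lemma du_Bois_Reymond:
  fixes k :: "real \<Rightarrow> 'a::euclidean_space"
  assumes k: "continuous_on {0..1} k"
    and test: "\<And>\<psi>. test_function \<psi> \<Longrightarrow> integral {0..1} (\<lambda>x. deriv \<psi> x *\<^sub>R k x) = 0"
    and x: "x \<in> {0..1}"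
  shows "k x = k 0"
proof -
  obtain \<eta>0 where \<eta>0: "test_function \<eta>0" "integral {0..1} \<eta>0 = 1" by (rule test_function_integral_one)
  define \<kappa> where "\<kappa> = integral {0..1} (\<lambda>x. \<eta>0 x *\<^sub>R k x)"
  have int: "(\<lambda>x. \<eta> x *\<^sub>R l x) integrable_on {0..1}" "\<eta> integrable_on {0..1}"
    if "test_function \<eta>" "continuous_on {0..1} l" for \<eta> and l :: "real \<Rightarrow> 'a"
    using that by (auto intro!: integrable_continuous_real continuous_intros test_function_continuous)
  have "AE x in I01. k x - \<kappa> = 0"
  proof (rule fundamental_lemma_variations)
    show "(\<lambda>x. k x - \<kappa>) absolutely_integrable_on {0..1}"
      by (intro absolutely_integrable_continuous_real continuous_intros k)
    fix \<eta> assume \<eta>: "test_function \<eta>"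
    define m where "m = integral {0..1} \<eta>"
    have "test_function (\<lambda>x. \<eta> x + (- m) * \<eta>0 x)" by (rule test_function_add[OF \<eta> \<eta>0(1)])
    moreover have "integral {0..1} (\<lambda>x. \<eta> x + (- m) * \<eta>0 x) = 0"
      using int(2)[OF \<eta> k] integrable_on_mult_right[OF int(2)[OF \<eta>0(1) k], of "- m"]
      by (subst integral_add) (auto simp: \<eta>0 m_def)
    ultimately obtain \<psi> where \<psi>: "test_function \<psi>" "deriv \<psi> = (\<lambda>x. \<eta> x + (- m) * \<eta>0 x)"
      by (rule test_function_primitive)
    have "0 = integral {0..1} (\<lambda>x. (\<eta> x + (- m) * \<eta>0 x) *\<^sub>R k x)"
      using test[OF \<psi>(1)] by (simp add: \<psi>(2))
    also have "\<dots> = integral {0..1} (\<lambda>x. \<eta> x *\<^sub>R k x - m *\<^sub>R (\<eta>0 x *\<^sub>R k x))"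
      by (simp add: scaleR_left_diff_distrib)
    also have "\<dots> = integral {0..1} (\<lambda>x. \<eta> x *\<^sub>R k x) - m *\<^sub>R \<kappa>"
      using int(1)[OF \<eta> k] integrable_cmul[OF int(1)[OF \<eta>0(1) k], of m]
      by (subst integral_diff) (auto simp: \<kappa>_def simp del: scaleR_scaleR)
    finally have e: "integral {0..1} (\<lambda>x. \<eta> x *\<^sub>R k x) = m *\<^sub>R \<kappa>" by simp
    have "integral {0..1} (\<lambda>x. \<eta> x *\<^sub>R \<kappa>) = m *\<^sub>R \<kappa>"
      using integral_linear[OF int(2)[OF \<eta> k] bounded_linear_scaleR_left, of \<kappa>] by (simp add: m_def o_def)
    with e show "integral {0..1} (\<lambda>x. \<eta> x *\<^sub>R (k x - \<kappa>)) = 0"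
      using int(1)[OF \<eta> k] int(1)[OF \<eta>, of "\<lambda>_. \<kappa>"]
      by (simp add: scaleR_right_diff_distrib integral_diff)
  qed
  then have "AE x in I01. k x = \<kappa>" by simp
  from continuous_AE_eq[OF k continuous_on_const this] x show ?thesis by simp
qed

section \<open>The second derivative on its domain\<close>

lemma AE_eq_integral_eq:
  fixes f g :: "real \<Rightarrow> 'a::euclidean_space"
  assumes "AE x in I01. f x = g x" "{a..b} \<subseteq> {0..1}"
  shows "integral {a..b} f = integral {a..b} g"
  by (rule integral_spike[of "{x \<in> {0..1}. \<not> f x = g x}"]) (use assms in \<open>auto simp: AE_I01\<close>)

lemma has_weak_deriv2_iff:
  "has_weak_deriv2 f g \<longleftrightarrow> (\<forall>\<psi>. test_function \<psi> \<longrightarrow>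
     integral {0..1} (\<lambda>x. deriv (deriv \<psi>) x *\<^sub>R rep_l2 f x) = integral {0..1} (\<lambda>x. \<psi> x *\<^sub>R rep_l2 g x))"
proof -
  have "(LINT x|I01. h x *\<^sub>R rep_l2 f x) = integral {0..1} (\<lambda>x. h x *\<^sub>R rep_l2 f x)"
    if "test_function h" for h f
    by (rule LINT_I01)
      (simp add: I01_absolutely_integrable absolutely_integrable_scaleR_continuous
        rep_l2_absolutely_integrable test_function_continuous[OF that])
  then show ?thesis
    unfolding has_weak_deriv2_def
    by (auto simp: numeral_2_eq_2 test_function_deriv)
qed

lemma has_weak_deriv2_unique:
  assumes "has_weak_deriv2 f g" "has_weak_deriv2 f h"
  shows "g = h"
proof (rule l2_eqI)
  have "AE x in I01. rep_l2 g x - rep_l2 h x = 0"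
  proof (rule fundamental_lemma_variations)
    show "(\<lambda>x. rep_l2 g x - rep_l2 h x) absolutely_integrable_on {0..1}"
      by (intro set_integral_diff rep_l2_absolutely_integrable)
    fix \<psi> assume \<psi>: "test_function \<psi>"
    have i: "(\<lambda>x. \<psi> x *\<^sub>R rep_l2 f x) integrable_on {0..1}" for f
      using absolutely_integrable_scaleR_continuous[OF rep_l2_absolutely_integrable test_function_continuous[OF \<psi>]]
      by (simp add: absolutely_integrable_on_def)
    show "integral {0..1} (\<lambda>x. \<psi> x *\<^sub>R (rep_l2 g x - rep_l2 h x)) = 0"
      using assms \<psi> unfolding has_weak_deriv2_iff
      by (simp add: scaleR_right_diff_distrib integral_diff i)
  qed
  then show "AE x in I01. rep_l2 g x = rep_l2 h x" by simp
qed

lemma weak_deriv2_eq: "has_weak_deriv2 f g \<Longrightarrow> weak_deriv2 f = g"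
  unfolding weak_deriv2_def using has_weak_deriv2_unique by blast

text \<open>The relation F'' = w in integrated form. It is stable under changing \<open>w\<close> on
  a null set and asks for no pointwise derivative of \<open>F'\<close>.\<close>

definition strong_deriv2 ::
    "l2 \<Rightarrow> l2 \<Rightarrow> (real \<Rightarrow> complex ^ 2) \<Rightarrow> (real \<Rightarrow> complex ^ 2) \<Rightarrow> bool" where
  "strong_deriv2 f w F F' \<longleftrightarrow> C1_representative f F F' \<and>
     (\<forall>x\<in>{0..1}. F' x = F' 0 + integral {0..x} (rep_l2 w))"

lemma strong_deriv2D:
  "strong_deriv2 f w F F' \<Longrightarrow> x \<in> {0..1} \<Longrightarrow> F' x = F' 0 + integral {0..x} (rep_l2 w)"
  unfolding strong_deriv2_def by blast

lemma C1_representative_test: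
  assumes "C1_representative f F F'" "test_function \<psi>"
  shows "integral {0..1} (\<lambda>x. deriv (deriv \<psi>) x *\<^sub>R rep_l2 f x) = - integral {0..1} (\<lambda>x. deriv \<psi> x *\<^sub>R F' x)"
proof -
  have F: "\<And>x. x \<in> {0..1} \<Longrightarrow> (F has_vector_derivative F' x) (at x within {0..1})"
      and ae: "AE x in I01. rep_l2 f x = F x" and c: "continuous_on {0..1} F'"
    using assms by (auto simp: C1_representative_def)
  have "integral {0..1} (\<lambda>x. deriv (deriv \<psi>) x *\<^sub>R rep_l2 f x) = integral {0..1} (\<lambda>x. deriv (deriv \<psi>) x *\<^sub>R F x)"
  proof (rule AE_eq_integral_eq)
    show "AE x in I01. deriv (deriv \<psi>) x *\<^sub>R rep_l2 f x = deriv (deriv \<psi>) x *\<^sub>R F x"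
      using ae by eventually_elim simp
  qed simp
  also have "\<dots> = integral {0..1} (\<lambda>x. deriv (deriv \<psi>) x *\<^sub>R (F 0 + integral {0..x} F'))"
    using integral_has_vector_derivative_Icc[OF F, of 0]
    by (intro Henstock_Kurzweil_Integration.integral_cong) auto
  also have "\<dots> = - integral {0..1} (\<lambda>x. deriv \<psi> x *\<^sub>R F' x)"
    by (rule test_function_by_parts[OF test_function_deriv[OF assms(2)]])
      (rule absolutely_integrable_continuous_real[OF c])
  finally show ?thesis .
qed

lemma strong_deriv2_imp_weak:
  assumes "strong_deriv2 f w F F'"
  shows "has_weak_deriv2 f w"
  unfolding has_weak_deriv2_iff
proof (intro allI impI)
  fix \<psi> assume \<psi>: "test_function \<psi>"
  have "integral {0..1} (\<lambda>x. deriv \<psi> x *\<^sub>R F' x) = integral {0..1} (\<lambda>x. deriv \<psi> x *\<^sub>R (F' 0 + integral {0..x} (rep_l2 w)))"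
    by (intro Henstock_Kurzweil_Integration.integral_cong arg_cong[OF strong_deriv2D[OF assms]])
  also have "\<dots> = - integral {0..1} (\<lambda>x. \<psi> x *\<^sub>R rep_l2 w x)"
    by (rule test_function_by_parts[OF \<psi> rep_l2_absolutely_integrable])
  finally show "integral {0..1} (\<lambda>x. deriv (deriv \<psi>) x *\<^sub>R rep_l2 f x) = integral {0..1} (\<lambda>x. \<psi> x *\<^sub>R rep_l2 w x)"
    using C1_representative_test[OF _ \<psi>, of f F F'] assms[unfolded strong_deriv2_def, THEN conjunct1] by simp
qed

text \<open>Two integrations by parts show that F' minus the indefinite integral of \<open>w\<close>
  is annihilated by all derivatives of test functions, so it is constant.\<close>

lemma weak_deriv2_imp_strong:
  assumes w: "has_weak_deriv2 f w" and C: "C1_representative f F F'"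
  shows "strong_deriv2 f w F F'"
  unfolding strong_deriv2_def
proof (intro conjI ballI C)
  fix x :: real assume x: "x \<in> {0..1}"
  have Wc: "continuous_on {0..1} (\<lambda>x. integral {0..x} (rep_l2 w))"
    using rep_l2_absolutely_integrable by (intro integral_Icc_continuous) (simp add: absolutely_integrable_on_def)
  have c: "continuous_on {0..1} F'" using C by (simp add: C1_representative_def)
  have "F' x - integral {0..x} (rep_l2 w) = F' 0 - integral {0..0} (rep_l2 w)"
  proof (rule du_Bois_Reymond[OF _ _ x])
    fix \<psi> assume \<psi>: "test_function \<psi>"
    have dc: "continuous_on {0..1} (deriv \<psi>)"
      by (rule test_function_continuous[OF test_function_deriv[OF \<psi>]])
    have "integral {0..1} (\<lambda>x. deriv \<psi> x *\<^sub>R F' x) = - integral {0..1} (\<lambda>x. \<psi> x *\<^sub>R rep_l2 w x)"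
      using C1_representative_test[OF C \<psi>] w \<psi> unfolding has_weak_deriv2_iff by simp
    moreover have "integral {0..1} (\<lambda>x. deriv \<psi> x *\<^sub>R integral {0..x} (rep_l2 w)) = - integral {0..1} (\<lambda>x. \<psi> x *\<^sub>R rep_l2 w x)"
      using test_function_by_parts[OF \<psi> rep_l2_absolutely_integrable, of 0 w] by simp
    ultimately show "integral {0..1} (\<lambda>x. deriv \<psi> x *\<^sub>R (F' x - integral {0..x} (rep_l2 w))) = 0"
      by (simp add: scaleR_right_diff_distrib integral_diff integrable_continuous_real continuous_on_scaleR dc c Wc)
  qed (intro continuous_intros c Wc)
  then show "F' x = F' 0 + integral {0..x} (rep_l2 w)" by (simp add: algebra_simps)
qed

definition boundary_conditions :: "(real \<Rightarrow> complex ^ 2) \<Rightarrow> (real \<Rightarrow> complex ^ 2) \<Rightarrow> bool" where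
  "boundary_conditions F F' \<longleftrightarrow> F 0 $ 1 = 0 \<and> F 1 $ 1 = 0 \<and> F' 0 $ 2 = 0 \<and> F' 1 $ 2 = 0"

lemma Dom_D_I:
  assumes "strong_deriv2 f w F F'" "boundary_conditions F F'"
  shows "f \<in> Dom_D" "weak_deriv2 f = w"
proof -
  show "f \<in> Dom_D"
    using strong_deriv2_imp_weak[OF assms(1)] assms
    unfolding Dom_D_def W22_def strong_deriv2_def boundary_conditions_def by blast
  show "weak_deriv2 f = w" by (rule weak_deriv2_eq[OF strong_deriv2_imp_weak[OF assms(1)]])
qed

lemma Dom_D_E:
  assumes "f \<in> Dom_D"
  obtains F F' where "strong_deriv2 f (weak_deriv2 f) F F'" "boundary_conditions F F'"
proof -
  obtain g F F' where g: "has_weak_deriv2 f g" and F: "C1_representative f F F'" "boundary_conditions F F'"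
    using assms unfolding Dom_D_def W22_def boundary_conditions_def by blast
  from weak_deriv2_imp_strong[OF g F(1)] F(2) show thesis
    unfolding weak_deriv2_eq[OF g, symmetric] by (rule that)
qed

lemma strong_deriv2_abs:
  assumes F: "\<And>x. x \<in> {0..1} \<Longrightarrow> (F has_vector_derivative F' x) (at x within {0..1})"
    and w: "square_integrable w" and F': "\<And>x. x \<in> {0..1} \<Longrightarrow> F' x = F' 0 + integral {0..x} w"
  shows "strong_deriv2 (abs_l2 F) (abs_l2 w) F F'"
proof -
  have eq: "F' x = F' 0 + integral {0..x} (rep_l2 (abs_l2 w))" if "x \<in> {0..1}" for x
    using F'[OF that] AE_eq_integral_eq[OF rep_abs_l2[OF w], of 0 x] that by simp
  have "continuous_on {0..1} (\<lambda>x. F' 0 + integral {0..x} (rep_l2 (abs_l2 w)))"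
    using rep_l2_absolutely_integrable[of "abs_l2 w"]
    by (intro continuous_intros integral_Icc_continuous) (simp add: absolutely_integrable_on_def)
  then have "continuous_on {0..1} F'" using eq by (metis (no_types, lifting) continuous_on_cong)
  moreover have "continuous_on {0..1} F"
    by (rule continuous_on_vector_derivative) (use F in auto)
  ultimately show ?thesis
    using F eq rep_abs_l2[OF square_integrable_continuous]
    unfolding strong_deriv2_def C1_representative_def by blast
qed

lemma strong_deriv2_linear:
  assumes "strong_deriv2 f w F F'" "strong_deriv2 g v G G'"
  shows "strong_deriv2 (f + c *\<^sub>C g) (w + c *\<^sub>C v) (\<lambda>x. F x + c *s G x) (\<lambda>x. F' x + c *s G' x)"
proof -
  have C: "C1_representative f F F'" "C1_representative g G G'"
    using assms by (auto simp: strong_deriv2_def)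
  have ae: "AE x in I01. rep_l2 (f + c *\<^sub>C g) x = rep_l2 f x + c *s rep_l2 g x" for f g
    using rep_plus[of f "c *\<^sub>C g"] rep_scaleC[of c g] by eventually_elim simp
  have "AE x in I01. rep_l2 f x = F x" "AE x in I01. rep_l2 g x = G x"
    using C by (auto simp: C1_representative_def)
  then have "AE x in I01. rep_l2 (f + c *\<^sub>C g) x = F x + c *s G x"
    using ae[of f g] by eventually_elim simp
  moreover have "((\<lambda>x. F x + c *s G x) has_vector_derivative F' x + c *s G' x) (at x within {0..1})"
    if "x \<in> {0..1}" for x
    using C that unfolding C1_representative_def
    by (intro has_vector_derivative_add bounded_linear.has_vector_derivative[OF bounded_linear_cscale]) auto
  moreover have "continuous_on {0..1} (\<lambda>x. F' x + c *s G' x)"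
    using C unfolding C1_representative_def
    by (intro continuous_on_add bounded_linear.continuous_on[OF bounded_linear_cscale]) auto
  moreover have "F' x + c *s G' x = F' 0 + c *s G' 0 + integral {0..x} (rep_l2 (w + c *\<^sub>C v))"
    if "x \<in> {0..1}" for x
  proof -
    have i: "rep_l2 f integrable_on {0..x}" for f
      using rep_l2_absolutely_integrable[of f] that
      by (auto simp: absolutely_integrable_on_def intro: integrable_on_subinterval)
    have "integral {0..x} (rep_l2 (w + c *\<^sub>C v)) = integral {0..x} (\<lambda>x. rep_l2 w x + c *s rep_l2 v x)"
      by (rule AE_eq_integral_eq[OF ae]) (use that in auto)
    also have "\<dots> = integral {0..x} (rep_l2 w) + c *s integral {0..x} (rep_l2 v)"
      using integral_linear[OF i bounded_linear_cscale] integrable_linear[OF i bounded_linear_cscale]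
      by (subst integral_add) (auto simp: o_def i)
    finally show ?thesis
      using strong_deriv2D[OF assms(1) that] strong_deriv2D[OF assms(2) that]
      by (simp only: vector_add_ldistrib add_ac)
  qed
  ultimately show ?thesis unfolding strong_deriv2_def C1_representative_def by blast
qed

lemma Dom_D_linear:
  assumes "f \<in> Dom_D" "g \<in> Dom_D"
  shows "f + c *\<^sub>C g \<in> Dom_D" "weak_deriv2 (f + c *\<^sub>C g) = weak_deriv2 f + c *\<^sub>C weak_deriv2 g"
proof -
  obtain F F' where F: "strong_deriv2 f (weak_deriv2 f) F F'" "boundary_conditions F F'" using Dom_D_E[OF assms(1)] .
  obtain G G' where G: "strong_deriv2 g (weak_deriv2 g) G G'" "boundary_conditions G G'" using Dom_D_E[OF assms(2)] .
  have "boundary_conditions (\<lambda>x. F x + c *s G x) (\<lambda>x. F' x + c *s G' x)" using F(2) G(2) by (simp add: boundary_conditions_def)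
  from Dom_D_I[OF strong_deriv2_linear[OF F(1) G(1)] this]
  show "f + c *\<^sub>C g \<in> Dom_D" "weak_deriv2 (f + c *\<^sub>C g) = weak_deriv2 f + c *\<^sub>C weak_deriv2 g" .
qed

lemma zero_Dom_D: "0 \<in> Dom_D"
proof -
  have "strong_deriv2 (abs_l2 (\<lambda>x. 0)) (abs_l2 (\<lambda>x. 0)) (\<lambda>x. 0) (\<lambda>x. 0)"
    by (rule strong_deriv2_abs) (auto simp: square_integrable_zero)
  from Dom_D_I(1)[OF this] show ?thesis by (simp add: boundary_conditions_def zero_l2_def)
qed

lemma bounded_bilinear_cdot: "bounded_bilinear cdot"
  unfolding bilinear_conv_bounded_bilinear[symmetric] bilinear_def
  by (auto simp: cdot_def sum_2 algebra_simps scaleR_add_right intro!: linearI)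

text \<open>The boundary terms are \<open>cdot (F' x) (G x)\<close> at x = 0 and x = 1. They vanish
  componentwise: the first component of \<open>G\<close> and the second component of
  \<open>F'\<close> are zero at both ends.\<close>

lemma cinner_weak_deriv2:
  assumes "strong_deriv2 f w F F'" "boundary_conditions F F'" "strong_deriv2 g v G G'" "boundary_conditions G G'"
  shows "cinner w g = - integral {0..1} (\<lambda>x. cdot (F' x) (G' x))"
proof -
  interpret bounded_bilinear cdot by (rule bounded_bilinear_cdot)
  have C: "C1_representative f F F'" "C1_representative g G G'"
    using assms by (auto simp: strong_deriv2_def)
  have G: "\<And>x. x \<in> {0..1} \<Longrightarrow> (G has_vector_derivative G' x) (at x within {0..1})"
      and c: "continuous_on {0..1} F'" "continuous_on {0..1} G'" and ae: "AE x in I01. rep_l2 g x = G x"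
    using C by (auto simp: C1_representative_def)
  have "cinner w g = integral {0..1} (\<lambda>x. cdot (rep_l2 w x) (rep_l2 g x))"
    unfolding cinner.rep_eq
    by (rule LINT_I01) (rule integrable_cdot[OF square_integrable_rep_l2 square_integrable_rep_l2])
  also have "\<dots> = integral {0..1} (\<lambda>x. cdot (rep_l2 w x) (G x))"
  proof (rule AE_eq_integral_eq)
    show "AE x in I01. cdot (rep_l2 w x) (rep_l2 g x) = cdot (rep_l2 w x) (G x)"
      using ae by eventually_elim simp
  qed simp
  also have "\<dots> = cdot (integral {0..1} (rep_l2 w)) (G 1) - integral {0..1} (\<lambda>x. cdot (integral {0..x} (rep_l2 w)) (G' x))"
    using integral_by_parts_indefinite[OF bounded_bilinear_cdot rep_l2_absolutely_integrable G c(2), of 1 w] by simp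
  also have "integral {0..1} (\<lambda>x. cdot (integral {0..x} (rep_l2 w)) (G' x)) =
      integral {0..1} (\<lambda>x. cdot (F' x) (G' x) - cdot (F' 0) (G' x))"
  proof (rule Henstock_Kurzweil_Integration.integral_cong)
    fix x :: real assume "x \<in> {0..1}"
    from strong_deriv2D[OF assms(1) this]
    show "cdot (integral {0..x} (rep_l2 w)) (G' x) = cdot (F' x) (G' x) - cdot (F' 0) (G' x)"
      by (simp add: diff_left[symmetric])
  qed
  also have "\<dots> = integral {0..1} (\<lambda>x. cdot (F' x) (G' x)) - cdot (F' 0) (G 1 - G 0)"
  proof -
    have "integral {0..1} (\<lambda>x. cdot (F' 0) (G' x)) = cdot (F' 0) (G 1 - G 0)"
      using integral_linear[OF _ bounded_linear_right[of "F' 0"], of G' "{0..1}"]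
        integral_has_vector_derivative_Icc[OF G, of 0 1] by (simp add: o_def)
    then show ?thesis
      by (subst integral_diff) (auto intro!: integrable_continuous_real continuous_on c continuous_intros)
  qed
  also have "integral {0..1} (rep_l2 w) = F' 1 - F' 0" using strong_deriv2D[OF assms(1), of 1] by simp
  also have "cdot (F' 1 - F' 0) (G 1) - (integral {0..1} (\<lambda>x. cdot (F' x) (G' x)) - cdot (F' 0) (G 1 - G 0))
     = - integral {0..1} (\<lambda>x. cdot (F' x) (G' x))"
    using assms(2,4) by (simp add: boundary_conditions_def cdot_def sum_2 algebra_simps)
  finally show ?thesis .
qed

section \<open>The scalar oscillator equation\<close>

text \<open>The variation-of-constants integral of sin (\<omega> (x - t)) / \<omega> against
  \<open>k\<close>, expanded by the addition theorem so that \<open>x\<close> leaves the integrands.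
  The next definition is the same with the kernel cos (\<omega> (x - t)).\<close>

definition duhamel :: "complex \<Rightarrow> (real \<Rightarrow> complex) \<Rightarrow> real \<Rightarrow> complex" where
  "duhamel \<omega> k x = (sin (\<omega> * of_real x) * integral {0..x} (\<lambda>t. cos (\<omega> * of_real t) * k t)
     - cos (\<omega> * of_real x) * integral {0..x} (\<lambda>t. sin (\<omega> * of_real t) * k t)) / \<omega>"

definition duhamel' :: "complex \<Rightarrow> (real \<Rightarrow> complex) \<Rightarrow> real \<Rightarrow> complex" where
  "duhamel' \<omega> k x = cos (\<omega> * of_real x) * integral {0..x} (\<lambda>t. cos (\<omega> * of_real t) * k t)
     + sin (\<omega> * of_real x) * integral {0..x} (\<lambda>t. sin (\<omega> * of_real t) * k t)"

lemma sin_cos_has_vector_derivative: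
  fixes \<omega> :: complex
  shows "((\<lambda>x. sin (\<omega> * of_real x)) has_vector_derivative \<omega> * cos (\<omega> * of_real x)) (at x within S)"
    and "((\<lambda>x. cos (\<omega> * of_real x)) has_vector_derivative - \<omega> * sin (\<omega> * of_real x)) (at x within S)"
proof -
  have "((\<lambda>z. sin (\<omega> * z)) has_field_derivative \<omega> * cos (\<omega> * of_real x)) (at (of_real x))"
    "((\<lambda>z. cos (\<omega> * z)) has_field_derivative - \<omega> * sin (\<omega> * of_real x)) (at (of_real x))"
    by (auto intro!: derivative_eq_intros)
  from this[THEN has_vector_derivative_real_field]
  show "((\<lambda>x. sin (\<omega> * of_real x)) has_vector_derivative \<omega> * cos (\<omega> * of_real x)) (at x within S)"
    "((\<lambda>x. cos (\<omega> * of_real x)) has_vector_derivative - \<omega> * sin (\<omega> * of_real x)) (at x within S)"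
    by (auto intro: has_vector_derivative_at_within)
qed

lemma absolutely_integrable_mult_continuous:
  fixes k h :: "real \<Rightarrow> complex"
  assumes "k absolutely_integrable_on {0..1}" "continuous_on {0..1} h"
  shows "(\<lambda>x. h x * k x) absolutely_integrable_on {0..1}"
proof (rule absolutely_integrable_bounded_measurable_product[where h="\<lambda>a b. a * b"])
  show "bilinear (\<lambda>a b. a * b :: complex)"
    by (auto simp: bilinear_def intro!: linearI simp: algebra_simps)
  show "h \<in> borel_measurable (lebesgue_on {0..1})"
    by (rule continuous_imp_measurable_on_sets_lebesgue[OF assms(2)]) auto
  show "bounded (h ` {0..1})"
    using compact_continuous_image[OF assms(2)] by (auto intro: compact_imp_bounded)
qed (use assms in auto)

context
  fixes \<omega> :: complex and k :: "real \<Rightarrow> complex"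
  assumes \<omega>: "\<omega> \<noteq> 0" and k: "k absolutely_integrable_on {0..1}"
begin

text \<open>As \<open>k\<close> is merely integrable, the two indefinite integrals are not
  differentiated but multiplied by sine and cosine and integrated by parts. The terms containing
  \<open>k\<close> cancel in the first identity and add up to \<open>k\<close> in the second,
  because cos^2 + sin^2 = 1.\<close>

lemma duhamel_integrals:
  assumes x: "x \<in> {0..1}"
  shows "duhamel \<omega> k x = integral {0..x} (duhamel' \<omega> k)"
    and "duhamel' \<omega> k x = integral {0..x} (\<lambda>t. k t - \<omega>\<^sup>2 * duhamel \<omega> k t)"
    and "continuous_on {0..1} (duhamel \<omega> k)" and "continuous_on {0..1} (duhamel' \<omega> k)"
proof -
  define s where "s t = sin (\<omega> * of_real t)" for t
  define c where "c t = cos (\<omega> * of_real t)" for t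
  define Ck where "Ck x = integral {0..x} (\<lambda>t. c t * k t)" for x
  define Sk where "Sk x = integral {0..x} (\<lambda>t. s t * k t)" for x
  have sc: "continuous_on A s" "continuous_on A c" for A
    unfolding s_def c_def by (intro continuous_intros)+
  have ck: "(\<lambda>t. c t * k t) absolutely_integrable_on {0..1}" and sk: "(\<lambda>t. s t * k t) absolutely_integrable_on {0..1}"
    by (intro absolutely_integrable_mult_continuous k sc)+
  have Cc: "continuous_on {0..1} Ck" and Sc: "continuous_on {0..1} Sk"
    unfolding Ck_def Sk_def using ck sk by (auto intro!: integral_Icc_continuous simp: absolutely_integrable_on_def)
  have D: "duhamel \<omega> k x = (s x * Ck x - c x * Sk x) / \<omega>" "duhamel' \<omega> k x = c x * Ck x + s x * Sk x" for x
    by (simp_all add: duhamel_def duhamel'_def s_def c_def Ck_def Sk_def)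
  show "continuous_on {0..1} (duhamel \<omega> k)" "continuous_on {0..1} (duhamel' \<omega> k)"
    unfolding D using \<omega> by (intro continuous_intros sc Cc Sc; simp)+
  have ds: "(s has_vector_derivative \<omega> * c t) (at t within {0..1})"
    and dc: "(c has_vector_derivative - \<omega> * s t) (at t within {0..1})" for t
    unfolding s_def c_def by (rule sin_cos_has_vector_derivative)+
  note ibp = integral_by_parts_indefinite[OF bounded_bilinear_mult _ _ _ x]
  have cont: "continuous_on {0..1} (\<lambda>t. \<omega> * c t)" "continuous_on {0..1} (\<lambda>t. - \<omega> * s t)"
    by (intro continuous_intros sc)+
  have sub: "{0..x} \<subseteq> {0..1}" using x by auto
  have ci: "(\<lambda>t. f t * g t) integrable_on {0..x}" if "continuous_on {0..1} f" "continuous_on {0..1} g" for f g :: "real \<Rightarrow> complex"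
    by (rule integrable_continuous_real) (intro continuous_intros continuous_on_subset[OF that(1) sub] continuous_on_subset[OF that(2) sub])
  have ki: "(\<lambda>t. h t * k t * g t) integrable_on {0..x}" if "continuous_on {0..1} h" "continuous_on {0..1} g" for h g
  proof -
    have "(\<lambda>t. (h t * g t) * k t) absolutely_integrable_on {0..1}"
      by (intro absolutely_integrable_mult_continuous k continuous_intros that)
    then have "(\<lambda>t. (h t * g t) * k t) integrable_on {0..x}"
      using integrable_on_subinterval[OF _ sub] by (auto simp: absolutely_integrable_on_def)
    then show ?thesis by (simp add: mult_ac)
  qed
  have e1: "Ck x * s x = integral {0..x} (\<lambda>t. c t * k t * s t) + integral {0..x} (\<lambda>t. Ck t * (\<omega> * c t))"
    using ibp[OF ck ds cont(1)] by (simp add: Ck_def)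
  have e2: "Sk x * c x = integral {0..x} (\<lambda>t. s t * k t * c t) + integral {0..x} (\<lambda>t. Sk t * (- \<omega> * s t))"
    using ibp[OF sk dc cont(2)] by (simp add: Sk_def)
  have e3: "Ck x * c x = integral {0..x} (\<lambda>t. c t * k t * c t) + integral {0..x} (\<lambda>t. Ck t * (- \<omega> * s t))"
    using ibp[OF ck dc cont(2)] by (simp add: Ck_def)
  have e4: "Sk x * s x = integral {0..x} (\<lambda>t. s t * k t * s t) + integral {0..x} (\<lambda>t. Sk t * (\<omega> * c t))"
    using ibp[OF sk ds cont(1)] by (simp add: Sk_def)
  have "s x * Ck x - c x * Sk x = integral {0..x} (\<lambda>t. Ck t * (\<omega> * c t)) - integral {0..x} (\<lambda>t. Sk t * (- \<omega> * s t))"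
    using e1 e2 by (simp add: mult_ac)
  also have "\<dots> = integral {0..x} (\<lambda>t. Ck t * (\<omega> * c t) - Sk t * (- \<omega> * s t))"
    by (rule integral_diff[symmetric]) (intro ci Cc Sc cont)+
  also have "\<dots> = integral {0..x} (\<lambda>t. \<omega> * duhamel' \<omega> k t)"
    by (simp add: D algebra_simps)
  finally show "duhamel \<omega> k x = integral {0..x} (duhamel' \<omega> k)"
    using \<omega> by (simp add: D(1))
  have "duhamel' \<omega> k x = (integral {0..x} (\<lambda>t. c t * k t * c t) + integral {0..x} (\<lambda>t. s t * k t * s t))
      + (integral {0..x} (\<lambda>t. Ck t * (- \<omega> * s t)) + integral {0..x} (\<lambda>t. Sk t * (\<omega> * c t)))"
    using e3 e4 by (simp add: D mult_ac)
  also have "\<dots> = integral {0..x} (\<lambda>t. c t * k t * c t + s t * k t * s t)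
      + integral {0..x} (\<lambda>t. Ck t * (- \<omega> * s t) + Sk t * (\<omega> * c t))"
    by (intro arg_cong2[where f="(+)"] integral_add[symmetric] ci ki Cc Sc cont sc)
  also have "\<dots> = integral {0..x} (\<lambda>t. (c t * k t * c t + s t * k t * s t) + (Ck t * (- \<omega> * s t) + Sk t * (\<omega> * c t)))"
    by (intro integral_add[symmetric] integrable_add ci ki Cc Sc cont sc)
  also have "\<dots> = integral {0..x} (\<lambda>t. k t - \<omega>\<^sup>2 * duhamel \<omega> k t)"
  proof (rule Henstock_Kurzweil_Integration.integral_cong)
    fix t
    have "(c t)\<^sup>2 + (s t)\<^sup>2 = 1" using sin_cos_squared_add2[of "\<omega> * of_real t"] by (simp add: s_def c_def power2_eq_square)
    then have "c t * k t * c t + s t * k t * s t = k t" 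
      by (metis (no_types, lifting) distrib_right mult.assoc mult.commute mult.left_neutral power2_eq_square)
    moreover have "\<omega>\<^sup>2 * duhamel \<omega> k t = \<omega> * (s t * Ck t - c t * Sk t)"
      using \<omega> by (simp add: D(1) power2_eq_square)
    ultimately show "(c t * k t * c t + s t * k t * s t) + (Ck t * (- \<omega> * s t) + Sk t * (\<omega> * c t)) = k t - \<omega>\<^sup>2 * duhamel \<omega> k t"
      by (simp add: algebra_simps)
  qed
  finally show "duhamel' \<omega> k x = integral {0..x} (\<lambda>t. k t - \<omega>\<^sup>2 * duhamel \<omega> k t)" .
qed

lemma duhamel_has_vector_derivative:
  assumes "x \<in> {0..1}"
  shows "(duhamel \<omega> k has_vector_derivative duhamel' \<omega> k x) (at x within {0..1})"
  by (rule has_vector_derivative_transform[OF assms _ integral_Icc_has_vector_derivative])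
    (use duhamel_integrals assms in auto)

end

lemma duhamel_zero [simp]: "duhamel \<omega> k 0 = 0" "duhamel' \<omega> k 0 = 0"
  by (simp_all add: duhamel_def duhamel'_def)

lemma duhamel_bound:
  assumes "\<omega> \<noteq> 0"
  obtains C where "C \<ge> 0" "\<And>k x. k absolutely_integrable_on {0..1} \<Longrightarrow> x \<in> {0..1} \<Longrightarrow>
    norm (duhamel \<omega> k x) \<le> C * integral {0..1} (\<lambda>t. norm (k t)) \<and>
    norm (duhamel' \<omega> k x) \<le> C * integral {0..1} (\<lambda>t. norm (k t))"
proof -
  have "bounded ((\<lambda>t::real. sin (\<omega> * of_real t)) ` {0..1})" "bounded ((\<lambda>t::real. cos (\<omega> * of_real t)) ` {0..1})"
    by (intro compact_imp_bounded compact_continuous_image continuous_intros compact_Icc)+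
  then obtain M1 M2 where M12: "\<And>t. t \<in> {0..1::real} \<Longrightarrow> norm (sin (\<omega> * of_real t)) \<le> M1"
     "\<And>t. t \<in> {0..1::real} \<Longrightarrow> norm (cos (\<omega> * of_real t)) \<le> M2"
    unfolding bounded_iff by fastforce
  define M where "M = max M1 M2"
  have M: "norm (sin (\<omega> * of_real t)) \<le> M" "norm (cos (\<omega> * of_real t)) \<le> M" if "t \<in> {0..1::real}" for t
    using M12[OF that] by (auto simp: M_def)
  have M0: "0 \<le> M" using M(1)[of 0] by simp
  have b: "norm (integral {0..x} (\<lambda>t. h t * k t)) \<le> M * integral {0..1} (\<lambda>t. norm (k t))"
    if k: "k absolutely_integrable_on {0..1}" and x: "x \<in> {0..1}" and h: "continuous_on {0..1} h"
      "\<And>t. t \<in> {0..1} \<Longrightarrow> norm (h t) \<le> M" for h k :: "real \<Rightarrow> complex" and x :: real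
  proof -
    have hk: "(\<lambda>t. h t * k t) absolutely_integrable_on {0..1}"
      by (rule absolutely_integrable_mult_continuous[OF k h(1)])
    have sub: "{0..x} \<subseteq> {0..1}" using x by auto
    have i: "(\<lambda>t. h t * k t) integrable_on {0..x}" "(\<lambda>t. norm (k t)) integrable_on {0..x}"
        "(\<lambda>t. norm (k t)) integrable_on {0..1}"
      using hk k integrable_on_subinterval[OF _ sub] by (auto simp: absolutely_integrable_on_def)
    have "norm (integral {0..x} (\<lambda>t. h t * k t)) \<le> integral {0..x} (\<lambda>t. M * norm (k t))"
      by (rule integral_norm_bound_integral)
        (use i h sub in \<open>auto simp: norm_mult intro!: mult_right_mono integrable_on_mult_right\<close>)
    also have "\<dots> \<le> M * integral {0..1} (\<lambda>t. norm (k t))"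
      using integral_subset_le[OF sub i(2,3)] M0 by (simp add: mult_left_mono)
    finally show ?thesis .
  qed
  \<comment> \<open>The sum covers both estimates; the one for \<open>duhamel\<close> carries the
    division by \<omega>.\<close>
  define C where "C = 2 * M * M * (1 + 1 / norm \<omega>)"
  have C0: "C \<ge> 0" using M0 by (simp add: C_def)
  show thesis
  proof (rule that[OF C0], rule conjI)
    fix k :: "real \<Rightarrow> complex" and x :: real assume k: "k absolutely_integrable_on {0..1}" and x: "x \<in> {0..1}"
    define N where "N = integral {0..1} (\<lambda>t. norm (k t))"
    have N0: "0 \<le> N" unfolding N_def by (rule Henstock_Kurzweil_Integration.integral_nonneg) (use k in \<open>auto simp: absolutely_integrable_on_def\<close>)
    define a where "a = integral {0..x} (\<lambda>t. cos (\<omega> * of_real t) * k t)"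
    define b where "b = integral {0..x} (\<lambda>t. sin (\<omega> * of_real t) * k t)"
    have ab: "norm a \<le> M * N" "norm b \<le> M * N"
      unfolding a_def b_def N_def using M by (auto intro!: b[OF k x] continuous_intros)
    have p: "norm (u * v) \<le> M * (M * N)" if "norm u \<le> M" "norm v \<le> M * N" for u v :: complex
      unfolding norm_mult using that M0 by (intro mult_mono) auto
    have "norm (sin (\<omega> * of_real x) * a - cos (\<omega> * of_real x) * b) \<le> 2 * M * M * N"
      using norm_triangle_ineq4[of "sin (\<omega> * of_real x) * a" "cos (\<omega> * of_real x) * b"]
        p[OF M(1)[OF x] ab(1)] p[OF M(2)[OF x] ab(2)] by simp
    then have "norm (duhamel \<omega> k x) \<le> 2 * M * M * N / norm \<omega>"
      unfolding duhamel_def a_def[symmetric] b_def[symmetric] norm_divide by (rule divide_right_mono) simp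
    also have "\<dots> \<le> C * N" using M0 N0 by (simp add: C_def algebra_simps)
    finally show "norm (duhamel \<omega> k x) \<le> C * integral {0..1} (\<lambda>t. norm (k t))" by (simp add: N_def)
    have "norm (duhamel' \<omega> k x) \<le> 2 * M * M * N"
      unfolding duhamel'_def a_def[symmetric] b_def[symmetric]
      using norm_triangle_ineq[of "cos (\<omega> * of_real x) * a" "sin (\<omega> * of_real x) * b"]
        p[OF M(2)[OF x] ab(1)] p[OF M(1)[OF x] ab(2)] by simp
    also have "\<dots> \<le> C * N" using M0 N0 by (simp add: C_def algebra_simps)
    finally show "norm (duhamel' \<omega> k x) \<le> C * integral {0..1} (\<lambda>t. norm (k t))" by (simp add: N_def)
  qed
qed

text \<open>The solution of y'' + \<omega>^2 y = k with y(0) = \<alpha> and y'(0) = \<beta>. The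
  next definition is its derivative.\<close>

definition osc :: "complex \<Rightarrow> (real \<Rightarrow> complex) \<Rightarrow> complex \<Rightarrow> complex \<Rightarrow> real \<Rightarrow> complex" where
  "osc \<omega> k \<alpha> \<beta> x = \<alpha> * cos (\<omega> * of_real x) + \<beta> * (sin (\<omega> * of_real x) / \<omega>) + duhamel \<omega> k x"

definition osc' :: "complex \<Rightarrow> (real \<Rightarrow> complex) \<Rightarrow> complex \<Rightarrow> complex \<Rightarrow> real \<Rightarrow> complex" where
  "osc' \<omega> k \<alpha> \<beta> x = \<alpha> * (- \<omega> * sin (\<omega> * of_real x)) + \<beta> * cos (\<omega> * of_real x) + duhamel' \<omega> k x"

lemma osc_zero [simp]: "osc \<omega> k \<alpha> \<beta> 0 = \<alpha>" "osc' \<omega> k \<alpha> \<beta> 0 = \<beta>"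
  by (simp_all add: osc_def osc'_def)

lemma osc_solves:
  assumes "\<omega> \<noteq> 0" "k absolutely_integrable_on {0..1}" "x \<in> {0..1}"
  shows "(osc \<omega> k \<alpha> \<beta> has_vector_derivative osc' \<omega> k \<alpha> \<beta> x) (at x within {0..1})"
    and "((\<lambda>t. k t - \<omega>\<^sup>2 * osc \<omega> k \<alpha> \<beta> t) has_integral (osc' \<omega> k \<alpha> \<beta> x - \<beta>)) {0..x}"
    and "continuous_on {0..1} (osc \<omega> k \<alpha> \<beta>)"
proof -
  have "((\<lambda>x. \<alpha> * cos (\<omega> * of_real x) + \<beta> / \<omega> * sin (\<omega> * of_real x) + duhamel \<omega> k x) has_vector_derivative
      \<alpha> * (- \<omega> * sin (\<omega> * of_real x)) + \<beta> / \<omega> * (\<omega> * cos (\<omega> * of_real x)) + duhamel' \<omega> k x) (at x within {0..1})"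
    by (intro has_vector_derivative_add has_vector_derivative_mult_right sin_cos_has_vector_derivative
        duhamel_has_vector_derivative assms)
  then show "(osc \<omega> k \<alpha> \<beta> has_vector_derivative osc' \<omega> k \<alpha> \<beta> x) (at x within {0..1})"
    using assms(1) unfolding osc_def[abs_def] osc'_def by simp
  show "continuous_on {0..1} (osc \<omega> k \<alpha> \<beta>)"
    unfolding osc_def[abs_def] using assms by (intro continuous_intros duhamel_integrals) auto
  define q where "q x = \<alpha> * (- \<omega> * sin (\<omega> * of_real x)) + \<beta> * cos (\<omega> * of_real x)" for x :: real
  have "(q has_vector_derivative \<alpha> * (- \<omega> * (\<omega> * cos (\<omega> * of_real t))) + \<beta> * (- \<omega> * sin (\<omega> * of_real t))) (at t within {0..x})" for t
    unfolding q_def[abs_def]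
    by (intro has_vector_derivative_add has_vector_derivative_mult_right sin_cos_has_vector_derivative)
  then have "((\<lambda>t. \<alpha> * (- \<omega> * (\<omega> * cos (\<omega> * of_real t))) + \<beta> * (- \<omega> * sin (\<omega> * of_real t))) has_integral (q x - q 0)) {0..x}"
    by (intro fundamental_theorem_of_calculus) (use assms in auto)
  moreover have "((\<lambda>t. k t - \<omega>\<^sup>2 * duhamel \<omega> k t) has_integral duhamel' \<omega> k x) {0..x}"
  proof -
    have "(\<lambda>t. k t - \<omega>\<^sup>2 * duhamel \<omega> k t) integrable_on {0..1}"
    proof (rule integrable_diff)
      show "k integrable_on {0..1}" using assms(2) by (simp add: absolutely_integrable_on_def)
      show "(\<lambda>t. \<omega>\<^sup>2 * duhamel \<omega> k t) integrable_on {0..1}"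
        using duhamel_integrals(3)[OF assms] by (intro integrable_continuous_real continuous_intros)
    qed
    then have "(\<lambda>t. k t - \<omega>\<^sup>2 * duhamel \<omega> k t) integrable_on {0..x}"
      by (rule integrable_on_subinterval) (use assms in auto)
    then show ?thesis using duhamel_integrals(2)[OF assms] by (simp add: has_integral_integrable_integral)
  qed
  ultimately have "((\<lambda>t. (\<alpha> * (- \<omega> * (\<omega> * cos (\<omega> * of_real t))) + \<beta> * (- \<omega> * sin (\<omega> * of_real t)))
      + (k t - \<omega>\<^sup>2 * duhamel \<omega> k t)) has_integral (q x - q 0 + duhamel' \<omega> k x)) {0..x}"
    by (rule has_integral_add)
  moreover have "(\<alpha> * (- \<omega> * (\<omega> * cos (\<omega> * of_real t))) + \<beta> * (- \<omega> * sin (\<omega> * of_real t)))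
      + (k t - \<omega>\<^sup>2 * duhamel \<omega> k t) = k t - \<omega>\<^sup>2 * osc \<omega> k \<alpha> \<beta> t" for t
    using assms(1) by (simp add: osc_def power2_eq_square field_simps)
  moreover have "q x - q 0 + duhamel' \<omega> k x = osc' \<omega> k \<alpha> \<beta> x - \<beta>"
    by (simp add: q_def osc'_def)
  ultimately show "((\<lambda>t. k t - \<omega>\<^sup>2 * osc \<omega> k \<alpha> \<beta> t) has_integral (osc' \<omega> k \<alpha> \<beta> x - \<beta>)) {0..x}" by (simp only:)
qed

lemma osc_bound:
  assumes "\<omega> \<noteq> 0"
  obtains C where "C \<ge> 0" "\<And>k \<alpha> \<beta> x. k absolutely_integrable_on {0..1} \<Longrightarrow> x \<in> {0..1} \<Longrightarrow>
    norm (osc \<omega> k \<alpha> \<beta> x) \<le> C * (norm \<alpha> + norm \<beta> + integral {0..1} (\<lambda>t. norm (k t)))"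
proof -
  obtain C where C: "C \<ge> 0" "\<And>k x. k absolutely_integrable_on {0..1} \<Longrightarrow> x \<in> {0..1} \<Longrightarrow>
    norm (duhamel \<omega> k x) \<le> C * integral {0..1} (\<lambda>t. norm (k t))"
    using duhamel_bound[OF assms] by metis
  have "bounded ((\<lambda>t::real. sin (\<omega> * of_real t) / \<omega>) ` {0..1})" "bounded ((\<lambda>t::real. cos (\<omega> * of_real t)) ` {0..1})"
    using assms by (intro compact_imp_bounded compact_continuous_image continuous_intros compact_Icc; simp)+
  then obtain M1 M2 where M: "\<And>t. t \<in> {0..1::real} \<Longrightarrow> norm (sin (\<omega> * of_real t) / \<omega>) \<le> M1"
     "\<And>t. t \<in> {0..1::real} \<Longrightarrow> norm (cos (\<omega> * of_real t)) \<le> M2"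
    unfolding bounded_iff by (metis imageI)
  have M0: "0 \<le> M1" "0 \<le> M2" using order_trans[OF norm_ge_zero M(1)[of 0]] order_trans[OF norm_ge_zero M(2)[of 0]] by auto
  show thesis
  proof (rule that[of "M1 + M2 + C"])
    fix k :: "real \<Rightarrow> complex" and \<alpha> \<beta> and x :: real assume k: "k absolutely_integrable_on {0..1}" and x: "x \<in> {0..1}"
    define N where "N = integral {0..1} (\<lambda>t. norm (k t))"
    have N0: "0 \<le> N" unfolding N_def by (rule Henstock_Kurzweil_Integration.integral_nonneg) (use k in \<open>auto simp: absolutely_integrable_on_def\<close>)
    have "norm (osc \<omega> k \<alpha> \<beta> x) \<le> norm (\<alpha> * cos (\<omega> * of_real x)) + norm (\<beta> * (sin (\<omega> * of_real x) / \<omega>)) + norm (duhamel \<omega> k x)"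
      unfolding osc_def by (intro order_trans[OF norm_triangle_ineq] add_mono norm_triangle_ineq order_refl)
    also have "\<dots> \<le> norm \<alpha> * M2 + norm \<beta> * M1 + C * N"
      unfolding norm_mult[of \<alpha>] norm_mult[of \<beta>] N_def
      by (intro add_mono mult_left_mono M C x k norm_ge_zero)
    also have "\<dots> \<le> (M1 + M2 + C) * (norm \<alpha> + norm \<beta> + N)"
      using M0 C(1) N0 by (simp add: algebra_simps)
    finally show "norm (osc \<omega> k \<alpha> \<beta> x) \<le> (M1 + M2 + C) * (norm \<alpha> + norm \<beta> + integral {0..1} (\<lambda>t. norm (k t)))"
      by (simp add: N_def)
  qed (use M0 C in auto)
qed

section \<open>Boundary values by shooting\<close>

lemma complex_vec2_eq_iff: "v = w \<longleftrightarrow> v $ 1 = w $ 1 \<and> v $ 2 = w $ 2" for v w :: "'a ^ 2"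
  by (simp add: vec_eq_iff forall_2)

lemma norm_vec2_le: "norm (v :: complex ^ 2) \<le> norm (v $ 1) + norm (v $ 2)"
  using L2_set_le_sum[of UNIV "\<lambda>i. norm (v $ i)"] by (simp add: norm_vec_def sum_2)

lemma bounded_linear_vec2_functional: "bounded_linear (\<lambda>v :: complex ^ 2. p * v $ 1 + q * v $ 2)"
  by (rule linear_conv_bounded_linear[THEN iffD1]) (auto intro!: linearI simp: algebra_simps)

lemma bounded_linear_cscale_left: "bounded_linear (\<lambda>c :: complex. c *s (v :: complex ^ 2))"
  by (rule linear_conv_bounded_linear[THEN iffD1]) (auto intro!: linearI simp: complex_vec2_eq_iff algebra_simps)

text \<open>\<open>s1\<close> and \<open>s2\<close> are the slopes of eigenvectors normalised to
  first component 1, so distinct slopes mean an eigenbasis. Non-zero eigenvalues and non-zero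
  \<open>z\<close> give non-zero frequencies, by which the solution formulas divide.\<close>

locale shooting =
  fixes A :: "complex ^ 2 ^ 2" and z s1 s2 \<mu>1 \<mu>2 :: complex
  assumes s: "s1 \<noteq> s2" and \<mu>: "\<mu>1 \<noteq> 0" "\<mu>2 \<noteq> 0" and z: "z \<noteq> 0"
    and ev: "A *v vector [1, s1] = \<mu>1 *s vector [1, s1]" "A *v vector [1, s2] = \<mu>2 *s vector [1, s2]"
begin

definition "\<omega>1 = csqrt (z / \<mu>1)"
definition "\<omega>2 = csqrt (z / \<mu>2)"

lemma \<omega>: "\<omega>1 \<noteq> 0" "\<omega>2 \<noteq> 0" "\<omega>1\<^sup>2 = z / \<mu>1" "\<omega>2\<^sup>2 = z / \<mu>2"
  using \<mu> z by (auto simp: \<omega>1_def \<omega>2_def)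

text \<open>The coordinates of - A^{-1} v in the eigenbasis. With them each component of the
  equation - A f'' - z f = g reads h'' + \<omega>^2 h = coord g, where \<omega>^2 = z /
  \<mu>.\<close>

definition "coord1 v = s2 / ((s1 - s2) * \<mu>1) * v $ 1 + - 1 / ((s1 - s2) * \<mu>1) * v $ 2" for v :: "complex ^ 2"
definition "coord2 v = - s1 / ((s1 - s2) * \<mu>2) * v $ 1 + 1 / ((s1 - s2) * \<mu>2) * v $ 2" for v :: "complex ^ 2"

lemma bounded_linear_l: "bounded_linear coord1" "bounded_linear coord2"
  unfolding coord1_def[abs_def] coord2_def[abs_def] by (rule bounded_linear_vec2_functional)+

lemma expansion: "- (\<mu>1 * coord1 v) *s vector [1, s1] + - (\<mu>2 * coord2 v) *s vector [1, s2] = v"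
  using s \<mu> by (simp add: complex_vec2_eq_iff coord1_def coord2_def divide_simps) (simp add: algebra_simps)

definition "h1 g \<alpha> \<beta> = osc \<omega>1 (\<lambda>x. coord1 (rep_l2 g x)) \<alpha> (s2 * \<beta>)"
definition "h2 g \<alpha> \<beta> = osc \<omega>2 (\<lambda>x. coord2 (rep_l2 g x)) (- \<alpha>) (- s1 * \<beta>)"
definition "h1' g \<alpha> \<beta> = osc' \<omega>1 (\<lambda>x. coord1 (rep_l2 g x)) \<alpha> (s2 * \<beta>)"
definition "h2' g \<alpha> \<beta> = osc' \<omega>2 (\<lambda>x. coord2 (rep_l2 g x)) (- \<alpha>) (- s1 * \<beta>)"

text \<open>
  The initial values in \<open>h1\<close> and \<open>h2\<close> are chosen such that, for all \<open>\<alpha>\<close> and \<open>\<beta>\<close>, the boundary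
  conditions at \<open>0\<close> hold.
\<close>

definition "sol g \<alpha> \<beta> x = h1 g \<alpha> \<beta> x *s vector [1, s1] + h2 g \<alpha> \<beta> x *s (vector [1, s2] :: complex ^ 2)"
definition "sol' g \<alpha> \<beta> x = h1' g \<alpha> \<beta> x *s vector [1, s1] + h2' g \<alpha> \<beta> x *s (vector [1, s2] :: complex ^ 2)"
definition "sol'' g \<alpha> \<beta> x = (coord1 (rep_l2 g x) - \<omega>1\<^sup>2 * h1 g \<alpha> \<beta> x) *s vector [1, s1]
    + (coord2 (rep_l2 g x) - \<omega>2\<^sup>2 * h2 g \<alpha> \<beta> x) *s (vector [1, s2] :: complex ^ 2)"

lemma k_absolutely_integrable:
  "(\<lambda>x. coord1 (rep_l2 g x)) absolutely_integrable_on {0..1}" "(\<lambda>x. coord2 (rep_l2 g x)) absolutely_integrable_on {0..1}"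
  using absolutely_integrable_linear[OF rep_l2_absolutely_integrable bounded_linear_l(1)]
    absolutely_integrable_linear[OF rep_l2_absolutely_integrable bounded_linear_l(2)]
  by (simp_all add: o_def)

lemma sol_has_vector_derivative:
  assumes "x \<in> {0..1}"
  shows "(sol g \<alpha> \<beta> has_vector_derivative sol' g \<alpha> \<beta> x) (at x within {0..1})"
  unfolding sol_def[abs_def] sol'_def h1_def h2_def h1'_def h2'_def
  by (intro has_vector_derivative_add bounded_linear.has_vector_derivative[OF bounded_linear_cscale_left]
      osc_solves \<omega> k_absolutely_integrable assms)

lemma sol'_integral:
  assumes "x \<in> {0..1}"
  shows "sol' g \<alpha> \<beta> x = sol' g \<alpha> \<beta> 0 + integral {0..x} (sol'' g \<alpha> \<beta>)"
proof -
  have "((\<lambda>t. (coord1 (rep_l2 g t) - \<omega>1\<^sup>2 * h1 g \<alpha> \<beta> t) *s vector [1, s1]) has_integral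
      (h1' g \<alpha> \<beta> x - s2 * \<beta>) *s (vector [1, s1] :: complex ^ 2)) {0..x}"
    using has_integral_linear[OF osc_solves(2)[OF \<omega>(1) k_absolutely_integrable(1) assms] bounded_linear_cscale_left]
    unfolding h1_def h1'_def o_def .
  moreover have "((\<lambda>t. (coord2 (rep_l2 g t) - \<omega>2\<^sup>2 * h2 g \<alpha> \<beta> t) *s vector [1, s2]) has_integral
      (h2' g \<alpha> \<beta> x - (- s1 * \<beta>)) *s (vector [1, s2] :: complex ^ 2)) {0..x}"
    using has_integral_linear[OF osc_solves(2)[OF \<omega>(2) k_absolutely_integrable(2) assms] bounded_linear_cscale_left]
    unfolding h2_def h2'_def o_def .
  ultimately have "(sol'' g \<alpha> \<beta> has_integral (h1' g \<alpha> \<beta> x - s2 * \<beta>) *s vector [1, s1]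
      + (h2' g \<alpha> \<beta> x - (- s1 * \<beta>)) *s (vector [1, s2] :: complex ^ 2)) {0..x}"
    unfolding sol''_def[abs_def] by (rule has_integral_add)
  moreover have "(h1' g \<alpha> \<beta> x - s2 * \<beta>) *s vector [1, s1]
      + (h2' g \<alpha> \<beta> x - (- s1 * \<beta>)) *s (vector [1, s2] :: complex ^ 2) = sol' g \<alpha> \<beta> x - sol' g \<alpha> \<beta> 0"
    by (simp add: sol'_def h1'_def h2'_def complex_vec2_eq_iff algebra_simps)
  ultimately show ?thesis by (simp add: integral_unique)
qed

lemma square_integrable_sol'': "square_integrable (sol'' g \<alpha> \<beta>)"
proof -
  have T: "bounded_linear (\<lambda>v. coord1 v *s vector [1, s1] + coord2 v *s (vector [1, s2] :: complex ^ 2))"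
    by (intro bounded_linear_add bounded_linear_compose[OF bounded_linear_cscale_left] bounded_linear_l)
  have "continuous_on {0..1} (h1 g \<alpha> \<beta>)" "continuous_on {0..1} (h2 g \<alpha> \<beta>)"
    unfolding h1_def h2_def by (rule osc_solves(3)[of _ _ 0] \<omega> k_absolutely_integrable | simp)+
  then have "continuous_on {0..1} (\<lambda>x. (- \<omega>1\<^sup>2 * h1 g \<alpha> \<beta> x) *s vector [1, s1]
      + (- \<omega>2\<^sup>2 * h2 g \<alpha> \<beta> x) *s (vector [1, s2] :: complex ^ 2))"
    by (intro continuous_on_add bounded_linear.continuous_on[OF bounded_linear_cscale_left] continuous_intros)
  from square_integrable_add[OF square_integrable_linear[OF square_integrable_rep_l2[of g] T] square_integrable_continuous[OF this]]
  show ?thesis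
    unfolding sol''_def[abs_def] by (rule back_subst[of square_integrable])
      (simp add: fun_eq_iff complex_vec2_eq_iff algebra_simps)
qed

lemma sol_continuous: "continuous_on {0..1} (sol g \<alpha> \<beta>)"
  by (rule continuous_on_vector_derivative) (use sol_has_vector_derivative in auto)

lemma strong_deriv2_sol: "strong_deriv2 (abs_l2 (sol g \<alpha> \<beta>)) (abs_l2 (sol'' g \<alpha> \<beta>)) (sol g \<alpha> \<beta>) (sol' g \<alpha> \<beta>)"
  by (rule strong_deriv2_abs[OF sol_has_vector_derivative square_integrable_sol'' sol'_integral])

lemma sol_equation: "- mat_app A (abs_l2 (sol'' g \<alpha> \<beta>)) - z *\<^sub>C abs_l2 (sol g \<alpha> \<beta>) = g"
proof (rule l2_eqI)
  have pw: "- (A *v sol'' g \<alpha> \<beta> x) - z *s sol g \<alpha> \<beta> x = rep_l2 g x" for x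
  proof -
    have A: "A *v sol'' g \<alpha> \<beta> x = ((coord1 (rep_l2 g x) - \<omega>1\<^sup>2 * h1 g \<alpha> \<beta> x) * \<mu>1) *s vector [1, s1]
      + ((coord2 (rep_l2 g x) - \<omega>2\<^sup>2 * h2 g \<alpha> \<beta> x) * \<mu>2) *s vector [1, s2]"
      unfolding sol''_def matrix_vector_right_distrib vector_scalar_commute ev by (simp only: vector_smult_assoc)
    have e: "(coord1 (rep_l2 g x) - \<omega>1\<^sup>2 * h1 g \<alpha> \<beta> x) * \<mu>1 = \<mu>1 * coord1 (rep_l2 g x) - z * h1 g \<alpha> \<beta> x"
      "(coord2 (rep_l2 g x) - \<omega>2\<^sup>2 * h2 g \<alpha> \<beta> x) * \<mu>2 = \<mu>2 * coord2 (rep_l2 g x) - z * h2 g \<alpha> \<beta> x"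
      unfolding \<omega>(3,4) left_diff_distrib using \<mu> by simp_all
    have "- (A *v sol'' g \<alpha> \<beta> x) - z *s sol g \<alpha> \<beta> x =
      - (\<mu>1 * coord1 (rep_l2 g x)) *s vector [1, s1] + - (\<mu>2 * coord2 (rep_l2 g x)) *s vector [1, s2]"
      unfolding A e by (simp add: complex_vec2_eq_iff sol_def algebra_simps)
    then show ?thesis by (simp only: expansion)
  qed
  show "AE x in I01. rep_l2 (- mat_app A (abs_l2 (sol'' g \<alpha> \<beta>)) - z *\<^sub>C abs_l2 (sol g \<alpha> \<beta>)) x = rep_l2 g x"
    using rep_minus[of "- mat_app A (abs_l2 (sol'' g \<alpha> \<beta>))" "z *\<^sub>C abs_l2 (sol g \<alpha> \<beta>)"]
      rep_uminus[of "mat_app A (abs_l2 (sol'' g \<alpha> \<beta>))"] rep_mat_app[of A "abs_l2 (sol'' g \<alpha> \<beta>)"]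
      rep_scaleC[of z "abs_l2 (sol g \<alpha> \<beta>)"] rep_abs_l2[OF square_integrable_sol'', of g \<alpha> \<beta>]
      rep_abs_l2[OF square_integrable_continuous[OF sol_continuous], of g \<alpha> \<beta>]
    by eventually_elim (simp add: pw)
qed

text \<open>At x = 1 the boundary values are affine in the parameters: \<open>P\<close> and
  \<open>Q\<close> are the contributions of the right-hand side to the first component of the value
  and the second component of the derivative, and \<open>m11\<close> to \<open>m22\<close> are the
  coefficients of \<alpha> and \<beta>.\<close>

definition "P g = duhamel \<omega>1 (\<lambda>x. coord1 (rep_l2 g x)) 1 + duhamel \<omega>2 (\<lambda>x. coord2 (rep_l2 g x)) 1"
definition "Q g = s1 * duhamel' \<omega>1 (\<lambda>x. coord1 (rep_l2 g x)) 1 + s2 * duhamel' \<omega>2 (\<lambda>x. coord2 (rep_l2 g x)) 1"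
definition "m11 = cos \<omega>1 - cos \<omega>2"
definition "m12 = s2 * (sin \<omega>1 / \<omega>1) - s1 * (sin \<omega>2 / \<omega>2)"
definition "m21 = s2 * \<omega>2 * sin \<omega>2 - s1 * \<omega>1 * sin \<omega>1"
definition "m22 = s1 * s2 * (cos \<omega>1 - cos \<omega>2)"

lemma sol_boundary:
  "sol g \<alpha> \<beta> 0 $ 1 = 0" "sol' g \<alpha> \<beta> 0 $ 2 = 0"
  "sol g \<alpha> \<beta> 0 $ 2 = \<alpha> * (s1 - s2)" "sol' g \<alpha> \<beta> 0 $ 1 = \<beta> * (s2 - s1)"
  "sol g \<alpha> \<beta> 1 $ 1 = \<alpha> * m11 + \<beta> * m12 + P g"
  "sol' g \<alpha> \<beta> 1 $ 2 = \<alpha> * m21 + \<beta> * m22 + Q g"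
  by (simp_all add: sol_def sol'_def h1_def h2_def h1'_def h2'_def)
    (simp_all add: osc_def osc'_def m11_def m12_def m21_def m22_def P_def Q_def algebra_simps)

lemma l_integral_bound:
  obtains c where "c \<ge> 0" "\<And>g. integral {0..1} (\<lambda>x. norm (coord1 (rep_l2 g x))) \<le> c * norm g"
    "\<And>g. integral {0..1} (\<lambda>x. norm (coord2 (rep_l2 g x))) \<le> c * norm g"
proof -
  obtain c1 where c1: "c1 \<ge> 0" "\<And>v. norm (coord1 v) \<le> norm v * c1"
    using bounded_linear.nonneg_bounded[OF bounded_linear_l(1)] by blast
  obtain c2 where c2: "c2 \<ge> 0" "\<And>v. norm (coord2 v) \<le> norm v * c2"
    using bounded_linear.nonneg_bounded[OF bounded_linear_l(2)] by blast
  have gen: "integral {0..1} (\<lambda>x. norm (l (rep_l2 g x))) \<le> (c1 + c2) * norm g"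
    if "bounded_linear l" "c \<le> c1 + c2" "\<And>v. norm (l v) \<le> norm v * c" for l :: "complex ^ 2 \<Rightarrow> complex" and c g
  proof -
    have g: "(\<lambda>x. norm (rep_l2 g x)) integrable_on {0..1}"
      using rep_l2_absolutely_integrable by (auto simp: absolutely_integrable_on_def)
    have "integral {0..1} (\<lambda>x. norm (l (rep_l2 g x))) \<le> integral {0..1} (\<lambda>x. (c1 + c2) * norm (rep_l2 g x))"
    proof (rule integral_le)
      show "(\<lambda>x. norm (l (rep_l2 g x))) integrable_on {0..1}"
        using absolutely_integrable_linear[OF rep_l2_absolutely_integrable that(1)]
        by (simp add: absolutely_integrable_on_def o_def)
      show "norm (l (rep_l2 g x)) \<le> (c1 + c2) * norm (rep_l2 g x)" for x
        using order_trans[OF that(3)[of "rep_l2 g x"] mult_left_mono[OF that(2) norm_ge_zero]] by (simp add: mult.commute)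
    qed (use g in \<open>auto intro: integrable_on_mult_right\<close>)
    also have "\<dots> \<le> (c1 + c2) * norm g"
      using integral_norm_rep_l2_le[of g] c1(1) c2(1) by (simp add: mult_left_mono)
    finally show ?thesis .
  qed
  show thesis
    by (rule that[of "c1 + c2"]) (use c1 c2 gen[OF bounded_linear_l(1) _ c1(2)] gen[OF bounded_linear_l(2) _ c2(2)] in auto)
qed

lemma PQ_bound:
  obtains C where "C \<ge> 0" "\<And>g :: l2. norm (P g) \<le> C * norm g" "\<And>g. norm (Q g) \<le> C * norm g"
proof -
  obtain c where c: "c \<ge> 0" "\<And>g. integral {0..1} (\<lambda>x. norm (coord1 (rep_l2 g x))) \<le> c * norm g"
    "\<And>g. integral {0..1} (\<lambda>x. norm (coord2 (rep_l2 g x))) \<le> c * norm g"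
    using l_integral_bound by blast
  obtain C1 where C1: "C1 \<ge> 0" "\<And>k x. k absolutely_integrable_on {0..1} \<Longrightarrow> x \<in> {0..1} \<Longrightarrow>
    norm (duhamel \<omega>1 k x) \<le> C1 * integral {0..1} (\<lambda>t. norm (k t)) \<and>
    norm (duhamel' \<omega>1 k x) \<le> C1 * integral {0..1} (\<lambda>t. norm (k t))"
    using duhamel_bound[OF \<omega>(1)] by metis
  obtain C2 where C2: "C2 \<ge> 0" "\<And>k x. k absolutely_integrable_on {0..1} \<Longrightarrow> x \<in> {0..1} \<Longrightarrow>
    norm (duhamel \<omega>2 k x) \<le> C2 * integral {0..1} (\<lambda>t. norm (k t)) \<and>
    norm (duhamel' \<omega>2 k x) \<le> C2 * integral {0..1} (\<lambda>t. norm (k t))"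
    using duhamel_bound[OF \<omega>(2)] by metis
  have d1: "norm (duhamel \<omega>1 (\<lambda>x. coord1 (rep_l2 g x)) 1) \<le> C1 * (c * norm g)"
    "norm (duhamel' \<omega>1 (\<lambda>x. coord1 (rep_l2 g x)) 1) \<le> C1 * (c * norm g)" for g
    using C1(2)[OF k_absolutely_integrable(1), of 1 g] mult_left_mono[OF c(2) C1(1), of g] by auto
  have d2: "norm (duhamel \<omega>2 (\<lambda>x. coord2 (rep_l2 g x)) 1) \<le> C2 * (c * norm g)"
    "norm (duhamel' \<omega>2 (\<lambda>x. coord2 (rep_l2 g x)) 1) \<le> C2 * (c * norm g)" for g
    using C2(2)[OF k_absolutely_integrable(2), of 1 g] mult_left_mono[OF c(3) C2(1), of g] by auto
  define C where "C = (1 + norm s1) * (C1 * c) + (1 + norm s2) * (C2 * c)"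
  show thesis
  proof (rule that)
    show "0 \<le> C" using c(1) C1(1) C2(1) by (simp add: C_def)
    fix g :: l2
    have n: "0 \<le> C1 * (c * norm g)" "0 \<le> C2 * (c * norm g)" using c(1) C1(1) C2(1) by auto
    have "norm (P g) \<le> C1 * (c * norm g) + C2 * (c * norm g)"
      unfolding P_def by (rule order_trans[OF norm_triangle_ineq add_mono[OF d1(1) d2(1)]])
    also have "\<dots> \<le> C * norm g"
      using mult_nonneg_nonneg[OF norm_ge_zero n(1), of s1] mult_nonneg_nonneg[OF norm_ge_zero n(2), of s2]
      by (simp add: C_def algebra_simps)
    finally show "norm (P g) \<le> C * norm g" .
    have "norm (Q g) \<le> norm s1 * (C1 * (c * norm g)) + norm s2 * (C2 * (c * norm g))"
      unfolding Q_def
      by (rule order_trans[OF norm_triangle_ineq])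
        (auto simp: norm_mult intro!: add_mono mult_left_mono d1 d2)
    also have "\<dots> \<le> C * norm g" using n by (simp add: C_def algebra_simps)
    finally show "norm (Q g) \<le> C * norm g" .
  qed
qed

lemma sol_bound:
  obtains C where "C \<ge> 0" "\<And>(g :: l2) \<alpha> \<beta>. norm (abs_l2 (sol g \<alpha> \<beta>)) \<le> C * (norm \<alpha> + norm \<beta> + norm g)"
proof -
  obtain c where c: "c \<ge> 0" "\<And>g. integral {0..1} (\<lambda>x. norm (coord1 (rep_l2 g x))) \<le> c * norm g"
    "\<And>g. integral {0..1} (\<lambda>x. norm (coord2 (rep_l2 g x))) \<le> c * norm g"
    using l_integral_bound by blast
  obtain C1 where C1: "C1 \<ge> 0" "\<And>k \<alpha> \<beta> x. k absolutely_integrable_on {0..1} \<Longrightarrow> x \<in> {0..1} \<Longrightarrow>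
    norm (osc \<omega>1 k \<alpha> \<beta> x) \<le> C1 * (norm \<alpha> + norm \<beta> + integral {0..1} (\<lambda>t. norm (k t)))"
    using osc_bound[OF \<omega>(1)] by metis
  obtain C2 where C2: "C2 \<ge> 0" "\<And>k \<alpha> \<beta> x. k absolutely_integrable_on {0..1} \<Longrightarrow> x \<in> {0..1} \<Longrightarrow>
    norm (osc \<omega>2 k \<alpha> \<beta> x) \<le> C2 * (norm \<alpha> + norm \<beta> + integral {0..1} (\<lambda>t. norm (k t)))"
    using osc_bound[OF \<omega>(2)] by metis
  define v1 where "v1 = norm (vector [1, s1] :: complex ^ 2)"
  define v2 where "v2 = norm (vector [1, s2] :: complex ^ 2)"
  \<comment> \<open>The summand 1 accounts for \<alpha>, the slopes for the factor of \<beta> in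
    either initial derivative, and \<open>c\<close> for the norm of \<open>g\<close>.\<close>
  define B where "B = 1 + norm s1 + norm s2 + c"
  have nsm: "norm (a *s v) \<le> 2 * (norm a * norm v)" for a and v :: "complex ^ 2"
  proof -
    have "norm (a *s v) \<le> norm a * norm (v $ 1) + norm a * norm (v $ 2)"
      using norm_vec2_le[of "a *s v"] by (simp add: norm_mult)
    also have "\<dots> \<le> norm a * norm v + norm a * norm v"
      by (intro add_mono mult_left_mono Finite_Cartesian_Product.norm_nth_le) auto
    finally show ?thesis by simp
  qed
  define C where "C = 2 * (C1 * B * v1) + 2 * (C2 * B * v2)"
  have C0: "C \<ge> 0" using C1(1) C2(1) c(1) by (simp add: C_def B_def v1_def v2_def)
  show thesis
  proof (rule that[OF C0])
    fix g :: l2 and \<alpha> \<beta> :: complex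
    define N where "N = norm \<alpha> + norm \<beta> + norm g"
    have N: "0 \<le> norm \<alpha>" "0 \<le> norm \<beta>" "0 \<le> norm g" by auto
    have e: "norm \<alpha> + norm s * norm \<beta> + I \<le> B * N"
      if "norm s \<le> norm s1 + norm s2" "I \<le> c * norm g" for s :: complex and I
    proof -
      have "norm s * norm \<beta> \<le> (norm s1 + norm s2) * N"
        using N by (intro mult_mono that(1)) (auto simp: N_def)
      moreover have "c * norm g \<le> c * N" using N c(1) by (intro mult_left_mono) (auto simp: N_def)
      moreover have "norm \<alpha> \<le> N" using N by (simp add: N_def)
      moreover have "B * N = N + (norm s1 + norm s2) * N + c * N" by (simp add: B_def algebra_simps)
      ultimately show ?thesis using that(2) by linarith
    qed
    have b: "norm (sol g \<alpha> \<beta> x) \<le> C * N" if x: "x \<in> {0..1}" for x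
    proof -
      have "norm (h1 g \<alpha> \<beta> x) \<le> C1 * (norm \<alpha> + norm (s2 * \<beta>) + integral {0..1} (\<lambda>t. norm (coord1 (rep_l2 g t))))"
        unfolding h1_def by (rule C1(2)[OF k_absolutely_integrable(1) x])
      also have "\<dots> \<le> C1 * (B * N)" unfolding norm_mult by (rule mult_left_mono[OF e[OF _ c(2)] C1(1)]) simp
      finally have a1: "norm (h1 g \<alpha> \<beta> x) \<le> C1 * (B * N)" .
      have "norm (h2 g \<alpha> \<beta> x) \<le> C2 * (norm (- \<alpha>) + norm (- s1 * \<beta>) + integral {0..1} (\<lambda>t. norm (coord2 (rep_l2 g t))))"
        unfolding h2_def by (rule C2(2)[OF k_absolutely_integrable(2) x])
      also have "\<dots> \<le> C2 * (B * N)" unfolding norm_mult norm_minus_cancel by (rule mult_left_mono[OF e[OF _ c(3)] C2(1)]) simp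
      finally have a2: "norm (h2 g \<alpha> \<beta> x) \<le> C2 * (B * N)" .
      have "norm (sol g \<alpha> \<beta> x) \<le> 2 * (norm (h1 g \<alpha> \<beta> x) * v1) + 2 * (norm (h2 g \<alpha> \<beta> x) * v2)"
        unfolding sol_def v1_def v2_def by (intro order_trans[OF norm_triangle_ineq] add_mono nsm)
      also have "\<dots> \<le> 2 * (C1 * (B * N) * v1) + 2 * (C2 * (B * N) * v2)"
        by (intro add_mono mult_left_mono mult_right_mono a1 a2) (auto simp: v1_def v2_def)
      also have "\<dots> = C * N" by (simp add: C_def algebra_simps)
      finally show ?thesis .
    qed
    show "norm (abs_l2 (sol g \<alpha> \<beta>)) \<le> C * (norm \<alpha> + norm \<beta> + norm g)"
      unfolding N_def[symmetric]
    proof (rule norm_l2_le)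
      have "AE x in I01. x \<in> {0<..<1}" by (rule AE_I2) simp
      with rep_abs_l2[OF square_integrable_continuous[OF sol_continuous], of g \<alpha> \<beta>]
      show "AE x in I01. norm (rep_l2 (abs_l2 (sol g \<alpha> \<beta>)) x) \<le> C * N"
        by eventually_elim (simp add: b)
      show "0 \<le> C * N" using C0 by (simp add: N_def)
    qed
  qed
qed

end

section \<open>The resolvent\<close>

lemma scaleC_add_right: "c *\<^sub>C (f + g) = c *\<^sub>C f + c *\<^sub>C g"
  by (rule l2_eqI) (use rep_scaleC[of c "f + g"] rep_plus[of f g] rep_plus[of "c *\<^sub>C f" "c *\<^sub>C g"]
    rep_scaleC[of c f] rep_scaleC[of c g] in eventually_elim, simp add: vector_add_ldistrib)

lemma scaleC_scaleC [simp]: "c *\<^sub>C d *\<^sub>C f = (c * d) *\<^sub>C f"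
  by (rule l2_eqI) (use rep_scaleC[of c "d *\<^sub>C f"] rep_scaleC[of d f] rep_scaleC[of "c * d" f]
    in eventually_elim, simp add: vector_smult_assoc)

lemma scaleC_of_real: "of_real r *\<^sub>C f = r *\<^sub>R f"
  by (rule l2_eqI) (use rep_scaleC[of "of_real r" f] rep_scaleR[of r f]
    in eventually_elim, simp add: complex_vec2_eq_iff scaleR_conv_of_real[where 'a=complex])

lemma scaleC_one [simp]: "1 *\<^sub>C f = f"
  using scaleC_of_real[of 1] by simp

lemma scaleC_minus_one [simp]: "(- 1) *\<^sub>C f = - f"
  using scaleC_of_real[of "-1"] by simp

lemma scaleC_zero_right [simp]: "c *\<^sub>C 0 = 0"
  using scaleC_add_right[of c 0 0] by simp

lemma scaleC_minus_right [simp]: "c *\<^sub>C (- f) = - (c *\<^sub>C f)"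
  using scaleC_add_right[of c f "- f"] by (simp add: eq_neg_iff_add_eq_0 add.commute)

lemma scaleC_minus_left [simp]: "(- c) *\<^sub>C f = - (c *\<^sub>C f)"
  using scaleC_scaleC[of "-1" c f] by (metis mult_minus1 scaleC_minus_one)

lemma scaleC_diff_right: "c *\<^sub>C (f - g) = c *\<^sub>C f - c *\<^sub>C g"
  using scaleC_add_right[of c f "- g"] by simp

lemma mat_app_add: "mat_app A (f + g) = mat_app A f + mat_app A g"
  by (rule l2_eqI) (use rep_mat_app[of A "f + g"] rep_plus[of f g] rep_plus[of "mat_app A f" "mat_app A g"]
    rep_mat_app[of A f] rep_mat_app[of A g] in eventually_elim, simp add: matrix_vector_right_distrib)

lemma mat_app_scaleC: "mat_app A (c *\<^sub>C f) = c *\<^sub>C mat_app A f"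
  by (rule l2_eqI) (use rep_mat_app[of A "c *\<^sub>C f"] rep_mat_app[of A f] rep_scaleC[of c f]
    rep_scaleC[of c "mat_app A f"] in eventually_elim, simp add: vector_scalar_commute)

lemma mat_app_mat_app [simp]: "mat_app A (mat_app B f) = mat_app (A ** B) f"
  by (rule l2_eqI) (use rep_mat_app[of A "mat_app B f"] rep_mat_app[of B f] rep_mat_app[of "A ** B" f]
    in eventually_elim, simp add: matrix_vector_mul_assoc)

lemma mat_app_one [simp]: "mat_app (mat 1) f = f"
  by (rule l2_eqI) (use rep_mat_app[of "mat 1" f] in eventually_elim, simp)

lemma mat_app_uminus: "mat_app (- A) f = - mat_app A f"
  by (rule l2_eqI) (use rep_mat_app[of "- A" f] rep_mat_app[of A f] rep_uminus[of "mat_app A f"]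
    in eventually_elim, simp add: complex_vec2_eq_iff matrix_vector_mult_def sum_2)

lemma mat_app_zero [simp]: "mat_app A 0 = 0"
  using mat_app_add[of A 0 0] by simp

lemma mat_app_minus_right [simp]: "mat_app A (- f) = - mat_app A f"
  using mat_app_add[of A f "- f"] by (simp add: eq_neg_iff_add_eq_0 add.commute)

section \<open>The complex inner product\<close>

lemma cinner_commute: "cinner g f = cnj (cinner f g)"
  unfolding cinner.rep_eq
  by (subst Bochner_Integration.integral_cnj[symmetric]) (simp add: cdot_def mult.commute)

lemma cinner_add_left: "cinner (f + g) h = cinner f h + cinner g h"
proof -
  have "cinner (f + g) h = (LINT x|I01. cdot (rep_l2 f x) (rep_l2 h x) + cdot (rep_l2 g x) (rep_l2 h x))"
    unfolding cinner.rep_eq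
  proof (rule integral_cong_AE)
    show "AE x in I01. cdot (rep_l2 (f + g) x) (rep_l2 h x) = cdot (rep_l2 f x) (rep_l2 h x) + cdot (rep_l2 g x) (rep_l2 h x)"
      using rep_plus[of f g] by eventually_elim (simp add: cdot_def sum_2 algebra_simps)
  qed (auto intro!: borel_measurable_integrable borel_measurable_add integrable_cdot square_integrable_rep_l2)
  then show ?thesis
    by (simp add: cinner.rep_eq integrable_cdot square_integrable_rep_l2)
qed

lemma cinner_scaleC_left: "cinner (c *\<^sub>C f) g = c * cinner f g"
proof -
  have "cinner (c *\<^sub>C f) g = (LINT x|I01. c * cdot (rep_l2 f x) (rep_l2 g x))"
    unfolding cinner.rep_eq
  proof (rule integral_cong_AE)
    show "AE x in I01. cdot (rep_l2 (c *\<^sub>C f) x) (rep_l2 g x) = c * cdot (rep_l2 f x) (rep_l2 g x)"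
      using rep_scaleC[of c f] by eventually_elim (simp add: cdot_def sum_2 algebra_simps)
  qed (auto intro!: borel_measurable_integrable borel_measurable_times integrable_cdot square_integrable_rep_l2)
  then show ?thesis by (simp add: cinner.rep_eq)
qed

lemma cinner_add_right: "cinner f (g + h) = cinner f g + cinner f h"
  by (simp add: cinner_commute[of f] cinner_add_left)

lemma cinner_scaleC_right: "cinner f (c *\<^sub>C g) = cnj c * cinner f g"
  by (simp add: cinner_commute[of f] cinner_scaleC_left)

lemma cinner_minus [simp]: "cinner (- f) g = - cinner f g" "cinner f (- g) = - cinner f g"
  using cinner_scaleC_left[of "-1" f g] cinner_scaleC_right[of f "-1" g] by simp_all

lemma cinner_diff: "cinner (f - h) g = cinner f g - cinner h g" "cinner f (g - h) = cinner f g - cinner f h"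
  using cinner_add_left[of f "- h" g] cinner_add_right[of f g "- h"] by simp_all

lemma cinner_self: "cinner f f = of_real ((norm f)\<^sup>2)"
proof (rule complex_eqI)
  show "Re (cinner f f) = Re (of_real ((norm f)\<^sup>2))"
    by (simp add: power2_norm_eq_inner inner_l2_def)
  show "Im (cinner f f) = Im (of_real ((norm f)\<^sup>2))"
    using arg_cong[OF cinner_commute[of f f], of Im] by simp
qed

lemma cinner_mat_app:
  assumes "\<And>i j. A $ i $ j = cnj (A $ j $ i)"
  shows "cinner (mat_app A f) g = cinner f (mat_app A g)"
  unfolding cinner.rep_eq
proof (rule integral_cong_AE)
  have A: "cnj (A $ 1 $ 2) = A $ 2 $ 1" "cnj (A $ 2 $ 1) = A $ 1 $ 2" "cnj (A $ 1 $ 1) = A $ 1 $ 1" "cnj (A $ 2 $ 2) = A $ 2 $ 2"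
    using assms by metis+
  show "AE x in I01. cdot (rep_l2 (mat_app A f) x) (rep_l2 g x) = cdot (rep_l2 f x) (rep_l2 (mat_app A g) x)"
    using rep_mat_app[of A f] rep_mat_app[of A g]
    by eventually_elim (simp add: cdot_def sum_2 matrix_vector_mult_def A algebra_simps)
qed (auto intro!: borel_measurable_integrable integrable_cdot square_integrable_rep_l2)

lemma bounded_clinear_mat_app: "bounded_clinear (mat_app A)"
  unfolding bounded_clinear_def
proof (intro conjI allI mat_app_scaleC)
  obtain K where K: "0 \<le> K" "\<And>v. norm (A *v v) \<le> norm v * K"
    using bounded_linear.nonneg_bounded[OF bounded_linear_matrix_complex] by blast
  show "bounded_linear (mat_app A)"
  proof (rule bounded_linear_intro[of _ K])
    fix f
    have sq: "integrable I01 (\<lambda>x. (norm (rep_l2 f x))\<^sup>2)" for f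
      using square_integrable_rep_l2[of f] by (simp add: square_integrable_def)
    have "(norm (mat_app A f))\<^sup>2 \<le> (LINT x|I01. K\<^sup>2 * (norm (rep_l2 f x))\<^sup>2)"
      unfolding norm_l2_square
    proof (rule integral_mono_AE)
      show "AE x in I01. (norm (rep_l2 (mat_app A f) x))\<^sup>2 \<le> K\<^sup>2 * (norm (rep_l2 f x))\<^sup>2"
        using rep_mat_app[of A f]
      proof eventually_elim
        case (elim x)
        show ?case using power_mono[OF K(2)[of "rep_l2 f x"], of 2] elim by (simp add: power_mult_distrib mult.commute)
      qed
    qed (use sq in auto)
    also have "\<dots> = (norm f * K)\<^sup>2" by (simp add: norm_l2_square power_mult_distrib mult.commute)
    finally show "norm (mat_app A f) \<le> norm f * K" by (rule power2_le_imp_le) (use K in simp)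
  qed (simp_all add: mat_app_add mat_app_scaleC flip: scaleC_of_real)
qed

text \<open>By injectivity the preimage supplied by \<open>ran\<close> is the value of the inverse,
  so its bound is a bound for the inverse.\<close>

lemma bij_betw_bounded_inverse:
  fixes T :: "l2 \<Rightarrow> l2"
  assumes V: "\<And>f g c. f \<in> V \<Longrightarrow> g \<in> V \<Longrightarrow> f + c *\<^sub>C g \<in> V"
    and T: "\<And>f g c. f \<in> V \<Longrightarrow> g \<in> V \<Longrightarrow> T (f + c *\<^sub>C g) = T f + c *\<^sub>C T g"
    and ker: "\<And>f. f \<in> V \<Longrightarrow> T f = 0 \<Longrightarrow> f = 0"
    and ran: "\<And>g. \<exists>f\<in>V. T f = g \<and> norm f \<le> C * norm g"
  shows "bij_betw T V UNIV \<and> bounded_clinear (inv_into V T)"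
proof -
  have inj: "inj_on T V"
  proof (rule inj_onI)
    fix f g assume fg: "f \<in> V" "g \<in> V" "T f = T g"
    have "f + (- 1) *\<^sub>C g = 0"
    proof (rule ker)
      show "f + (- 1) *\<^sub>C g \<in> V" by (rule V[OF fg(1,2)])
      show "T (f + (- 1) *\<^sub>C g) = 0" using T[OF fg(1,2), of "-1"] fg(3) by simp
    qed
    then show "f = g" by simp
  qed
  have surj: "T ` V = UNIV"
  proof (intro equalityI subsetI UNIV_I)
    fix g from ran[of g] show "g \<in> T ` V" by blast
  qed
  define R where "R = inv_into V T"
  have R: "R g \<in> V" "T (R g) = g" for g
    using surj by (auto simp: R_def inv_into_into f_inv_into_f)
  have RT: "R (T f) = f" if "f \<in> V" for f using that inj by (simp add: R_def)
  have lin: "R (g + c *\<^sub>C h) = R g + c *\<^sub>C R h" for g h c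
    using T[OF R(1) R(1), of g c h] RT[OF V[OF R(1) R(1), of g c h]] by (simp add: R(2))
  have R0: "R 0 = 0" using lin[of 0 "-1" 0] by simp
  have bound: "norm (R g) \<le> norm g * C" for g
    using ran[of g] RT by (auto simp: mult.commute)
  have sc: "R (c *\<^sub>C h) = c *\<^sub>C R h" for c h using lin[of 0 c h] R0 by simp
  have "bounded_linear R"
  proof (rule bounded_linear_intro[OF _ _ bound])
    show "R (g + h) = R g + R h" for g h using lin[of g 1 h] by simp
    show "R (r *\<^sub>R g) = r *\<^sub>R R g" for r g by (simp add: sc flip: scaleC_of_real)
  qed
  with sc inj surj show ?thesis by (simp add: bounded_clinear_def bij_betw_def R_def)
qed

lemma dom_op_AD [simp]: "dom (op_AD A) = Dom_D"
  by (auto simp: op_AD_def dom_def)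

lemma op_AD_apply: "f \<in> Dom_D \<Longrightarrow> op_AD A f = Some (- mat_app A (weak_deriv2 f))"
  by (simp add: op_AD_def)

lemma op_AD_shift_linear:
  assumes "f \<in> Dom_D" "g \<in> Dom_D"
  shows "- mat_app A (weak_deriv2 (f + c *\<^sub>C g)) - z *\<^sub>C (f + c *\<^sub>C g)
    = (- mat_app A (weak_deriv2 f) - z *\<^sub>C f) + c *\<^sub>C (- mat_app A (weak_deriv2 g) - z *\<^sub>C g)"
  using Dom_D_linear[OF assms, of c]
  by (simp add: mat_app_add mat_app_scaleC scaleC_add_right scaleC_diff_right mult.commute algebra_simps)

text \<open>For every \<open>g\<close> the solutions satisfying the conditions at 0 form a
  two-parameter family, and the conditions at 1 are a linear system with determinant \<Delta>.
  Injectivity excludes \<Delta> = 0, and then the parameters depend boundedly on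
  \<open>g\<close>.\<close>

lemma (in shooting) in_resolvent_set:
  assumes ker: "\<And>f. f \<in> Dom_D \<Longrightarrow> - mat_app A (weak_deriv2 f) = z *\<^sub>C f \<Longrightarrow> f = 0"
  shows "z \<in> resolvent_set (op_AD A)"
proof -
  obtain C where C: "C \<ge> 0" "\<And>g. norm (P g) \<le> C * norm g" "\<And>g. norm (Q g) \<le> C * norm g"
    using PQ_bound by blast
  obtain K where K: "K \<ge> 0" "\<And>g \<alpha> \<beta>. norm (abs_l2 (sol g \<alpha> \<beta>)) \<le> K * (norm \<alpha> + norm \<beta> + norm g)"
    using sol_bound by blast
  define \<Delta> where "\<Delta> = m11 * m22 - m12 * m21"
  have dom: "abs_l2 (sol g \<alpha> \<beta>) \<in> Dom_D" "weak_deriv2 (abs_l2 (sol g \<alpha> \<beta>)) = abs_l2 (sol'' g \<alpha> \<beta>)"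
    if "\<alpha> * m11 + \<beta> * m12 + P g = 0" "\<alpha> * m21 + \<beta> * m22 + Q g = 0" for g \<alpha> \<beta>
  proof -
    have "boundary_conditions (sol g \<alpha> \<beta>) (sol' g \<alpha> \<beta>)" using that by (simp add: boundary_conditions_def sol_boundary)
    from Dom_D_I[OF strong_deriv2_sol this]
    show "abs_l2 (sol g \<alpha> \<beta>) \<in> Dom_D" "weak_deriv2 (abs_l2 (sol g \<alpha> \<beta>)) = abs_l2 (sol'' g \<alpha> \<beta>)" .
  qed
  \<comment> \<open>A null vector of the system yields, for g = 0, a solution in the domain. It must
    be zero by hypothesis, and then so are its parameters.\<close>
  have \<Delta>: "\<Delta> \<noteq> 0"
  proof
    assume "\<Delta> = 0"
    then have "\<exists>\<alpha> \<beta>. (\<alpha> \<noteq> 0 \<or> \<beta> \<noteq> 0) \<and> \<alpha> * m11 + \<beta> * m12 = 0 \<and> \<alpha> * m21 + \<beta> * m22 = 0"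
    proof (cases "m11 = 0 \<and> m12 = 0")
      case True
      show ?thesis
      proof (cases "m21 = 0 \<and> m22 = 0")
        case True
        with \<open>m11 = 0 \<and> m12 = 0\<close> show ?thesis by (intro exI[of _ 1]) auto
      next
        case False
        with True show ?thesis by (intro exI[of _ "- m22"] exI[of _ m21]) auto
      qed
    next
      case False
      with \<open>\<Delta> = 0\<close> show ?thesis
        by (intro exI[of _ "- m12"] exI[of _ m11]) (auto simp: \<Delta>_def algebra_simps)
    qed
    then obtain \<alpha> \<beta> where ab: "\<alpha> \<noteq> 0 \<or> \<beta> \<noteq> 0" "\<alpha> * m11 + \<beta> * m12 = 0" "\<alpha> * m21 + \<beta> * m22 = 0" by blast
    \<comment> \<open>The representative of 0 is zero only almost everywhere, so the vanishing of
      \<open>P\<close> and \<open>Q\<close> there is read off from their bounds.\<close>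
    have PQ0: "P 0 = 0" "Q 0 = 0" using C(2)[of 0] C(3)[of 0] by simp_all
    have eq0: "- mat_app A (abs_l2 (sol'' 0 \<alpha> \<beta>)) = z *\<^sub>C abs_l2 (sol 0 \<alpha> \<beta>)"
      using sol_equation[of 0 \<alpha> \<beta>] by (metis eq_iff_diff_eq_0)
    have d: "\<alpha> * m11 + \<beta> * m12 + P 0 = 0" "\<alpha> * m21 + \<beta> * m22 + Q 0 = 0" using ab PQ0 by simp_all
    from ker[OF dom(1)[OF d]] have "abs_l2 (sol 0 \<alpha> \<beta>) = 0" by (simp add: dom(2)[OF d] eq0)
    then have "AE x in I01. sol 0 \<alpha> \<beta> x = 0"
      using abs_l2_eq_iff[OF square_integrable_continuous[OF sol_continuous] square_integrable_zero, of 0 \<alpha> \<beta>]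
      by (simp add: zero_l2_def)
    from continuous_AE_eq[OF sol_continuous continuous_on_const this]
    have z0: "sol 0 \<alpha> \<beta> x = 0" if "x \<in> {0..1}" for x using that by simp
    \<comment> \<open>The solution is identically zero on [0, 1], hence so are its value and its
      one-sided derivative at 0. These are non-zero multiples of \<alpha> and \<beta> in the
      remaining components.\<close>
    have "((\<lambda>x. 0) has_vector_derivative sol' 0 \<alpha> \<beta> 0) (at 0 within {0..1})"
      by (rule has_vector_derivative_transform[OF _ _ sol_has_vector_derivative[of 0 0 \<alpha> \<beta>]]) (auto simp: z0)
    moreover have "((\<lambda>x. 0) has_vector_derivative 0) (at 0 within {0..1::real})" by simp
    ultimately have "sol' 0 \<alpha> \<beta> 0 = 0"
      by (rule vector_derivative_unique_within[rotated]) (simp add: trivial_limit_within islimpt_Icc)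
    then have "\<beta> * (s2 - s1) = 0" using sol_boundary(4)[of 0 \<alpha> \<beta>] by simp
    moreover have "\<alpha> * (s1 - s2) = 0" using z0[of 0] sol_boundary(3)[of 0 \<alpha> \<beta>] by simp
    ultimately show False using ab(1) s by auto
  qed
  define KK where "KK = K * ((C * norm m12 + C * norm m22) / norm \<Delta> + (C * norm m11 + C * norm m21) / norm \<Delta> + 1)"
  have "\<exists>f\<in>Dom_D. - mat_app A (weak_deriv2 f) - z *\<^sub>C f = g \<and> norm f \<le> KK * norm g" for g
  proof -
    \<comment> \<open>Cramer's rule.\<close>
    define \<alpha> where "\<alpha> = (Q g * m12 - P g * m22) / \<Delta>"
    define \<beta> where "\<beta> = (P g * m21 - Q g * m11) / \<Delta>"
    have "(\<alpha> * m11 + \<beta> * m12 + P g) * \<Delta> = 0" "(\<alpha> * m21 + \<beta> * m22 + Q g) * \<Delta> = 0"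
      using \<Delta> by (simp_all add: \<alpha>_def \<beta>_def distrib_right) (simp_all add: \<Delta>_def algebra_simps)
    then have sys: "\<alpha> * m11 + \<beta> * m12 + P g = 0" "\<alpha> * m21 + \<beta> * m22 + Q g = 0" using \<Delta> by simp_all
    have n: "norm (Q g * m - P g * m') \<le> (C * norm m + C * norm m') * norm g"
      "norm (P g * m - Q g * m') \<le> (C * norm m + C * norm m') * norm g" for m m'
    proof -
      have "norm (p * m - q * m') \<le> (C * norm m + C * norm m') * norm g"
        if "norm p \<le> C * norm g" "norm q \<le> C * norm g" for p q
      proof -
        have "norm (p * m - q * m') \<le> norm p * norm m + norm q * norm m'"
          using norm_triangle_ineq4[of "p * m" "q * m'"] by (simp add: norm_mult)
        also have "\<dots> \<le> C * norm g * norm m + C * norm g * norm m'"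
          by (intro add_mono mult_right_mono that) auto
        finally show ?thesis by (simp add: algebra_simps)
      qed
      from this[OF C(3) C(2)] this[OF C(2) C(3)]
      show "norm (Q g * m - P g * m') \<le> (C * norm m + C * norm m') * norm g"
        "norm (P g * m - Q g * m') \<le> (C * norm m + C * norm m') * norm g" by auto
    qed
    have "norm \<alpha> \<le> (C * norm m12 + C * norm m22) / norm \<Delta> * norm g"
      using divide_right_mono[OF n(1)[of m12 m22], of "norm \<Delta>"] by (simp add: \<alpha>_def norm_divide)
    moreover have "norm \<beta> \<le> (C * norm m11 + C * norm m21) / norm \<Delta> * norm g"
      using divide_right_mono[OF n(2)[of m21 m11], of "norm \<Delta>"] by (simp add: \<beta>_def norm_divide add.commute)
    ultimately have "norm \<alpha> + norm \<beta> + norm g \<le> ((C * norm m12 + C * norm m22) / norm \<Delta>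
        + (C * norm m11 + C * norm m21) / norm \<Delta> + 1) * norm g"
      by (simp only: distrib_right mult_1_left)
    from mult_left_mono[OF this K(1)] K(2)[of g \<alpha> \<beta>] have "norm (abs_l2 (sol g \<alpha> \<beta>)) \<le> KK * norm g"
      by (simp add: KK_def mult.assoc)
    then show ?thesis
      using dom[OF sys] sol_equation[of g \<alpha> \<beta>] by (intro bexI[of _ "abs_l2 (sol g \<alpha> \<beta>)"]) auto
  qed
  then have "bij_betw (\<lambda>f. - mat_app A (weak_deriv2 f) - z *\<^sub>C f) Dom_D UNIV \<and>
      bounded_clinear (inv_into Dom_D (\<lambda>f. - mat_app A (weak_deriv2 f) - z *\<^sub>C f))"
    by (intro bij_betw_bounded_inverse[where C=KK])
      (auto intro: Dom_D_linear(1) op_AD_shift_linear ker)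
  moreover have "bij_betw (\<lambda>f. the (op_AD A f) - z *\<^sub>C f) Dom_D UNIV \<longleftrightarrow>
      bij_betw (\<lambda>f. - mat_app A (weak_deriv2 f) - z *\<^sub>C f) Dom_D UNIV"
    by (rule bij_betw_cong) (simp add: op_AD_apply)
  moreover have "inv_into Dom_D (\<lambda>f. the (op_AD A f) - z *\<^sub>C f) = inv_into Dom_D (\<lambda>f. - mat_app A (weak_deriv2 f) - z *\<^sub>C f)"
    by (simp add: inv_into_def fun_eq_iff op_AD_apply cong: conj_cong)
  ultimately show ?thesis by (simp add: resolvent_set_def)
qed

section \<open>Energy identity and self-adjointness\<close>

lemma cinner_weak_deriv2_symmetric:
  assumes "f \<in> Dom_D" "g \<in> Dom_D"
  shows "cinner (weak_deriv2 f) g = cinner f (weak_deriv2 g)"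
proof -
  obtain F F' where F: "strong_deriv2 f (weak_deriv2 f) F F'" "boundary_conditions F F'" using Dom_D_E[OF assms(1)] .
  obtain G G' where G: "strong_deriv2 g (weak_deriv2 g) G G'" "boundary_conditions G G'" using Dom_D_E[OF assms(2)] .
  have c: "continuous_on {0..1} F'" "continuous_on {0..1} G'"
    using F G by (auto simp: strong_deriv2_def C1_representative_def)
  have i: "(\<lambda>x. cdot (G' x) (F' x)) integrable_on {0..1}"
    by (intro integrable_continuous_real bounded_bilinear.continuous_on[OF bounded_bilinear_cdot] c)
  have "cinner f (weak_deriv2 g) = cnj (- integral {0..1} (\<lambda>x. cdot (G' x) (F' x)))"
    using cinner_weak_deriv2[OF G F] cinner_commute[of f "weak_deriv2 g"] by simp
  also have "\<dots> = - integral {0..1} (\<lambda>x. cnj (cdot (G' x) (F' x)))"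
    using integral_linear[OF i bounded_linear_cnj] by (simp add: o_def)
  also have "(\<lambda>x. cnj (cdot (G' x) (F' x))) = (\<lambda>x. cdot (F' x) (G' x))"
    by (simp add: cdot_def mult.commute)
  finally show ?thesis using cinner_weak_deriv2[OF F G] by simp
qed

text \<open>\<open>E\<close> is the integral of the squared norm of \<open>F'\<close>. If it
  vanishes, \<open>f\<close> is constant but possibly non-zero, as its second component is free;
  hence the last clause speaks of the second derivative.\<close>

lemma cinner_weak_deriv2_energy:
  assumes "f \<in> Dom_D"
  obtains E where "E \<ge> 0" "cinner (- weak_deriv2 f) f = of_real E" "E = 0 \<Longrightarrow> weak_deriv2 f = 0"
proof -
  obtain F F' where F: "strong_deriv2 f (weak_deriv2 f) F F'" "boundary_conditions F F'" using Dom_D_E[OF assms] .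
  have c: "continuous_on {0..1} F'"
    using F by (auto simp: strong_deriv2_def C1_representative_def)
  define E where "E = integral {0..1} (\<lambda>x. (norm (F' x))\<^sup>2)"
  have cE: "continuous_on {0..1} (\<lambda>x. (norm (F' x))\<^sup>2)" by (intro continuous_intros c)
  show thesis
  proof (rule that)
    show "E \<ge> 0" unfolding E_def
      by (rule Henstock_Kurzweil_Integration.integral_nonneg[OF integrable_continuous_real[OF cE]]) simp
    have "cdot v v = of_real ((norm v)\<^sup>2)" for v
      by (rule complex_eqI) (simp_all add: Re_cdot power2_norm_eq_inner, simp add: cdot_def)
    then have "cinner (- weak_deriv2 f) f = integral {0..1} (\<lambda>x. of_real ((norm (F' x))\<^sup>2))"
      using cinner_weak_deriv2[OF F F] by simp
    also have "\<dots> = of_real E"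
      unfolding E_def using integral_linear[OF integrable_continuous_real[OF cE] bounded_linear_of_real[where 'a=complex]]
      by (simp add: o_def)
    finally show "cinner (- weak_deriv2 f) f = of_real E" .
    assume "E = 0"
    then have z: "F' x = 0" if "x \<in> {0..1}" for x
      using integral_eq_0_iff[OF cE] that by (simp add: E_def)
    have "integral {0..x} (rep_l2 0) = 0" if "x \<in> {0..1}" for x
      using AE_eq_integral_eq[OF rep_zero, of 0 x] that by simp
    with z F(1) have "strong_deriv2 f 0 F F'" by (simp add: strong_deriv2_def)
    from Dom_D_I(2)[OF this F(2)] show "weak_deriv2 f = 0" .
  qed
qed

text \<open>\<open>B\<close> is the inverse of \<open>A\<close>. Applying it to the equation and
  pairing with \<open>f\<close> gives E = z q, where E is the energy and q is the form of
  \<open>B\<close> at \<open>f\<close>, real because \<open>B\<close> is hermitian. The hypothesis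
  on q and E isolates the sign argument, which is one thing for definite and another for indefinite
  matrices.\<close>

lemma op_AD_kernel_trivial:
  assumes f: "f \<in> Dom_D" "- mat_app A (weak_deriv2 f) = z *\<^sub>C f"
    and B: "B ** A = mat 1" "\<And>i j. B $ i $ j = cnj (B $ j $ i)"
    and q: "\<And>q E :: real. cinner (mat_app B f) f = of_real q \<Longrightarrow> E \<ge> 0 \<Longrightarrow> z * of_real q = of_real E \<Longrightarrow> E = 0"
    and z: "z \<noteq> 0"
  shows "f = 0"
proof -
  obtain E where E: "E \<ge> 0" "cinner (- weak_deriv2 f) f = of_real E" "E = 0 \<Longrightarrow> weak_deriv2 f = 0"
    using cinner_weak_deriv2_energy[OF f(1)] by blast
  have "- weak_deriv2 f = mat_app B (- mat_app A (weak_deriv2 f))" by (simp add: B(1))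
  also have "\<dots> = z *\<^sub>C mat_app B f" by (simp only: f(2) mat_app_scaleC)
  finally have "of_real E = z * cinner (mat_app B f) f" using E(2) by (simp only: cinner_scaleC_left)
  moreover have "cinner (mat_app B f) f \<in> \<real>"
    using cinner_mat_app[OF B(2), of f f] cinner_commute[of "mat_app B f" f] by (simp add: complex_is_Real_iff complex_eq_iff)
  then obtain q' where "cinner (mat_app B f) f = of_real q'" by (auto elim: Reals_cases)
  ultimately have "E = 0" using q[of q' E] E(1) by simp
  \<comment> \<open>Zero energy makes the second derivative vanish, and the equation itself then
    annihilates z f.\<close>
  then have "z *\<^sub>C f = 0" using E(3) f(2) by simp
  then have "(1 / z) *\<^sub>C z *\<^sub>C f = 0" by (simp only: scaleC_zero_right)
  then show "f = 0" using z by simp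
qed

section \<open>Resolvent sets of linear operators and their behaviour under sign change\<close>

lemma linear_operator_combination:
  assumes "linear_operator K" "f \<in> dom K" "g \<in> dom K"
  shows "f + c *\<^sub>C g \<in> dom K" "the (K (f + c *\<^sub>C g)) = the (K f) + c *\<^sub>C the (K g)"
proof -
  have g: "K (c *\<^sub>C g) = Some (c *\<^sub>C the (K g))" using assms by (auto simp: linear_operator_def)
  then have "c *\<^sub>C g \<in> dom K" by auto
  with assms g have "K (f + c *\<^sub>C g) = Some (the (K f) + c *\<^sub>C the (K g))"
    by (auto simp: linear_operator_def)
  then show "f + c *\<^sub>C g \<in> dom K" "the (K (f + c *\<^sub>C g)) = the (K f) + c *\<^sub>C the (K g)" by auto
qed

text \<open>In this form, free of \<open>inv_into\<close>, membership in the resolvent set can be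
  carried across a sign change or a similarity.\<close>

lemma resolvent_set_iff:
  assumes K: "linear_operator K"
  shows "z \<in> resolvent_set K \<longleftrightarrow> (\<forall>f\<in>dom K. the (K f) - z *\<^sub>C f = 0 \<longrightarrow> f = 0) \<and>
    (\<exists>C. \<forall>g. \<exists>f\<in>dom K. the (K f) - z *\<^sub>C f = g \<and> norm f \<le> C * norm g)"
proof
  assume "z \<in> resolvent_set K"
  then have b: "bij_betw (\<lambda>f. the (K f) - z *\<^sub>C f) (dom K) UNIV"
    and R: "bounded_linear (inv_into (dom K) (\<lambda>f. the (K f) - z *\<^sub>C f))"
    by (auto simp: resolvent_set_def bounded_clinear_def)
  let ?T = "\<lambda>f. the (K f) - z *\<^sub>C f" and ?R = "inv_into (dom K) (\<lambda>f. the (K f) - z *\<^sub>C f)"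
  obtain C where C: "\<And>g. norm (?R g) \<le> norm g * C" using bounded_linear.bounded[OF R] by blast
  have 0: "0 \<in> dom K" "?T 0 = 0"
  proof -
    show "0 \<in> dom K" using K by (simp add: linear_operator_def)
    from linear_operator_combination(2)[OF K this this, of "-1"] show "?T 0 = 0" by simp
  qed
  have "f = 0" if "f \<in> dom K" "?T f = 0" for f
    using b 0 that unfolding bij_betw_def inj_on_def by metis
  moreover have R: "?R g \<in> dom K" "?T (?R g) = g" for g
    using b bij_betw_inv_into_right[OF b UNIV_I] by (auto simp: bij_betw_def inv_into_into)
  ultimately show "(\<forall>f\<in>dom K. ?T f = 0 \<longrightarrow> f = 0) \<and> (\<exists>C. \<forall>g. \<exists>f\<in>dom K. ?T f = g \<and> norm f \<le> C * norm g)"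
  proof (intro conjI exI[of _ C] allI)
    fix g
    show "\<exists>f\<in>dom K. ?T f = g \<and> norm f \<le> C * norm g"
      using R[of g] C[of g] by (intro bexI[of _ "?R g"] conjI) (simp_all add: mult.commute)
  qed blast
next
  assume r: "(\<forall>f\<in>dom K. the (K f) - z *\<^sub>C f = 0 \<longrightarrow> f = 0) \<and>
    (\<exists>C. \<forall>g. \<exists>f\<in>dom K. the (K f) - z *\<^sub>C f = g \<and> norm f \<le> C * norm g)"
  then obtain C where C: "\<And>g. \<exists>f\<in>dom K. the (K f) - z *\<^sub>C f = g \<and> norm f \<le> C * norm g" by blast
  show "z \<in> resolvent_set K"
    unfolding resolvent_set_def mem_Collect_eq
  proof (rule bij_betw_bounded_inverse[OF _ _ _ C])
    fix f g c assume fg: "f \<in> dom K" "g \<in> dom K"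
    show "f + c *\<^sub>C g \<in> dom K" by (rule linear_operator_combination[OF K fg])
    show "the (K (f + c *\<^sub>C g)) - z *\<^sub>C (f + c *\<^sub>C g) = (the (K f) - z *\<^sub>C f) + c *\<^sub>C (the (K g) - z *\<^sub>C g)"
      by (simp add: linear_operator_combination(2)[OF K fg] scaleC_add_right scaleC_diff_right mult.commute algebra_simps)
  qed (use r in blast)
qed

lemma linear_operator_op_AD: "linear_operator (op_AD A)"
  unfolding linear_operator_def
proof (intro conjI ballI allI)
  show "0 \<in> dom (op_AD A)" by (simp add: zero_Dom_D)
  fix f assume f: "f \<in> dom (op_AD A)"
  then have D: "f \<in> Dom_D" by simp
  show "op_AD A (f + g) = Some (the (op_AD A f) + the (op_AD A g))" if "g \<in> dom (op_AD A)" for g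
    using Dom_D_linear[OF D, of g 1] that D by (simp add: op_AD_apply mat_app_add)
  have w0: "weak_deriv2 0 = 0"
    using Dom_D_linear(2)[OF zero_Dom_D zero_Dom_D, of "-1"] by simp
  show "op_AD A (c *\<^sub>C f) = Some (c *\<^sub>C the (op_AD A f))" for c
    using Dom_D_linear[OF zero_Dom_D D, of c] D by (simp add: op_AD_apply mat_app_scaleC w0)
qed

lemma neg_op_op_AD: "neg_op (op_AD A) = op_AD (- A)"
  by (auto simp: neg_op_def op_AD_def mat_app_uminus fun_eq_iff)

lemma resolvent_set_op_AD_uminus:
  assumes "- z \<in> resolvent_set (op_AD A)"
  shows "z \<in> resolvent_set (op_AD (- A))"
proof -
  have r: "(\<forall>f\<in>Dom_D. the (op_AD A f) - (- z) *\<^sub>C f = 0 \<longrightarrow> f = 0)"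
    "\<exists>C. \<forall>g. \<exists>f\<in>Dom_D. the (op_AD A f) - (- z) *\<^sub>C f = g \<and> norm f \<le> C * norm g"
    using assms by (simp_all add: resolvent_set_iff[OF linear_operator_op_AD])
  then obtain C where C: "\<And>g. \<exists>f\<in>Dom_D. the (op_AD A f) - (- z) *\<^sub>C f = g \<and> norm f \<le> C * norm g" by blast
  have e: "the (op_AD (- A) f) - z *\<^sub>C f = - (the (op_AD A f) - (- z) *\<^sub>C f)" if "f \<in> Dom_D" for f
    using that by (simp add: op_AD_apply mat_app_uminus)
  show ?thesis
    unfolding resolvent_set_iff[OF linear_operator_op_AD] dom_op_AD
  proof (intro conjI ballI impI exI[of _ C] allI)
    fix f assume f: "f \<in> Dom_D" "the (op_AD (- A) f) - z *\<^sub>C f = 0"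
    then show "f = 0" using r(1) e[OF f(1)] by (metis neg_equal_0_iff_equal)
  next
    fix g
    from C[of "- g"] show "\<exists>f\<in>Dom_D. the (op_AD (- A) f) - z *\<^sub>C f = g \<and> norm f \<le> C * norm g"
      using e by (metis minus_minus norm_minus_cancel)
  qed
qed

text \<open>Already the real part suffices: the set of vectors real-orthogonal to v - w is closed
  and contains \<open>V\<close>, so it contains v - w.\<close>

lemma cinner_dense_unique:
  assumes "closure V = UNIV" "\<And>f. f \<in> V \<Longrightarrow> cinner f v = cinner f w"
  shows "v = w"
proof -
  have "closed {f. f \<bullet> (v - w) = 0}"
    by (intro closed_Collect_eq continuous_intros)
  moreover have "V \<subseteq> {f. f \<bullet> (v - w) = 0}"
    using assms(2) by (auto simp: inner_l2_def cinner_diff)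
  ultimately have "closure V \<subseteq> {f. f \<bullet> (v - w) = 0}" by (rule closure_minimal[rotated])
  then have "(v - w) \<bullet> (v - w) = 0" using assms(1) by blast
  then show ?thesis by simp
qed

text \<open>Symmetry makes the adjoint an extension of \<open>K\<close>; what remains is that its
  domain is not larger. If the adjoint maps \<open>u\<close> to \<open>v\<close>, surjectivity
  provides \<open>w\<close> in the domain of \<open>K\<close> with (K - r) w = v - r u. Then u - w
  is orthogonal to the range of K - r, which is the whole space.\<close>

lemma self_adjointI:
  assumes K: "linear_operator K" "densely_defined K"
    and sym: "\<And>f g. f \<in> dom K \<Longrightarrow> g \<in> dom K \<Longrightarrow> cinner (the (K f)) g = cinner f (the (K g))"
    and r: "of_real r \<in> resolvent_set K"
  shows "self_adjoint K"
proof -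
  have surj: "\<exists>f\<in>dom K. the (K f) - of_real r *\<^sub>C f = g" for g
    using r unfolding resolvent_set_iff[OF K(1)] by blast
  have uniq: "v = w" if "\<forall>f\<in>dom K. cinner (the (K f)) u = cinner f v" "\<forall>f\<in>dom K. cinner (the (K f)) u = cinner f w" for u v w
    using K(2) that by (intro cinner_dense_unique[of "dom K"]) (auto simp: densely_defined_def)
  have "K u = adjoint_op K u" for u
  proof (cases "u \<in> dom K")
    case True
    have v: "\<forall>f\<in>dom K. cinner (the (K f)) u = cinner f (the (K u))" using sym True by blast
    then have "(THE v. \<forall>f\<in>dom K. cinner (the (K f)) u = cinner f v) = the (K u)"
      by (rule the_equality) (use uniq v in blast)
    then have "adjoint_op K u = Some (the (K u))" using v by (auto simp: adjoint_op_def)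
    then show ?thesis using True by auto
  next
    case False
    have "\<not> (\<exists>v. \<forall>f\<in>dom K. cinner (the (K f)) u = cinner f v)"
    proof
      assume "\<exists>v. \<forall>f\<in>dom K. cinner (the (K f)) u = cinner f v"
      then obtain v where v: "\<And>f. f \<in> dom K \<Longrightarrow> cinner (the (K f)) u = cinner f v" by blast
      obtain w where w: "w \<in> dom K" "the (K w) - of_real r *\<^sub>C w = v - of_real r *\<^sub>C u" using surj by blast
      \<comment> \<open>The vector u - w is itself represented in the range of K - r, so
        orthogonality to the range makes its norm zero. Since \<open>r\<close> is real, it passes
        unchanged through the inner product.\<close>
      obtain h where h: "h \<in> dom K" "the (K h) - of_real r *\<^sub>C h = u - w" using surj by blast
      have "cinner (u - w) (u - w) = cinner (the (K h) - of_real r *\<^sub>C h) u - cinner (the (K h) - of_real r *\<^sub>C h) w"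
        by (simp add: h(2) cinner_diff(2))
      also have "cinner (the (K h) - of_real r *\<^sub>C h) u = cinner h (v - of_real r *\<^sub>C u)"
        using v[OF h(1)] by (simp add: cinner_diff cinner_scaleC_left cinner_scaleC_right)
      also have "cinner (the (K h) - of_real r *\<^sub>C h) w = cinner h (the (K w) - of_real r *\<^sub>C w)"
        using sym[OF h(1) w(1)] by (simp add: cinner_diff cinner_scaleC_left cinner_scaleC_right)
      finally have "cinner (u - w) (u - w) = 0" by (simp add: w(2))
      then have "u = w" by (simp add: cinner_self)
      with w(1) False show False by simp
    qed
    then show ?thesis using False by (auto simp: adjoint_op_def)
  qed
  then show ?thesis using K by (auto simp: self_adjoint_def)
qed

section \<open>Density of the domain\<close>

lemma abs_l2_add:
  assumes "square_integrable u" "square_integrable v"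
  shows "abs_l2 (\<lambda>x. u x + v x) = abs_l2 u + abs_l2 v"
  by (rule l2_eqI) (use rep_abs_l2[OF square_integrable_add[OF assms]] rep_abs_l2[OF assms(1)] rep_abs_l2[OF assms(2)]
    rep_plus[of "abs_l2 u" "abs_l2 v"] in eventually_elim, simp)

lemma abs_l2_sum:
  assumes "finite I" "\<And>i. i \<in> I \<Longrightarrow> square_integrable (u i)"
  shows "square_integrable (\<lambda>x. \<Sum>i\<in>I. u i x) \<and> abs_l2 (\<lambda>x. \<Sum>i\<in>I. u i x) = (\<Sum>i\<in>I. abs_l2 (u i))"
  using assms
  by (induction I rule: finite_induct)
    (auto simp: square_integrable_zero zero_l2_def abs_l2_add square_integrable_add)

lemma abs_l2_tendsto:
  assumes s: "\<And>n. square_integrable (s n)" and u: "square_integrable u"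
    and lim: "AE x in I01. (\<lambda>n. s n x) \<longlonglongrightarrow> u x"
    and dom: "\<And>n. AE x in I01. norm (s n x - u x) \<le> w x" and w: "integrable I01 (\<lambda>x. (w x)\<^sup>2)"
  shows "(\<lambda>n. abs_l2 (s n)) \<longlonglongrightarrow> abs_l2 u"
proof -
  have m [measurable]: "s n \<in> borel_measurable I01" "u \<in> borel_measurable I01" for n
    using s u by (auto simp: square_integrable_def)
  have sq: "(norm (abs_l2 (s n) - abs_l2 u))\<^sup>2 = (LINT x|I01. (norm (s n x - u x))\<^sup>2)" for n
    unfolding norm_l2_square
  proof (rule integral_cong_AE)
    show "(\<lambda>x. (norm (rep_l2 (abs_l2 (s n) - abs_l2 u) x))\<^sup>2) \<in> borel_measurable I01"
      using square_integrable_rep_l2 unfolding square_integrable_def by blast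
    show "AE x in I01. (norm (rep_l2 (abs_l2 (s n) - abs_l2 u) x))\<^sup>2 = (norm (s n x - u x))\<^sup>2"
      using rep_minus[of "abs_l2 (s n)" "abs_l2 u"] rep_abs_l2[OF s[of n]] rep_abs_l2[OF u]
      by eventually_elim simp
  qed simp
  have "(\<lambda>n. LINT x|I01. (norm (s n x - u x))\<^sup>2) \<longlonglongrightarrow> (LINT x|I01. 0)"
  proof (rule integral_dominated_convergence[OF _ _ w])
    show "AE x in I01. (\<lambda>n. (norm (s n x - u x))\<^sup>2) \<longlonglongrightarrow> 0"
      using lim
    proof eventually_elim
      case (elim x)
      have "(\<lambda>n. (norm (s n x - u x))\<^sup>2) \<longlonglongrightarrow> (norm (u x - u x))\<^sup>2" by (intro tendsto_intros elim)
      then show ?case by simp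
    qed
    show "AE x in I01. norm ((norm (s n x - u x))\<^sup>2) \<le> (w x)\<^sup>2" for n
      using dom[of n] by eventually_elim (simp add: power_mono)
  qed simp_all
  then have "(\<lambda>n. sqrt ((norm (abs_l2 (s n) - abs_l2 u))\<^sup>2)) \<longlonglongrightarrow> sqrt 0"
    unfolding sq by (intro tendsto_real_sqrt) simp
  then have "(\<lambda>n. norm (abs_l2 (s n) - abs_l2 u)) \<longlonglongrightarrow> 0" by simp
  then have "(\<lambda>n. abs_l2 (s n) - abs_l2 u) \<longlonglongrightarrow> 0" by (rule tendsto_norm_zero_cancel)
  then show ?thesis by (simp add: LIM_zero_iff)
qed

lemma closure_limitI:
  fixes f :: l2
  assumes "\<And>n. F n \<in> V" "F \<longlonglongrightarrow> f"
  shows "f \<in> closure V"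
  unfolding closure_sequential by (rule exI[of _ F]) (use assms in simp)

lemma closure_Dom_D_linear:
  assumes "f \<in> closure Dom_D" "g \<in> closure Dom_D"
  shows "f + g \<in> closure Dom_D" "- f \<in> closure Dom_D"
proof -
  obtain F G where F: "\<And>n. F n \<in> Dom_D" "F \<longlonglongrightarrow> f" and G: "\<And>n. G n \<in> Dom_D" "G \<longlonglongrightarrow> g"
    using assms unfolding closure_sequential by blast
  have "F n + G n \<in> Dom_D" for n
    using Dom_D_linear(1)[OF F(1) G(1), of n 1 n] by simp
  then show "f + g \<in> closure Dom_D" by (rule closure_limitI[OF _ tendsto_add[OF F(2) G(2)]])
  have "- F n \<in> Dom_D" for n
    using Dom_D_linear(1)[OF zero_Dom_D F(1), of "- 1" n] by simp
  then show "- f \<in> closure Dom_D" by (rule closure_limitI[OF _ tendsto_minus[OF F(2)]])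
qed

lemma closure_Dom_D_sum:
  assumes "finite I" "\<And>i. i \<in> I \<Longrightarrow> u i \<in> closure Dom_D"
  shows "(\<Sum>i\<in>I. u i) \<in> closure Dom_D"
  using assms
proof (induction I rule: finite_induct)
  case empty
  then show ?case using zero_Dom_D closure_subset by auto
qed (auto intro: closure_Dom_D_linear)

text \<open>A test function vanishes near both end points, so it meets the Dirichlet and the Neumann
  conditions at once, in any direction \<open>e\<close>.\<close>

lemma test_function_in_Dom_D:
  assumes "test_function \<psi>"
  shows "abs_l2 (\<lambda>x. \<psi> x *\<^sub>R e) \<in> Dom_D"
proof -
  have v: "((\<lambda>x. \<phi> x *\<^sub>R e) has_vector_derivative deriv \<phi> x *\<^sub>R e) (at x within S)"
    if "test_function \<phi>" for \<phi> x S
    using has_vector_derivative_scaleR[OF has_field_derivative_at_within[OF test_function_has_real_derivative(1)[OF that]]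
      has_vector_derivative_const] by simp
  have d: "test_function (deriv \<psi>)" "test_function (deriv (deriv \<psi>))"
    using assms by (auto intro: test_function_deriv)
  have "strong_deriv2 (abs_l2 (\<lambda>x. \<psi> x *\<^sub>R e)) (abs_l2 (\<lambda>x. deriv (deriv \<psi>) x *\<^sub>R e)) (\<lambda>x. \<psi> x *\<^sub>R e) (\<lambda>x. deriv \<psi> x *\<^sub>R e)"
  proof (rule strong_deriv2_abs[OF v[OF assms]])
    show "square_integrable (\<lambda>x. deriv (deriv \<psi>) x *\<^sub>R e)"
      by (intro square_integrable_continuous continuous_intros test_function_continuous d)
    show "deriv \<psi> x *\<^sub>R e = deriv \<psi> 0 *\<^sub>R e + integral {0..x} (\<lambda>x. deriv (deriv \<psi>) x *\<^sub>R e)" if "x \<in> {0..1}" for x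
      using integral_has_vector_derivative_Icc(1)[OF v[OF d(1)], of 0 x] that by simp
  qed
  then show ?thesis
    by (rule Dom_D_I(1)) (simp add: boundary_conditions_def test_function_boundary[OF assms] test_function_boundary[OF d(1)])
qed

lemma square_integrable_indicator:
  assumes "E \<in> sets lebesgue"
  shows "square_integrable (\<lambda>x. indicator E x *\<^sub>R e)"
  unfolding square_integrable_def
proof
  interpret finite_measure I01 by (rule finite_measure_I01)
  have [measurable]: "indicator E \<in> borel_measurable I01"
    using assms by (intro measurable_restrict_space1) simp
  show "(\<lambda>x. indicator E x *\<^sub>R e) \<in> borel_measurable I01" by measurable
  show "integrable I01 (\<lambda>x. (norm (indicator E x *\<^sub>R e))\<^sup>2)"
  proof (rule integrable_const_bound[of _ "(norm e)\<^sup>2"])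
    show "(\<lambda>x. (norm (indicator E x *\<^sub>R e))\<^sup>2) \<in> borel_measurable I01" by measurable
  qed (auto simp: indicator_def)
qed

lemma interval_in_closure_Dom_D:
  "abs_l2 (\<lambda>x. indicator {a<..<b} x *\<^sub>R e) \<in> closure Dom_D"
proof -
  interpret finite_measure I01 by (rule finite_measure_I01)
  have "(\<lambda>n. abs_l2 (\<lambda>x. cutoff a b n x *\<^sub>R e)) \<longlonglongrightarrow> abs_l2 (\<lambda>x. indicator {a<..<b} x *\<^sub>R e)"
  proof (rule abs_l2_tendsto[where w="\<lambda>x. norm e"])
    show "square_integrable (\<lambda>x. cutoff a b n x *\<^sub>R e)" for n
      by (intro square_integrable_continuous continuous_intros cutoff_continuous)
    show "square_integrable (\<lambda>x. indicator {a<..<b} x *\<^sub>R e)"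
      by (rule square_integrable_indicator) simp
    show "AE x in I01. (\<lambda>n. cutoff a b n x *\<^sub>R e) \<longlonglongrightarrow> indicator {a<..<b} x *\<^sub>R e"
      by (rule AE_I2) (auto intro!: tendsto_scaleR cutoff_tendsto_indicator)
    show "AE x in I01. norm (cutoff a b n x *\<^sub>R e - indicator {a<..<b} x *\<^sub>R e) \<le> norm e" for n
    proof (rule AE_I2)
      fix x
      have "\<bar>cutoff a b n x - indicator {a<..<b} x\<bar> \<le> 1"
        using cutoff_bounds[of a b n x] by (auto simp: indicator_def)
      then have "\<bar>cutoff a b n x - indicator {a<..<b} x\<bar> * norm e \<le> norm e"
        by (intro mult_left_le_one_le) auto
      then show "norm (cutoff a b n x *\<^sub>R e - indicator {a<..<b} x *\<^sub>R e) \<le> norm e"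
        by (simp add: scaleR_left_diff_distrib[symmetric])
    qed
  qed simp
  then show ?thesis
    by (rule closure_limitI[OF test_function_in_Dom_D[OF test_function_cutoff]])
qed

text \<open>The closure contains the interval indicators and is stable under sums, negation and
  limits, which is all that set induction asks for. The vector \<open>e\<close> is arbitrary, so
  every value of a simple function is covered.\<close>

lemma indicator_in_closure_Dom_D:
  assumes "E \<in> sets lebesgue"
  shows "abs_l2 (\<lambda>x. indicator E x *\<^sub>R e) \<in> closure Dom_D"
  using assms
proof (induction rule: sets_I01_induct)
  case (null A B)
  have "abs_l2 (\<lambda>x. indicator B x *\<^sub>R e) = abs_l2 (\<lambda>x. indicator A x *\<^sub>R e)"
  proof (rule abs_l2_cong)
    show "AE x in I01. indicator B x *\<^sub>R e = indicator A x *\<^sub>R e"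
      using null.hyps(3) by eventually_elim (simp add: indicator_def)
  qed (intro square_integrable_indicator null)+
  with null show ?case by simp
next
  case (interval a b)
  show ?case by (rule interval_in_closure_Dom_D)
next
  case (compl A)
  \<comment> \<open>Almost everywhere on (0, 1) the indicator of (-1, 2) is 1, so it stands for the
    constant function in the interval case.\<close>
  have "abs_l2 (\<lambda>x. indicator (- A) x *\<^sub>R e) = abs_l2 (\<lambda>x. indicator {-1<..<2} x *\<^sub>R e) + - abs_l2 (\<lambda>x. indicator A x *\<^sub>R e)"
  proof (rule l2_eqI)
    have s: "square_integrable (\<lambda>x. indicator {-1<..<2} x *\<^sub>R e)" "square_integrable (\<lambda>x. indicator A x *\<^sub>R e)"
      "square_integrable (\<lambda>x. indicator (- A) x *\<^sub>R e)"
      using compl.hyps sets.compl_sets[OF compl.hyps] by (auto intro!: square_integrable_indicator simp: Compl_eq_Diff_UNIV)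
    have "AE x in I01. x \<in> {0<..<1}" by (rule AE_I2) simp
    with rep_plus[of "abs_l2 (\<lambda>x. indicator {-1<..<2} x *\<^sub>R e)" "- abs_l2 (\<lambda>x. indicator A x *\<^sub>R e)"]
      rep_uminus[of "abs_l2 (\<lambda>x. indicator A x *\<^sub>R e)"] rep_abs_l2[OF s(1)] rep_abs_l2[OF s(2)] rep_abs_l2[OF s(3)]
    show "AE x in I01. rep_l2 (abs_l2 (\<lambda>x. indicator (- A) x *\<^sub>R e)) x =
        rep_l2 (abs_l2 (\<lambda>x. indicator {-1<..<2} x *\<^sub>R e) + - abs_l2 (\<lambda>x. indicator A x *\<^sub>R e)) x"
      by eventually_elim (auto simp: indicator_def)
  qed
  then show ?case
    using closure_Dom_D_linear(1)[OF interval_in_closure_Dom_D closure_Dom_D_linear(2)[OF compl.IH compl.IH]] by simp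
next
  case (union A)
  have sq: "square_integrable (\<lambda>x. indicator (A i) x *\<^sub>R e)" for i
    using union by (intro square_integrable_indicator) auto
  note sum = abs_l2_sum[of "{..<n}" "\<lambda>i x. indicator (A i) x *\<^sub>R e" for n, OF _ sq]
  interpret finite_measure I01 by (rule finite_measure_I01)
  have "(\<lambda>n. abs_l2 (\<lambda>x. \<Sum>i<n. indicator (A i) x *\<^sub>R e)) \<longlonglongrightarrow> abs_l2 (\<lambda>x. indicator (\<Union>i. A i) x *\<^sub>R e)"
  proof (rule abs_l2_tendsto[where w="\<lambda>x. norm e"])
    show "square_integrable (\<lambda>x. \<Sum>i<n. indicator (A i) x *\<^sub>R e)" for n using sum[of n] by simp
    show "square_integrable (\<lambda>x. indicator (\<Union>i. A i) x *\<^sub>R e)"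
      using union by (intro square_integrable_indicator) auto
    show "AE x in I01. (\<lambda>n. \<Sum>i<n. indicator (A i) x *\<^sub>R e) \<longlonglongrightarrow> indicator (\<Union>i. A i) x *\<^sub>R e"
      unfolding scaleR_sum_left[symmetric]
      using sum_indicator_disjoint_family(1)[OF union.hyps(1)] by (intro AE_I2 tendsto_intros)
    show "AE x in I01. norm ((\<Sum>i<n. indicator (A i) x *\<^sub>R e) - indicator (\<Union>i. A i) x *\<^sub>R e) \<le> norm e" for n
    proof (rule AE_I2)
      fix x
      have "\<bar>(\<Sum>i<n. indicator (A i) x) - indicator (\<Union>i. A i) x :: real\<bar> \<le> 1"
        using sum_indicator_disjoint_family(2,3)[OF union.hyps(1), of x n] by (auto simp: indicator_def)
      then have "\<bar>(\<Sum>i<n. indicator (A i) x) - indicator (\<Union>i. A i) x\<bar> * norm e \<le> norm e"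
        by (intro mult_left_le_one_le) auto
      then show "norm ((\<Sum>i<n. indicator (A i) x *\<^sub>R e) - indicator (\<Union>i. A i) x *\<^sub>R e) \<le> norm e"
        unfolding scaleR_sum_left[symmetric] scaleR_left_diff_distrib[symmetric] by simp
    qed
  qed simp
  moreover have "abs_l2 (\<lambda>x. \<Sum>i<n. indicator (A i) x *\<^sub>R e) \<in> closure Dom_D" for n
    using sum[of n] closure_Dom_D_sum[of "{..<n}" "\<lambda>i. abs_l2 (\<lambda>x. indicator (A i) x *\<^sub>R e)"] union.IH by simp
  ultimately show ?case by (rule closed_sequentially[OF closed_closure, rotated])
qed

lemma closure_Dom_D: "closure Dom_D = UNIV"
proof (intro equalityI subsetI UNIV_I)
  fix f :: l2
  have f: "rep_l2 f \<in> borel_measurable I01" using square_integrable_rep_l2 by (simp add: square_integrable_def)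
  obtain s where s: "\<And>i. simple_function I01 (s i)"
      "\<And>x. x \<in> space I01 \<Longrightarrow> (\<lambda>i. s i x) \<longlonglongrightarrow> rep_l2 f x"
      "\<And>i x. x \<in> space I01 \<Longrightarrow> dist (s i x) 0 \<le> 2 * dist (rep_l2 f x) 0"
    using borel_measurable_implies_sequence_metric[OF f, of 0] by blast
  have lvl: "s i -` {y} \<inter> space I01 \<in> sets lebesgue" for i y
  proof -
    have "s i -` {y} \<inter> space I01 \<in> sets I01" by (rule simple_functionD(2)[OF s(1)])
    then show ?thesis by (subst (asm) sets_restrict_space_iff) auto
  qed
  define u where "u i y x = indicator (s i -` {y} \<inter> space I01) x *\<^sub>R y" for i y x
  have u: "square_integrable (u i y)" "abs_l2 (u i y) \<in> closure Dom_D" for i y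
    unfolding u_def[abs_def] by (intro square_integrable_indicator indicator_in_closure_Dom_D lvl)+
  have fin: "finite (s i ` space I01)" for i by (rule simple_functionD(1)[OF s(1)])
  \<comment> \<open>The simple function is rewritten as the sum of its values over its level sets,
    so that the indicators above apply.\<close>
  define t where "t i x = (\<Sum>y\<in>s i ` space I01. u i y x)" for i x
  have t: "square_integrable (t i)" "abs_l2 (t i) \<in> closure Dom_D" for i
    using abs_l2_sum[of "s i ` space I01" "u i", OF fin u(1)] closure_Dom_D_sum[OF fin u(2)]
    by (simp_all add: t_def[abs_def])
  have ts: "t i x = s i x" if "x \<in> space I01" for i x
    unfolding t_def u_def using that fin[of i]
    by (subst sum.remove[of _ "s i x"]) (auto simp: indicator_def intro!: sum.neutral)
  have "(\<lambda>i. abs_l2 (t i)) \<longlonglongrightarrow> abs_l2 (rep_l2 f)"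
  proof (rule abs_l2_tendsto[OF t(1) square_integrable_rep_l2])
    show "AE x in I01. (\<lambda>n. t n x) \<longlonglongrightarrow> rep_l2 f x"
      by (rule AE_I2) (use s(2) ts in simp)
    \<comment> \<open>The approximants are bounded by twice the norm of the limit, and the limit
      itself adds one more.\<close>
    show "AE x in I01. norm (t n x - rep_l2 f x) \<le> 3 * norm (rep_l2 f x)" for n
    proof (rule AE_I2)
      fix x assume x: "x \<in> space I01"
      show "norm (t n x - rep_l2 f x) \<le> 3 * norm (rep_l2 f x)"
        using norm_triangle_ineq4[of "s n x" "rep_l2 f x"] s(3)[OF x, of n] by (simp add: ts[OF x])
    qed
    show "integrable I01 (\<lambda>x. (3 * norm (rep_l2 f x))\<^sup>2)"
      using square_integrable_rep_l2[of f] by (simp add: power_mult_distrib square_integrable_def)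
  qed
  then have "(\<lambda>i. abs_l2 (t i)) \<longlonglongrightarrow> f" by (simp add: abs_rep_l2)
  with t(2) show "f \<in> closure Dom_D" by (rule closed_sequentially[OF closed_closure])
qed

section \<open>Spectra\<close>

definition sym2 :: "real \<Rightarrow> real \<Rightarrow> real \<Rightarrow> complex ^ 2 ^ 2" where
  "sym2 p q r = vector [vector [of_real p, of_real q], vector [of_real q, of_real r]]"

lemma mat2_eq_iff: "A = B \<longleftrightarrow> A $ 1 $ 1 = B $ 1 $ 1 \<and> A $ 1 $ 2 = B $ 1 $ 2 \<and> A $ 2 $ 1 = B $ 2 $ 1 \<and> A $ 2 $ 2 = B $ 2 $ 2"
  for A B :: "'a ^ 2 ^ 2"
  by (simp add: vec_eq_iff forall_2)

lemma sym2_hermitian: "sym2 p q r $ i $ j = cnj (sym2 p q r $ j $ i)"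
  using exhaust_2[of i] exhaust_2[of j] by (auto simp: sym2_def)

lemma sym2_mult_eq:
  assumes "p * p' + q * q' = x" "p * q' + q * r' = y" "q * p' + r * q' = y" "q * q' + r * r' = w"
  shows "sym2 p q r ** sym2 p' q' r' = sym2 x y w"
  using assms[THEN arg_cong[of _ _ complex_of_real]]
  by (simp add: mat2_eq_iff sym2_def matrix_matrix_mult_def sum_2)

lemma sym2_one: "sym2 1 0 1 = mat 1"
  by (simp add: mat2_eq_iff sym2_def mat_def)

lemma A1_eq_sym2: "A1 a d = sym2 a 1 d"
  by (simp add: A1_def sym2_def)

lemma uminus_sym2: "- sym2 p q r = sym2 (- p) (- q) (- r)"
  by (simp add: mat2_eq_iff sym2_def)

text \<open>By Cayley-Hamilton, a root S of A with trace \<tau> and determinant \<delta> satisfies A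
  = \<tau> S - \<delta>, so S = (A + \<delta>) / \<tau>. Here \<delta>^2 is the determinant of A,
  and \<tau>^2 is its trace plus 2 \<delta>. The off-diagonal entry \<open>e\<close> is 1 for
  \<open>A1\<close> and -1 for its negative.\<close>

lemma sym2_sqrt:
  assumes "a > 0" "d > 0" "a * d > 1" "e\<^sup>2 = 1"
  obtains p q r p' q' r' where "sym2 p q r ** sym2 p q r = sym2 a e d"
    "sym2 p q r ** sym2 p' q' r' = mat 1" "sym2 p' q' r' ** sym2 p q r = mat 1"
proof -
  define \<delta> where "\<delta> = sqrt (a * d - 1)"
  have \<delta>: "\<delta> > 0" "\<delta>\<^sup>2 = a * d - 1" using assms by (auto simp: \<delta>_def)
  define \<tau> where "\<tau> = sqrt (a + d + 2 * \<delta>)"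
  have \<tau>: "\<tau> > 0" "\<tau>\<^sup>2 = a + d + 2 * \<delta>" using assms \<delta> by (auto simp: \<tau>_def)
  define p where "p = (a + \<delta>) / \<tau>"
  define q where "q = e / \<tau>"
  define r where "r = (d + \<delta>) / \<tau>"
  have "p * p + q * q = ((a + \<delta>)\<^sup>2 + e\<^sup>2) / \<tau>\<^sup>2"
    by (simp add: p_def q_def power2_eq_square flip: add_divide_distrib)
  also have "(a + \<delta>)\<^sup>2 + e\<^sup>2 = a * \<tau>\<^sup>2" unfolding \<tau>(2) assms(4) using \<delta>(2) by (simp add: power2_eq_square algebra_simps)
  finally have pp: "p * p + q * q = a" using \<tau>(1) by simp
  have "q * q + r * r = ((d + \<delta>)\<^sup>2 + e\<^sup>2) / \<tau>\<^sup>2"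
    by (simp add: r_def q_def power2_eq_square add.commute flip: add_divide_distrib)
  also have "(d + \<delta>)\<^sup>2 + e\<^sup>2 = d * \<tau>\<^sup>2" unfolding \<tau>(2) assms(4) using \<delta>(2) by (simp add: power2_eq_square algebra_simps)
  finally have rr: "q * q + r * r = d" using \<tau>(1) by simp
  have "p * q + q * r = ((a + \<delta>) * e + e * (d + \<delta>)) / \<tau>\<^sup>2"
    by (simp add: p_def q_def r_def power2_eq_square flip: add_divide_distrib)
  also have "(a + \<delta>) * e + e * (d + \<delta>) = e * \<tau>\<^sup>2" unfolding \<tau>(2) by (simp add: algebra_simps)
  finally have pq: "p * q + q * r = e" using \<tau>(1) by simp
  have "p * r - q * q = ((a + \<delta>) * (d + \<delta>) - e\<^sup>2) / \<tau>\<^sup>2"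
    by (simp add: p_def q_def r_def power2_eq_square flip: diff_divide_distrib)
  also have "(a + \<delta>) * (d + \<delta>) - e\<^sup>2 = \<delta> * \<tau>\<^sup>2" unfolding \<tau>(2) assms(4) using \<delta>(2) by (simp add: power2_eq_square algebra_simps)
  finally have det: "p * r - q * q = \<delta>" using \<tau>(1) by simp
  show thesis
  proof (rule that)
    show "sym2 p q r ** sym2 p q r = sym2 a e d"
      by (rule sym2_mult_eq) (use pp rr pq in \<open>simp_all add: algebra_simps\<close>)
    have inv: "(p * r - q * q) / \<delta> = 1" using det \<delta> by simp
    show "sym2 p q r ** sym2 (r / \<delta>) (- q / \<delta>) (p / \<delta>) = mat 1"
      unfolding sym2_one[symmetric]
      by (rule sym2_mult_eq) (use inv in \<open>simp_all add: diff_divide_distrib mult.commute\<close>)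
    show "sym2 (r / \<delta>) (- q / \<delta>) (p / \<delta>) ** sym2 p q r = mat 1"
      unfolding sym2_one[symmetric]
      by (rule sym2_mult_eq) (use inv in \<open>simp_all add: diff_divide_distrib mult.commute\<close>)
  qed
qed

text \<open>The discriminant (a - d)^2 + 4 is positive, so the eigenvalues are real and distinct.
  The first row of \<open>A1\<close> determines the eigenvector (1, m - a), and the characteristic
  equation, in the form (m - a) (m - d) = 1, takes care of the second row.\<close>

lemma A1_in_resolvent_set:
  assumes "a * d \<noteq> 1" "z \<noteq> 0"
    and ker: "\<And>f. f \<in> Dom_D \<Longrightarrow> - mat_app (A1 a d) (weak_deriv2 f) = z *\<^sub>C f \<Longrightarrow> f = 0"
  shows "z \<in> resolvent_set (op_AD (A1 a d))"
proof -
  define \<rho> where "\<rho> = sqrt ((a - d)\<^sup>2 + 4)"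
  have \<rho>: "\<rho> > 0" "\<rho>\<^sup>2 = (a - d)\<^sup>2 + 4" by (auto simp: \<rho>_def add_nonneg_pos)
  define m1 where "m1 = (a + d + \<rho>) / 2"
  define m2 where "m2 = (a + d - \<rho>) / 2"
  have ch: "(m1 - a) * (m1 - d) = 1" "(m2 - a) * (m2 - d) = 1"
    using \<rho>(2) by (simp_all add: m1_def m2_def power2_eq_square field_simps)
  \<comment> \<open>The eigenvalue 0 would turn the characteristic equation into a d = 1.\<close>
  have ne: "m1 \<noteq> 0" "m2 \<noteq> 0" using ch assms(1) by auto
  have eig: "A1 a d *v vector [1, of_real (m - a)] = of_real m *s vector [1, of_real (m - a)]"
    if "(m - a) * (m - d) = 1" for m
  proof -
    have "1 + d * (m - a) = m * (m - a)" using that by (simp add: algebra_simps)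
    from arg_cong[OF this, of complex_of_real] show ?thesis
      by (simp add: complex_vec2_eq_iff A1_def matrix_vector_mult_def sum_2)
  qed
  interpret shooting "A1 a d" z "of_real (m1 - a)" "of_real (m2 - a)" "of_real m1" "of_real m2"
  proof
    show "complex_of_real (m1 - a) \<noteq> complex_of_real (m2 - a)"
      using \<rho>(1) by (simp add: m1_def m2_def del: of_real_diff)
    show "A1 a d *v vector [1, of_real (m1 - a)] = of_real m1 *s vector [1, of_real (m1 - a)]"
      by (rule eig[OF ch(1)])
    show "A1 a d *v vector [1, of_real (m2 - a)] = of_real m2 *s vector [1, of_real (m2 - a)]"
      by (rule eig[OF ch(2)])
  qed (use ne assms(2) in auto)
  show ?thesis by (rule in_resolvent_set[OF ker])
qed

text \<open>\<open>T\<close> is the inverse of \<open>S\<close>, so the form of the inverse matrix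
  is the squared norm of T f and q is non-negative. For q > 0 the relation z q = E would place
  \<open>z\<close> in the half-line, so q = 0 and hence E = 0.\<close>

lemma op_AD_square_kernel_trivial:
  assumes TS: "T ** S = mat 1" and T: "\<And>i j. T $ i $ j = cnj (T $ j $ i)"
    and f: "f \<in> Dom_D" "- mat_app (S ** S) (weak_deriv2 f) = z *\<^sub>C f"
    and z: "z \<notin> complex_of_real ` {0..}"
  shows "f = 0"
proof (rule op_AD_kernel_trivial[OF f])
  show "(T ** T) ** (S ** S) = mat 1"
    using TS by (metis matrix_mul_assoc matrix_mul_lid)
  have "cnj (T $ 1 $ 2) = T $ 2 $ 1" "cnj (T $ 2 $ 1) = T $ 1 $ 2" "cnj (T $ 1 $ 1) = T $ 1 $ 1" "cnj (T $ 2 $ 2) = T $ 2 $ 2"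
    using T by metis+
  then show "(T ** T) $ i $ j = cnj ((T ** T) $ j $ i)" for i j
    using exhaust_2[of i] exhaust_2[of j] by (auto simp: matrix_matrix_mult_def sum_2 mult.commute)
  show "z \<noteq> 0" using z by auto
  fix q E :: real assume q: "cinner (mat_app (T ** T) f) f = of_real q" and E: "E \<ge> 0" "z * of_real q = of_real E"
  have "cinner (mat_app (T ** T) f) f = of_real ((norm (mat_app T f))\<^sup>2)"
    using cinner_mat_app[OF T, of "mat_app T f" f] by (simp add: cinner_self)
  then have "q = (norm (mat_app T f))\<^sup>2" using q by (metis of_real_eq_iff)
  then have "q \<ge> 0" by simp
  show "E = 0"
  proof (cases "q = 0")
    case False
    then have "z = of_real (E / q)" using E(2) by (simp add: field_simps)
    moreover have "E / q \<in> {0..}" using E(1) \<open>q \<ge> 0\<close> by simp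
    ultimately show ?thesis using z by blast
  qed (use E(2) in simp)
qed

lemma similar_nonneg_operator:
  assumes S: "\<And>i j. S $ i $ j = cnj (S $ j $ i)"
    and ST: "S ** T = mat 1" "T ** S = mat 1"
    and res: "\<And>z. z \<notin> complex_of_real ` {0..} \<Longrightarrow> z \<in> resolvent_set (op_AD (S ** S))"
  shows "\<exists>L. nonneg_operator L \<and> similar (op_AD (S ** S)) L"
proof -
  define K where "K = op_AD (S ** S)"
  define L where "L = (\<lambda>f. map_option (mat_app T) (K (mat_app S f)))"
  have STf: "mat_app S (mat_app T f) = f" "mat_app T (mat_app S f) = f" for f
    using ST by simp_all
  have K: "linear_operator K" unfolding K_def by (rule linear_operator_op_AD)
  have dL: "dom L = {f. mat_app S f \<in> Dom_D}" by (auto simp: L_def K_def op_AD_def dom_def)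
  have L: "the (L f) = mat_app T (the (K (mat_app S f)))" if "f \<in> dom L" for f
    using that by (auto simp: dL L_def K_def op_AD_def)
  \<comment> \<open>One factor \<open>S\<close> cancels against \<open>T\<close>, which leaves S D
    S; with \<open>S\<close> hermitian and D symmetric, symmetry of \<open>L\<close> is
    immediate.\<close>
  have L': "the (L f) = - mat_app S (weak_deriv2 (mat_app S f))" if "f \<in> dom L" for f
    using that by (simp add: L) (simp add: dL K_def op_AD_apply matrix_mul_assoc ST)
  have lin: "linear_operator L"
    unfolding linear_operator_def
  proof (intro conjI ballI allI)
    show "0 \<in> dom L" by (simp add: dL zero_Dom_D)
    fix f assume f: "f \<in> dom L"
    have Sf: "mat_app S f \<in> dom K" using f by (simp add: dL K_def)
    show "L (f + g) = Some (the (L f) + the (L g))" if g: "g \<in> dom L" for g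
    proof -
      have "mat_app S g \<in> dom K" using g by (simp add: dL K_def)
      with K Sf have "K (mat_app S f + mat_app S g) = Some (the (K (mat_app S f)) + the (K (mat_app S g)))"
        unfolding linear_operator_def by blast
      then show ?thesis unfolding L[OF f] L[OF g] by (simp add: L_def mat_app_add)
    qed
    show "L (c *\<^sub>C f) = Some (c *\<^sub>C the (L f))" for c
    proof -
      have "K (c *\<^sub>C mat_app S f) = Some (c *\<^sub>C the (K (mat_app S f)))"
        using K Sf unfolding linear_operator_def by blast
      then show ?thesis unfolding L[OF f] by (simp add: L_def mat_app_scaleC)
    qed
  qed
  have resL: "z \<in> resolvent_set L" if "z \<in> resolvent_set K" for z
  proof -
    have r: "\<forall>f\<in>dom K. the (K f) - z *\<^sub>C f = 0 \<longrightarrow> f = 0"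
      "\<exists>C. \<forall>g. \<exists>f\<in>dom K. the (K f) - z *\<^sub>C f = g \<and> norm f \<le> C * norm g"
      using that unfolding resolvent_set_iff[OF K] by blast+
    from r(2) obtain C where C: "\<And>g. \<exists>f\<in>dom K. the (K f) - z *\<^sub>C f = g \<and> norm f \<le> C * norm g" by blast
    \<comment> \<open>This intertwining relation S (L - z) = (K - z) S carries injectivity and
      solvability from \<open>K\<close> to \<open>L\<close>; the bound picks up one factor for
      \<open>S\<close> and one for \<open>T\<close>.\<close>
    have e: "mat_app S (the (L f) - z *\<^sub>C f) = the (K (mat_app S f)) - z *\<^sub>C mat_app S f" if "f \<in> dom L" for f
      using mat_app_add[of S "the (L f)" "- (z *\<^sub>C f)"] by (simp add: L[OF that] mat_app_scaleC matrix_mul_assoc ST)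
    obtain k where k: "k \<ge> 0" "\<And>f. norm (mat_app S f) \<le> norm f * k"
      using bounded_linear.nonneg_bounded bounded_clinear_mat_app unfolding bounded_clinear_def by blast
    obtain t where t: "t \<ge> 0" "\<And>f. norm (mat_app T f) \<le> norm f * t"
      using bounded_linear.nonneg_bounded bounded_clinear_mat_app unfolding bounded_clinear_def by blast
    show ?thesis
      unfolding resolvent_set_iff[OF lin]
    proof (intro conjI ballI impI exI[of _ "\<bar>C\<bar> * k * t"] allI)
      fix f assume f: "f \<in> dom L" "the (L f) - z *\<^sub>C f = 0"
      have "mat_app S f \<in> dom K" using f(1) by (simp add: dL K_def)
      moreover have "the (K (mat_app S f)) - z *\<^sub>C mat_app S f = 0" using e[OF f(1)] f(2) by simp
      ultimately have "mat_app S f = 0" using r(1) by blast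
      then show "f = 0" using STf(2)[of f] by simp
    next
      fix g
      obtain h where h: "h \<in> dom K" "the (K h) - z *\<^sub>C h = mat_app S g" "norm h \<le> C * norm (mat_app S g)"
        using C by blast
      have Th: "mat_app T h \<in> dom L" using h(1) by (simp add: dL K_def ST)
      have "mat_app S (the (L (mat_app T h)) - z *\<^sub>C mat_app T h) = mat_app S g"
        using e[OF Th] h(2) by (simp add: ST)
      then have "the (L (mat_app T h)) - z *\<^sub>C mat_app T h = g" by (metis STf(2))
      moreover have "norm (mat_app T h) \<le> \<bar>C\<bar> * k * t * norm g"
      proof -
        \<comment> \<open>\<open>resolvent_set_iff\<close> provides no sign for \<open>C\<close>, so
          the monotonicity steps use its absolute value.\<close>
        have "norm h \<le> \<bar>C\<bar> * norm (mat_app S g)"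
          by (rule order_trans[OF h(3)]) (intro mult_right_mono abs_ge_self norm_ge_zero)
        also have "\<dots> \<le> \<bar>C\<bar> * (norm g * k)" by (intro mult_left_mono k) simp
        finally have "norm h * t \<le> \<bar>C\<bar> * (norm g * k) * t" by (rule mult_right_mono[OF _ t(1)])
        with t(2)[of h] show ?thesis by (simp add: algebra_simps)
      qed
      ultimately show "\<exists>f\<in>dom L. the (L f) - z *\<^sub>C f = g \<and> norm f \<le> \<bar>C\<bar> * k * t * norm g"
        using Th by blast
    qed
  qed
  have "densely_defined L"
  proof -
    \<comment> \<open>A continuous surjection maps the dense set \<open>Dom_D\<close> onto a dense
      set.\<close>
    have "dom L = mat_app T ` Dom_D"
    proof (intro equalityI subsetI)
      fix f assume "f \<in> dom L"
      then have "mat_app S f \<in> Dom_D" by (simp add: dL)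
      then show "f \<in> mat_app T ` Dom_D" by (rule rev_image_eqI) (simp only: STf)
    qed (auto simp: dL ST)
    moreover have "mat_app T ` closure Dom_D \<subseteq> closure (mat_app T ` Dom_D)"
      using bounded_clinear_mat_app[of T] unfolding bounded_clinear_def
      by (intro image_closure_subset linear_continuous_on closed_closure closure_subset) auto
    moreover have "mat_app T ` UNIV = UNIV" by (metis STf(2) surjI)
    ultimately show ?thesis using closure_Dom_D by (simp add: densely_defined_def top.extremum_unique)
  qed
  moreover have "cinner (the (L f)) g = cinner f (the (L g))" if "f \<in> dom L" "g \<in> dom L" for f g
    using that cinner_weak_deriv2_symmetric[of "mat_app S f" "mat_app S g"]
      cinner_mat_app[OF S, of "weak_deriv2 (mat_app S f)" g] cinner_mat_app[OF S, of f "weak_deriv2 (mat_app S g)"]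
    by (simp add: L' dL)
  moreover have "of_real (- 1) \<in> resolvent_set L" by (rule resL, unfold K_def, rule res) (auto simp: complex_eq_iff)
  ultimately have "self_adjoint L" by (rule self_adjointI[OF lin])
  moreover have "spec L \<subseteq> complex_of_real ` {0..}"
    using res resL by (auto simp: spec_def K_def)
  moreover have "similar K L"
    unfolding similar_def
  proof (intro exI[of _ "mat_app S"] conjI bounded_clinear_mat_app)
    show "bij (mat_app S)" by (rule o_bij[of "mat_app T"]) (simp_all add: fun_eq_iff ST)
    have i: "inv (mat_app S) = mat_app T" by (rule inv_equality) (simp_all only: STf)
    show "bounded_clinear (inv (mat_app S))" unfolding i by (rule bounded_clinear_mat_app)
    show "K = (\<lambda>f. map_option (mat_app S) (L (inv (mat_app S) f)))"
      unfolding i L_def by (simp add: STf option.map_comp o_def ST option.map_ident)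
  qed
  ultimately show ?thesis by (auto simp: nonneg_operator_def K_def)
qed

text \<open>Such a \<open>k\<close> would take only the values 0 and 1, by continuity even at every
  point, and yet run from 0 at x = 0 to 1 at x = 1.\<close>

lemma step_not_AE_continuous:
  fixes k :: "real \<Rightarrow> complex"
  assumes k: "continuous_on {0..1} k"
    and ae: "AE x in I01. k x = indicator {1/2<..} x"
  shows False
proof -
  \<comment> \<open>Multiplication by \<open>\<bar>x - 1/2\<bar>\<close> removes the jump of the
    step, so the almost-everywhere identity becomes one between continuous functions and can be read
    off at the end points.\<close>
  define p where "p x = k x * of_real \<bar>x - 1/2\<bar> - of_real (max 0 (x - 1/2))" for x :: real
  have pa: "AE x in I01. p x = 0"
    using ae
  proof eventually_elim
    case (elim x)
    then show ?case by (cases "1/2 < x") (simp_all add: p_def)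
  qed
  have pc: "continuous_on {0..1} p" unfolding p_def[abs_def] by (intro continuous_intros k)
  have p: "p x = 0" if "x \<in> {0..1}" for x
    by (rule continuous_AE_eq[OF pc continuous_on_const pa that])
  have "k 0 = 0" "k 1 = 1" using p[of 0] p[of 1] by (simp_all add: p_def)
  moreover have "continuous_on {0..1} (\<lambda>x. Re (k x))" by (intro continuous_intros k)
  ultimately obtain x where x: "0 \<le> x" "x \<le> 1" "Re (k x) = 1/2"
    using IVT'[of "\<lambda>x. Re (k x)" 0 "1/2" 1] by auto
  \<comment> \<open>Idempotence is a closed condition, so it passes from almost all points to the
    point where the real part of \<open>k\<close> is 1/2.\<close>
  have "AE x in I01. k x * k x = k x" using ae by eventually_elim (simp add: indicator_def)
  then have idem: "k x * k x = k x"
    by (rule continuous_AE_eq[rotated 2]) (use x in \<open>auto intro!: continuous_intros k\<close>)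
  then have "k x = 0 \<or> k x = 1" by simp
  then show False using x(3) by auto
qed

text \<open>If f were a preimage of the step in direction (1, 0), the functional below would
  eliminate the second derivative and exhibit the step as - z times a continuous function. This
  covers every \<open>z\<close>, including 0.\<close>

lemma spec_op_AD_singular:
  assumes "a * d = 1"
  shows "spec (op_AD (A1 a d)) = UNIV"
proof -
  have "z \<notin> resolvent_set (op_AD (A1 a d))" for z
  proof
    assume "z \<in> resolvent_set (op_AD (A1 a d))"
    then obtain f where f: "f \<in> Dom_D"
      "- mat_app (A1 a d) (weak_deriv2 f) - z *\<^sub>C f = abs_l2 (\<lambda>x. indicator {1/2<..} x *\<^sub>R vector [1, 0])"
      unfolding resolvent_set_iff[OF linear_operator_op_AD] by (metis dom_op_AD op_AD_apply option.sel)
    obtain F F' where F: "strong_deriv2 f (weak_deriv2 f) F F'" using Dom_D_E[OF f(1)] .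
    have FAE: "AE x in I01. rep_l2 f x = F x"
      and Fd: "\<And>x. x \<in> {0..1} \<Longrightarrow> (F has_vector_derivative F' x) (at x within {0..1})"
      using F unfolding strong_deriv2_def C1_representative_def by blast+
    have Fc: "continuous_on {0..1} F" by (rule continuous_on_vector_derivative) (use Fd in auto)
    \<comment> \<open>For a d = 1 the first row of \<open>A1\<close> is \<open>a\<close> times the
      second, so this combination annihilates its range; on (1, 0) it takes the value 1.\<close>
    let ?l = "\<lambda>v :: complex ^ 2. v $ 1 - of_real a * v $ 2"
    have lA: "?l (A1 a d *v v) = 0" for v
      using arg_cong[OF assms, of complex_of_real]
      by (simp add: A1_def matrix_vector_mult_def sum_2 algebra_simps mult.assoc[symmetric])
    have sq: "square_integrable (\<lambda>x. indicator {1/2<..} x *\<^sub>R vector [1, 0])"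
      by (rule square_integrable_indicator) simp
    have "AE x in I01. - z * ?l (F x) = indicator {1/2<..} x"
      using FAE rep_abs_l2[OF sq]
        rep_minus[of "- mat_app (A1 a d) (weak_deriv2 f)" "z *\<^sub>C f"] rep_uminus[of "mat_app (A1 a d) (weak_deriv2 f)"]
        rep_mat_app[of "A1 a d" "weak_deriv2 f"] rep_scaleC[of z f]
      unfolding f(2)
    proof eventually_elim
      case (elim x)
      have "- (A1 a d *v rep_l2 (weak_deriv2 f) x) - z *s F x = indicator {1/2<..} x *\<^sub>R vector [1, 0]"
        using elim by simp
      from arg_cong[OF this, of ?l] lA[of "rep_l2 (weak_deriv2 f) x"] show ?case
        by (simp add: algebra_simps indicator_def split: if_splits)
    qed
    moreover have "continuous_on {0..1} (\<lambda>x. - z * ?l (F x))"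
      by (intro continuous_intros Fc)
    ultimately show False by (rule step_not_AE_continuous[rotated])
  qed
  then show ?thesis by (auto simp: spec_def)
qed

theorem theorem19:
  fixes a d :: real
  shows "(a * d = 1 \<longrightarrow> spec (op_AD (A1 a d)) = UNIV) \<and>
    (a * d > 1 \<and> a > 0 \<and> d > 0 \<longrightarrow>
       (\<exists>L. nonneg_operator L \<and> similar (op_AD (A1 a d)) L) \<and>
       spec (op_AD (A1 a d)) \<subseteq> complex_of_real ` {0..}) \<and>
    (a * d > 1 \<and> a < 0 \<and> d < 0 \<longrightarrow>
       (\<exists>L. nonneg_operator L \<and> similar (neg_op (op_AD (A1 a d))) L) \<and>
       spec (op_AD (A1 a d)) \<subseteq> complex_of_real ` {..0}) \<and>
    (a * d < 1 \<longrightarrow> spec (op_AD (A1 a d)) \<subseteq> \<real>)"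
proof (intro conjI impI)
  show "spec (op_AD (A1 a d)) = UNIV" if "a * d = 1" using that by (rule spec_op_AD_singular)
next
  assume ad: "a * d > 1 \<and> a > 0 \<and> d > 0"
  obtain p q r p' q' r' where S: "sym2 p q r ** sym2 p q r = sym2 a 1 d"
    "sym2 p q r ** sym2 p' q' r' = mat 1" "sym2 p' q' r' ** sym2 p q r = mat 1"
    by (rule sym2_sqrt[of a d 1]) (use ad in auto)
  have res: "z \<in> resolvent_set (op_AD (A1 a d))" if "z \<notin> complex_of_real ` {0..}" for z
  proof (rule A1_in_resolvent_set)
    show "f = 0" if "f \<in> Dom_D" "- mat_app (A1 a d) (weak_deriv2 f) = z *\<^sub>C f" for f
      using op_AD_square_kernel_trivial[OF S(3) sym2_hermitian that(1)[unfolded A1_eq_sym2] _ \<open>z \<notin> _\<close>] that(2)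
      by (simp add: S(1) A1_eq_sym2)
  qed (use ad that in auto)
  show "\<exists>L. nonneg_operator L \<and> similar (op_AD (A1 a d)) L"
    using similar_nonneg_operator[OF sym2_hermitian S(2,3)] res by (simp add: S(1) A1_eq_sym2)
  show "spec (op_AD (A1 a d)) \<subseteq> complex_of_real ` {0..}"
    using res by (auto simp: spec_def)
next
  assume ad: "a * d > 1 \<and> a < 0 \<and> d < 0"
  \<comment> \<open>With both diagonal entries negative, it is - A1 that is positive definite, with
    off-diagonal entry -1.\<close>
  obtain p q r p' q' r' where S: "sym2 p q r ** sym2 p q r = sym2 (- a) (- 1) (- d)"
    "sym2 p q r ** sym2 p' q' r' = mat 1" "sym2 p' q' r' ** sym2 p q r = mat 1"
    by (rule sym2_sqrt[of "- a" "- d" "- 1"]) (use ad in auto)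
  have SA: "sym2 p q r ** sym2 p q r = - A1 a d" by (simp add: S(1) A1_eq_sym2 uminus_sym2)
  have res: "- z \<in> resolvent_set (op_AD (A1 a d))" if z: "z \<notin> complex_of_real ` {0..}" for z
  proof (rule A1_in_resolvent_set)
    fix f assume f: "f \<in> Dom_D" "- mat_app (A1 a d) (weak_deriv2 f) = (- z) *\<^sub>C f"
    show "f = 0"
    proof (rule op_AD_square_kernel_trivial[OF S(3) sym2_hermitian f(1) _ z])
      show "- mat_app (sym2 p q r ** sym2 p q r) (weak_deriv2 f) = z *\<^sub>C f"
        using f(2) by (simp add: SA mat_app_uminus)
    qed
  qed (use ad z in auto)
  show "\<exists>L. nonneg_operator L \<and> similar (neg_op (op_AD (A1 a d))) L"
    using similar_nonneg_operator[OF sym2_hermitian S(2,3)] resolvent_set_op_AD_uminus[OF res]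
    by (simp add: SA neg_op_op_AD)
  show "spec (op_AD (A1 a d)) \<subseteq> complex_of_real ` {..0}"
  proof
    fix z assume z: "z \<in> spec (op_AD (A1 a d))"
    then have "- z \<in> complex_of_real ` {0..}" using res[of "- z"] by (auto simp: spec_def)
    then obtain x where "- z = of_real x" "x \<ge> 0" by auto
    then have "z = of_real (- x)" by (metis minus_minus of_real_minus)
    then show "z \<in> complex_of_real ` {..0}" using \<open>x \<ge> 0\<close> by auto
  qed
next
  assume ad: "a * d < 1"
  have "z \<in> resolvent_set (op_AD (A1 a d))" if z: "z \<notin> \<real>" for z
  proof (rule A1_in_resolvent_set)
    fix f assume f: "f \<in> Dom_D" "- mat_app (A1 a d) (weak_deriv2 f) = z *\<^sub>C f"
    define \<delta> where "\<delta> = a * d - 1"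
    have \<delta>: "(a * d - 1) / \<delta> = 1" using ad by (simp add: \<delta>_def)
    show "f = 0"
    proof (rule op_AD_kernel_trivial[OF f])
      \<comment> \<open>The adjugate of \<open>A1\<close> divided by its determinant \<delta>, which
        is non-zero since it is negative here.\<close>
      show "sym2 (d / \<delta>) (- 1 / \<delta>) (a / \<delta>) ** A1 a d = mat 1"
        unfolding A1_eq_sym2 sym2_one[symmetric]
        by (rule sym2_mult_eq) (use \<delta> in \<open>simp_all add: diff_divide_distrib mult.commute\<close>)
      show "z \<noteq> 0" using z by auto
      fix q E :: real assume "z * of_real q = of_real E"
      \<comment> \<open>The form may take either sign, but for non-real \<open>z\<close> the
        imaginary part of z q = E forces q = 0, and the real part then gives E = 0.\<close>
      then have "Im z * q = 0" "Re z * q = E" by (auto simp: complex_eq_iff)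
      then show "E = 0" using z by (auto simp: complex_is_Real_iff)
    qed (rule sym2_hermitian)
  qed (use ad z in auto)
  then show "spec (op_AD (A1 a d)) \<subseteq> \<real>" by (auto simp: spec_def)
qed

end
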